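(* Let $\lambda$ be a partition of length $p$ with $\lambda_1=r$, and let $\lambda'=(\lambda'_1,\ldots,\lambda'_r)$ be its conjugate. Then the following two statements hold. ($H$-type) Let $m$ be a positive integer, $\boldsymbol{s}=(s_{ij})\in T(\lambda,\mathbb{C})$, and let $\boldsymbol{t}\in T((m),\mathbb{C})$ be the one-row tableau with entries $t_1,t_2,\ldots,t_m$ from left to right. Suppose that the real parts of all $s_{ij}$ and $t_k$ are greater than or equal to $1$, and that the real parts of $$t_1,\ldots,t_{\min\{m,r-1\}},\ s_{11},\ldots,s_{\lambda'_2 1},\ s_{12},\ldots,s_{\lambda'_2 2},\ s_{13},\ldots,s_{\lambda'_3 3},\ \ldots,\ s_{1r},\ldots,s_{\lambda'_r r},\ t_m,\ s_{\lambda'_1 1}$$ are greater than $1$. Then $$\sum_{sym}\zeta_{\lambda}(\boldsymbol{s})\,\zeta_{(m)}(\boldsymbol{t})=\sum_{sym}\ \sum_{J\in\mathcal{H}(\lambda,m)}\zeta_{\lambda^J}(\boldsymbol{u}^J(\boldsymbol{s},\boldsymbol{t})),$$ where $\sum_{sym}$ means the summation over all permutations of $$\{t_1,\ldots,t_{\min\{m,r-1\}},\ s_{11},\ldots,s_{\lambda'_2 1},\ s_{12},\ldots,s_{\lambda'_2 2},\ s_{13},\ldots,s_{\lambda'_3 3},\ \ldots,\ s_{1r},\ldots,s_{\lambda'_r r}\}$$ as indeterminates. ($E$-type) Let $n$ be a positive integer, let $\boldsymbol{s}\in T((1^n),\mathbb{C})$ be the one-column tableau with entries $s_1,s_2,\ldots,s_n$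 from top to bottom, and let $\boldsymbol{t}=(t_{ij})\in T(\lambda,\mathbb{C})$. Suppose that the real parts of all $t_{ij}$ and $s_k$ are greater than or equal to $1$, and that the real parts of $$s_1,\ldots,s_{\min\{n,p-1\}},\ t_{11},\ldots,t_{1\lambda_2},\ t_{21},\ldots,t_{2\lambda_2},\ t_{31},\ldots,t_{3\lambda_3},\ \ldots,\ t_{p1},\ldots,t_{p\lambda_p},\ s_n,\ t_{1\lambda_1}$$ are greater than $1$. Then $$\sum_{sym}\zeta_{(1^n)}(\boldsymbol{s})\,\zeta_{\lambda}(\boldsymbol{t})=\sum_{sym}\ \sum_{K\in\mathcal{E}(\lambda,n)}\zeta_{\lambda_K}(\boldsymbol{u}_K(\boldsymbol{s},\boldsymbol{t})),$$ where $\sum_{sym}$ means the summation over all permutations of $$\{s_1,\ldots,s_{\min\{n,p-1\}},\ t_{11},\ldots,t_{1\lambda_2},\ t_{21},\ldots,t_{2\lambda_2},\ t_{31},\ldots,t_{3\lambda_3},\ \ldots,\ t_{p1},\ldots,t_{p\lambda_p}\}$$ as indeterminates.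
   Context: Partitions and tableaux. A partition $\lambda=(\lambda_1\ge\lambda_2\ge\cdots\ge 0)$ has length $l(\lambda)$ (number of nonzero parts), with $\lambda_k=0$ for $k>l(\lambda)$; its Young diagram is $D(\lambda)=\{(i,j)\in\mathbb{Z}^2\mid 1\le i\le l(\lambda),\ 1\le j\le\lambda_i\}$ ($i$ is the row, counted from the top; $j$ is the column), and $\lambda'$ is its conjugate. For a set $X$, $T(\lambda,X)$ is the set of all fillings $(t_{ij})_{(i,j)\in D(\lambda)}$ of $D(\lambda)$ with elements of $X$. $SSYT(\lambda)\subset T(\lambda,\mathbb{N})$ is the set of semistandard Young tableaux of shape $\lambda$ (positive integer entries, rows weakly increasing, columns strictly increasing). $(m)$ is the one-row partition and $(1^n)$ the one-column partition. Schur multiple zeta function. For $\boldsymbol{s}=(s_{ij})\in T(\lambda,\mathbb{C})$, $$\zeta_\lambda(\boldsymbol{s})=\sum_{M\in SSYT(\lambda)}\frac{1}{M^{\boldsymbol{s}}},\qquad M^{\boldsymbol{s}}=\prod_{(i,j)\in D(\lambda)}m_{ij}^{s_{ij}}\quad\text{for } M=(m_{ij}).$$ The sets $\mathcal{E}$ and $\mathcal{H}$. For a partition $\lambda$ and a positive integer $n$, $\mathcal{E}(\lambda,n)$ is the set of all subsets $K\subset\mathbb{Z}_{>0}$ with $\#K=n$ such that the sequence $\lambda_K$ given by $(\lambda_K)_k=\lambda_k+1$ if $k\in K$ and $(\lambda_K)_k=\lambda_k$ if $k\notin K$ is a partition. For a partition $\mu$ and a positive integer $m$, $\mathcal{H}(\mu,m)=\mathcal{E}(\mu',m)$,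 and for $J\in\mathcal{H}(\mu,m)$, $\mu^J=((\mu')_J)'$. Pushing rule. For $J=\{\alpha_1<\cdots<\alpha_m\}\in\mathcal{H}(\lambda,m)$, $\boldsymbol{s}\in T(\lambda,\mathbb{C})$ and $\boldsymbol{t}\in T((m),\mathbb{C})$ with entries $t_1,\ldots,t_m$, $\boldsymbol{u}^J(\boldsymbol{s},\boldsymbol{t})\in T(\lambda^J,\mathbb{C})$ is obtained by putting $t_k$ into box $(1,\alpha_k)$ for $k=1,\ldots,m$ and, for each $(i,j)\in D(\lambda)$, putting $s_{ij}$ into box $(i,j)$ if $j\notin J$ and into box $(i+1,j)$ if $j\in J$. For $K=\{\beta_1<\cdots<\beta_n\}\in\mathcal{E}(\lambda,n)$, $\boldsymbol{s}\in T((1^n),\mathbb{C})$ with entries $s_1,\ldots,s_n$ and $\boldsymbol{t}\in T(\lambda,\mathbb{C})$, $\boldsymbol{u}_K(\boldsymbol{s},\boldsymbol{t})\in T(\lambda_K,\mathbb{C})$ is obtained by putting $s_k$ into box $(\beta_k,1)$ for $k=1,\ldots,n$ and, for each $(i,j)\in D(\lambda)$, putting $t_{ij}$ into box $(i,j)$ if $i\notin K$ and into box $(i,j+1)$ if $i\in K$. Reading of the lists. In the $H$-type list, the $s$-blocks are $s_{i1}$ for $1\le i\le\lambda'_2$, and $s_{ij}$ for $2\le j\le r$, $1\le i\le\lambda'_j$ (with $\lambda'_2=0$ if $r=1$). In the $E$-type list, the $t$-blocks are $t_{1j}$ for $1\le j\le\lambda_2$, and $t_{ij}$ for $2\le i\le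 p$, $1\le j\le\lambda_i$ (with $\lambda_2=0$ if $p=1$). Empty ranges contribute nothing. Symmetrization. $\sum_{sym}$ over a set of variables treats them as distinct indeterminates (even if some of their complex values coincide): one sums, over all permutations $\sigma$ of this set, the expression obtained by simultaneously replacing each variable $x$ in the set by $\sigma(x)$ throughout the expression, leaving all other variables fixed. *)

theory Defs
  imports "HOL-Analysis.Analysis" "HOL-Combinatorics.Permutations"
begin

text \<open>
  A partition is the sequence of its parts, indexed from 1; the value at the unused index 0 is
  normalised to 0. The empty partition is included.
\<close>

definition is_partition :: "(nat \<Rightarrow> nat) \<Rightarrow> bool" where
  "is_partition lam \<longleftrightarrow>
     lam 0 = 0 \<and> (\<forall>i\<ge>1. lam (i + 1) \<le> lam i) \<and> finite {i. lam i \<noteq> 0}"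

definition part_length :: "(nat \<Rightarrow> nat) \<Rightarrow> nat" where
  "part_length lam = card {i. i \<ge> 1 \<and> lam i \<noteq> 0}"

definition diagram :: "(nat \<Rightarrow> nat) \<Rightarrow> (nat \<times> nat) set" where
  "diagram lam = {(i, j). 1 \<le> i \<and> i \<le> part_length lam \<and> 1 \<le> j \<and> j \<le> lam i}"

definition conj_part :: "(nat \<Rightarrow> nat) \<Rightarrow> nat \<Rightarrow> nat" where
  "conj_part lam j = card {i. (i, j) \<in> diagram lam}"

definition one_row :: "nat \<Rightarrow> nat \<Rightarrow> nat" where
  "one_row m = (\<lambda>i. if i = 1 then m else 0)"

definition one_column :: "nat \<Rightarrow> nat \<Rightarrow> nat" where
  "one_column n = (\<lambda>i. if 1 \<le> i \<and> i \<le> n then 1 else 0)"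

text \<open>
  Fillings are extensional functions (\<open>undefined\<close> off the diagram), so that each filling is
  represented exactly once in the series below.
\<close>

definition fillings :: "(nat \<Rightarrow> nat) \<Rightarrow> 'a set \<Rightarrow> (nat \<times> nat \<Rightarrow> 'a) set" where
  "fillings lam X = diagram lam \<rightarrow>\<^sub>E X"

definition SSYT :: "(nat \<Rightarrow> nat) \<Rightarrow> (nat \<times> nat \<Rightarrow> nat) set" where
  "SSYT lam = {M \<in> fillings lam {1..}.
     (\<forall>i j. (i, j) \<in> diagram lam \<and> (i, j + 1) \<in> diagram lam \<longrightarrow> M (i, j) \<le> M (i, j + 1)) \<and>
     (\<forall>i j. (i, j) \<in> diagram lam \<and> (i + 1, j) \<in> diagram lam \<longrightarrow> M (i, j) < M (i + 1, j))}"

definition schur_zeta :: "(nat \<Rightarrow> nat) \<Rightarrow> (nat \<times> nat \<Rightarrow> complex) \<Rightarrow> complex" where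
  "schur_zeta lam s =
     (\<Sum>\<^sub>\<infinity>M\<in>SSYT lam. 1 / (\<Prod>b\<in>diagram lam. of_nat (M b) powr s b))"

definition add_rows :: "(nat \<Rightarrow> nat) \<Rightarrow> nat set \<Rightarrow> nat \<Rightarrow> nat" where
  "add_rows lam K = (\<lambda>k. if k \<in> K then lam k + 1 else lam k)"

definition E_set :: "(nat \<Rightarrow> nat) \<Rightarrow> nat \<Rightarrow> nat set set" where
  "E_set lam n = {K. K \<subseteq> {1..} \<and> finite K \<and> card K = n \<and> is_partition (add_rows lam K)}"

definition H_set :: "(nat \<Rightarrow> nat) \<Rightarrow> nat \<Rightarrow> nat set set" where
  "H_set mu m = E_set (conj_part mu) m"

definition add_columns :: "(nat \<Rightarrow> nat) \<Rightarrow> nat set \<Rightarrow> nat \<Rightarrow> nat" where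
  "add_columns mu J = conj_part (add_rows (conj_part mu) J)"

text \<open>
  Pushing rules. The index \<open>k\<close> with \<open>j = \<alpha>\<^sub>k\<close> in \<open>J = {\<alpha>\<^sub>1 < \<dots> < \<alpha>\<^sub>m}\<close> is the number of elements of
  \<open>J\<close> that are at most \<open>j\<close>.
\<close>

definition push_columns ::
  "(nat \<Rightarrow> nat) \<Rightarrow> nat set \<Rightarrow> (nat \<times> nat \<Rightarrow> 'a) \<Rightarrow> (nat \<times> nat \<Rightarrow> 'a) \<Rightarrow> nat \<times> nat \<Rightarrow> 'a" where
  "push_columns lam J s t = restrict
     (\<lambda>(i, j). if j \<in> J then (if i = 1 then t (1, card {a \<in> J. a \<le> j}) else s (i - 1, j))
               else s (i, j))
     (diagram (add_columns lam J))"

definition push_rows ::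
  "(nat \<Rightarrow> nat) \<Rightarrow> nat set \<Rightarrow> (nat \<times> nat \<Rightarrow> 'a) \<Rightarrow> (nat \<times> nat \<Rightarrow> 'a) \<Rightarrow> nat \<times> nat \<Rightarrow> 'a" where
  "push_rows lam K s t = restrict
     (\<lambda>(i, j). if i \<in> K then (if j = 1 then s (card {b \<in> K. b \<le> i}, 1) else t (i, j - 1))
               else t (i, j))
     (diagram (add_rows lam K))"

text \<open>
  Indeterminates: \<open>Inl b\<close> stands for the entry of \<open>s\<close> in box \<open>b\<close>, \<open>Inr b\<close> for that of \<open>t\<close>.
  An expression in the indeterminates is a function \<open>F\<close> of their values \<open>v\<close>; replacing every
  indeterminate \<open>x\<close> by \<open>\<sigma> x\<close> in it amounts to evaluating \<open>F\<close> at \<open>v \<circ> \<sigma>\<close>.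
\<close>

type_synonym indet = "(nat \<times> nat) + (nat \<times> nat)"

definition sym_sum ::
  "indet set \<Rightarrow> ((indet \<Rightarrow> complex) \<Rightarrow> complex) \<Rightarrow> (indet \<Rightarrow> complex) \<Rightarrow> complex" where
  "sym_sum V F v = (\<Sum>\<sigma> | \<sigma> permutes V. F (v \<circ> \<sigma>))"

definition H_indets :: "(nat \<Rightarrow> nat) \<Rightarrow> nat \<Rightarrow> indet set" where
  "H_indets lam m =
     {Inr (1, k) | k. 1 \<le> k \<and> k \<le> min m (lam 1 - 1)} \<union>
     {Inl (i, 1) | i. 1 \<le> i \<and> i \<le> conj_part lam 2} \<union>
     {Inl (i, j) | i j. 2 \<le> j \<and> j \<le> lam 1 \<and> 1 \<le> i \<and> i \<le> conj_part lam j}"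

definition E_indets :: "(nat \<Rightarrow> nat) \<Rightarrow> nat \<Rightarrow> indet set" where
  "E_indets lam n =
     {Inl (k, 1) | k. 1 \<le> k \<and> k \<le> min n (part_length lam - 1)} \<union>
     {Inr (1, j) | j. 1 \<le> j \<and> j \<le> lam 2} \<union>
     {Inr (i, j) | i j. 2 \<le> i \<and> i \<le> part_length lam \<and> 1 \<le> j \<and> j \<le> lam i}"

end

theory Submission
  imports Defs
begin

text \<open>
  A semistandard tableau is the chain of partitions occupied by its entries at most \<open>v\<close>, consecutive
  partitions differing by a horizontal strip. Both identities come from the Pieri bijections between
  pairs of tableaux and tableaux of an enlarged shape, realised as growth diagrams: a local rule turns
  the chain of the tableau of shape \<open>lam\<close> and the content of the row (column) into the chain of the
  enlarged tableau, and can be run backwards.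

  The bijection preserves the multiset of entries, and it does not change the entries attached to
  the indeterminates outside the symmetrised set: those belong to the part of the row (column) that
  reaches beyond \<open>lam\<close>, and to the part of the first column (row) of \<open>lam\<close> that sticks out beyond the
  second, which is at most shifted as a whole. Hence the labels of the two sides differ, for each pair
  of tableaux, by a permutation of the symmetrised set only, and this permutation is absorbed by the
  sum over all permutations. Absolute convergence is needed only for the two factors on the left.
\<close>

section \<open>Partitions and diagrams\<close>

text \<open>Insertion and the pushing rule do not match box by box: insertion moves an entry along a
  bumping route, the pushing rule moves a whole column or row. The exponent attached to an entry
  therefore changes, and no equality of single terms can be expected. The exact routes are
  irrelevant, though: two assignments of entries to indeterminates with equally many entries below
  every threshold, which agree off the symmetrised set, differ by some permutation of that set. So
  only sizes of shapes and the history of a few boundary boxes have to be extracted, and both are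
  visible in the local rule; no insertion is carried out letter by letter.

  The bounds min{m, r-1} and min{n, p-1} come from a saturation effect. As soon as the enlarged
  first row (column) is at least as long as that of \<open>lam\<close>, it grows only by newly
  inserted letters. Once k \<ge> r (k \<ge> p) letters have arrived it is saturated, so as many
  boxes as letters are still to come, and this fixes the box of the k-th letter.\<close>

text \<open>Lengths, conjugate parts and the shapes of a tableau chain are all defined as
  cardinalities. Recognising such a set as an initial segment turns membership into comparison with
  its cardinality, the form in which all of them are used.\<close>

lemma down_closed_eq_atLeastAtMost:
  fixes S :: "nat set"
  assumes "finite S" "0 \<notin> S" and down: "\<And>x y. y \<in> S \<Longrightarrow> 1 \<le> x \<Longrightarrow> x \<le> y \<Longrightarrow> x \<in> S"
  shows "S = {1..card S}"
proof (cases "S = {}")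
  case False
  have "S = {1..Max S}"
    using down[OF Max_in[OF assms(1) False]] assms
    by (auto simp: Suc_le_eq intro!: Nat.gr0I)
  then show ?thesis by (metis card_atLeastAtMost diff_Suc_1)
qed auto

lemma is_partition_zero: "is_partition lam \<Longrightarrow> lam 0 = 0"
  by (simp add: is_partition_def)

lemma is_partition_antimono:
  assumes "is_partition lam" "1 \<le> i" "i \<le> j"
  shows "lam j \<le> lam i"
  using assms(3)
proof (induction rule: dec_induct)
  case (step n)
  then have "lam (Suc n) \<le> lam n"
    using assms by (auto simp: is_partition_def)
  with step show ?case by simp
qed simp

lemma part_length_iff:
  assumes "is_partition lam" "1 \<le> i"
  shows "i \<le> part_length lam \<longleftrightarrow> 1 \<le> lam i"
proof -
  define S where "S = {i. i \<ge> 1 \<and> lam i \<noteq> 0}"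
  have fin: "finite S"
    using assms by (auto simp: is_partition_def S_def elim: rev_finite_subset)
  have "S = {1..card S}"
    using is_partition_antimono[OF assms(1)]
    by (intro down_closed_eq_atLeastAtMost fin) (fastforce simp: S_def)+
  then have "i \<in> S \<longleftrightarrow> i \<le> card S"
    using assms by (metis atLeastAtMost_iff)
  then show ?thesis
    using assms by (auto simp: S_def part_length_def)
qed

lemma diagram_partition:
  assumes "is_partition lam"
  shows "diagram lam = {(i, j). 1 \<le> i \<and> 1 \<le> j \<and> j \<le> lam i}"
  using part_length_iff[OF assms] by (fastforce simp: diagram_def)

lemma diagram_rows: "diagram lam = Sigma {1..part_length lam} (\<lambda>i. {1..lam i})"
  by (auto simp: diagram_def)

lemma finite_diagram [simp, intro]: "finite (diagram lam)"
  by (simp add: diagram_rows)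

lemma card_diagram:
  assumes "is_partition lam" "\<And>i. q < i \<Longrightarrow> lam i = 0"
  shows "card (diagram lam) = (\<Sum>i\<in>{1..q}. lam i)"
proof -
  have "diagram lam = Sigma {1..q} (\<lambda>i. {1..lam i})"
    unfolding diagram_partition[OF assms(1)] using assms(2)
    by (auto simp: not_le intro: ccontr)
  then show ?thesis by simp
qed

lemma is_partition_bound:
  assumes "is_partition lam"
  obtains q where "\<And>i. q < i \<Longrightarrow> lam i = 0"
  using part_length_iff[OF assms]
  by (metis One_nat_def Suc_leI bot_nat_0.not_eq_extremum linorder_not_le not_less0)

section \<open>Conjugate partitions\<close>

text \<open>The boxes of a column form an initial segment because the parts decrease. This
  adjunction between \<open>lam\<close> and its conjugate replaces the cardinality in the later
  arguments about conjugates.\<close>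

lemma conj_part_iff:
  assumes "is_partition lam" "1 \<le> i" "1 \<le> j"
  shows "i \<le> conj_part lam j \<longleftrightarrow> j \<le> lam i"
proof -
  define S where "S = {i. (i, j) \<in> diagram lam}"
  have S: "S = {i. 1 \<le> i \<and> j \<le> lam i}"
    using assms by (auto simp: S_def diagram_partition)
  have fin: "finite S"
    by (rule finite_subset[of _ "fst ` diagram lam"]) (auto simp: S_def intro: rev_image_eqI)
  have "S = {1..card S}"
    using is_partition_antimono[OF assms(1)]
    by (intro down_closed_eq_atLeastAtMost fin) (fastforce simp: S)+
  then have "i \<in> S \<longleftrightarrow> i \<le> card S"
    using assms by (metis atLeastAtMost_iff)
  moreover have "conj_part lam j = card S"
    by (simp add: conj_part_def S_def)
  ultimately show ?thesis
    using assms by (auto simp: S)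
qed

lemma conj_part_0 [simp]: "conj_part lam 0 = 0"
  by (simp add: conj_part_def diagram_def)

lemma is_partition_conj_part:
  assumes "is_partition lam"
  shows "is_partition (conj_part lam)"
proof -
  have "conj_part lam (j + 1) \<le> conj_part lam j" if "1 \<le> j" for j
    using conj_part_iff[OF assms, of "conj_part lam (j + 1)" "j + 1"]
      conj_part_iff[OF assms, of "conj_part lam (j + 1)" j] that
    by (cases "conj_part lam (j + 1) = 0") auto
  moreover have "{j. conj_part lam j \<noteq> 0} \<subseteq> {..lam 1}"
  proof
    fix j assume "j \<in> {j. conj_part lam j \<noteq> 0}"
    then have "1 \<le> conj_part lam j" "j \<noteq> 0" by (auto intro: Nat.gr0I)
    then show "j \<in> {..lam 1}"
      using conj_part_iff[OF assms, of 1 j] by auto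
  qed
  ultimately show ?thesis
    by (auto simp: is_partition_def intro: finite_subset)
qed

lemma partition_eqI:
  assumes "is_partition f" "is_partition g"
    and "\<And>i j. 1 \<le> i \<Longrightarrow> 1 \<le> j \<Longrightarrow> j \<le> f i \<longleftrightarrow> j \<le> g i"
  shows "f = g"
proof
  fix i
  show "f i = g i"
  proof (cases "i = 0")
    case True
    then show ?thesis using assms(1,2) by (simp add: is_partition_zero)
  next
    case False
    then show ?thesis
      using assms(3)[of i "f i"] assms(3)[of i "g i"]
      by (cases "f i = 0"; cases "g i = 0") auto
  qed
qed

lemma conj_part_conj_part:
  assumes "is_partition lam"
  shows "conj_part (conj_part lam) = lam"
  using assms is_partition_conj_part[OF assms]
  by (intro partition_eqI is_partition_conj_part) (auto simp: conj_part_iff)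

lemma diagram_conj_part:
  assumes "is_partition lam"
  shows "diagram (conj_part lam) = prod.swap ` diagram lam"
  using assms is_partition_conj_part[OF assms]
  by (force simp: diagram_partition conj_part_iff image_iff)

lemma card_diagram_conj_part:
  "is_partition lam \<Longrightarrow> card (diagram (conj_part lam)) = card (diagram lam)"
  by (simp add: diagram_conj_part card_image)

lemma is_partition_one_row: "is_partition (one_row m)"
  by (auto simp: is_partition_def one_row_def)

lemma is_partition_one_column: "is_partition (one_column n)"
  by (auto simp: is_partition_def one_column_def intro: finite_subset[of _ "{..n}"])

lemma diagram_one_row: "diagram (one_row m) = {1} \<times> {1..m}"
  by (subst diagram_partition[OF is_partition_one_row]) (auto simp: one_row_def split: if_splits)

lemma diagram_one_column: "diagram (one_column n) = {1..n} \<times> {1}"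
  by (subst diagram_partition[OF is_partition_one_column])
    (auto simp: one_column_def split: if_splits)

section \<open>Tableaux as chains of horizontal strips\<close>

text \<open>Interlacing \<open>lam (i + 1) \<le> mu i \<le> lam i\<close> means that the skew shape
  has at most one box in each column.\<close>

definition hstrip :: "(nat \<Rightarrow> nat) \<Rightarrow> (nat \<Rightarrow> nat) \<Rightarrow> bool" where
  "hstrip mu lam \<longleftrightarrow> is_partition mu \<and> is_partition lam \<and>
     (\<forall>i\<ge>1. mu i \<le> lam i \<and> lam (i + 1) \<le> mu i)"

text \<open>The index \<open>v\<close> acts as time. It runs over all naturals because entries are
  unbounded; eventual constancy reflects that a tableau has only finitely many boxes.\<close>

definition strip_chain :: "(nat \<Rightarrow> nat) \<Rightarrow> (nat \<Rightarrow> nat \<Rightarrow> nat) \<Rightarrow> bool" where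
  "strip_chain lam L \<longleftrightarrow> L 0 = (\<lambda>i. 0) \<and> (\<forall>v. hstrip (L v) (L (Suc v))) \<and>
     (\<exists>n. \<forall>v\<ge>n. L v = lam)"

definition tab_chain :: "(nat \<Rightarrow> nat) \<Rightarrow> (nat \<times> nat \<Rightarrow> nat) \<Rightarrow> nat \<Rightarrow> nat \<Rightarrow> nat" where
  "tab_chain lam M v i = card {j. (i, j) \<in> diagram lam \<and> M (i, j) \<le> v}"

lemma nat_le_via_lower:
  fixes a b :: nat
  assumes "\<And>j. 1 \<le> j \<Longrightarrow> j \<le> a \<Longrightarrow> j \<le> b"
  shows "a \<le> b"
  using assms[of a] by (cases "a = 0") auto

lemma hstrip_partition: "hstrip mu lam \<Longrightarrow> is_partition mu" "hstrip mu lam \<Longrightarrow> is_partition lam"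
  by (auto simp: hstrip_def)

lemma hstrip_le: "hstrip mu lam \<Longrightarrow> mu i \<le> lam i"
  by (cases "i = 0") (auto simp: hstrip_def is_partition_def)

lemma hstrip_Suc_le: "hstrip mu lam \<Longrightarrow> 1 \<le> i \<Longrightarrow> lam (Suc i) \<le> mu i"
  by (auto simp: hstrip_def)

text \<open>Only the outer shape has to be known as a partition:
  \<open>mu (i + 1) \<le> lam (i + 1) \<le> mu i\<close> makes the inner one decrease.\<close>

lemma hstripI:
  assumes "is_partition lam" "mu 0 = 0" "\<And>i. 1 \<le> i \<Longrightarrow> mu i \<le> lam i"
    "\<And>i. 1 \<le> i \<Longrightarrow> lam (i + 1) \<le> mu i"
  shows "hstrip mu lam"
proof -
  have le: "mu i \<le> lam i" for i
    using assms(2,3) by (cases "i = 0") auto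
  have "finite {i. mu i \<noteq> 0}"
  proof (rule finite_subset)
    show "{i. mu i \<noteq> 0} \<subseteq> {i. lam i \<noteq> 0}"
      using le by (metis (mono_tags, lifting) Collect_mono le_zero_eq)
  qed (use assms(1) in \<open>simp add: is_partition_def\<close>)
  moreover have "mu (i + 1) \<le> mu i" if "1 \<le> i" for i
    using le[of "i + 1"] assms(4)[OF that] by simp
  ultimately show ?thesis
    using assms by (auto simp: hstrip_def is_partition_def)
qed

lemma strip_chain_mono: "strip_chain lam L \<Longrightarrow> v \<le> w \<Longrightarrow> L v i \<le> L w i"
  by (rule lift_Suc_mono_le[where f = "\<lambda>v. L v i"]) (auto simp: strip_chain_def hstrip_le)

lemma strip_chain_le:
  assumes "strip_chain lam L"
  shows "L v i \<le> lam i"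
proof -
  obtain n where "\<forall>v\<ge>n. L v = lam"
    using assms by (auto simp: strip_chain_def)
  then show ?thesis
    using strip_chain_mono[OF assms, of v "max v n" i] by simp
qed

lemma strip_chain_hstrip: "strip_chain lam L \<Longrightarrow> hstrip (L v) (L (Suc v))"
  by (simp add: strip_chain_def)

lemma strip_chain_partition: "strip_chain lam L \<Longrightarrow> is_partition (L v)"
  by (rule hstrip_partition(1)[OF strip_chain_hstrip])

lemma strip_chain_limit:
  assumes "strip_chain lam L"
  shows "is_partition lam"
proof -
  obtain n where "L n = lam"
    using assms by (auto simp: strip_chain_def)
  with strip_chain_partition[OF assms, of n] show ?thesis by simp
qed

lemma strip_chain_limit_unique:
  assumes "strip_chain lam L" "strip_chain lam' L"
  shows "lam = lam'"
proof -
  obtain n n' where "\<forall>v\<ge>n. L v = lam" "\<forall>v\<ge>n'. L v = lam'"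
    using assms unfolding strip_chain_def by blast
  then have "L (max n n') = lam" "L (max n n') = lam'"
    by (blast intro: max.cobounded1 max.cobounded2)+
  then show ?thesis by simp
qed

section \<open>Passing between a tableau and its chain\<close>

lemma SSYT_row_mono:
  assumes lam: "is_partition lam" and M: "M \<in> SSYT lam"
    and "1 \<le> i" "1 \<le> j" "j \<le> k" "k \<le> lam i"
  shows "M (i, j) \<le> M (i, k)"
  using assms(5,6)
proof (induction k rule: dec_induct)
  case (step n)
  then have "M (i, n) \<le> M (i, n + 1)"
    using assms by (auto simp: SSYT_def diagram_partition[OF lam])
  with step show ?case by simp
qed simp

lemma SSYT_column_mono:
  assumes lam: "is_partition lam" and M: "M \<in> SSYT lam"
    and "1 \<le> j" "1 \<le> i" "i \<le> k" "j \<le> lam k"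
  shows "M (i, j) \<le> M (k, j)"
  using assms(5,6)
proof (induction k rule: dec_induct)
  case (step n)
  then have "j \<le> lam n"
    using is_partition_antimono[OF lam, of n "Suc n"] assms(4) by simp
  then have "M (n, j) < M (n + 1, j)"
    using assms step by (auto simp: SSYT_def diagram_partition[OF lam])
  with step \<open>j \<le> lam n\<close> show ?case by simp
qed simp

lemma SSYT_pos: "M \<in> SSYT lam \<Longrightarrow> b \<in> diagram lam \<Longrightarrow> 1 \<le> M b"
  by (auto simp: SSYT_def fillings_def PiE_iff)

lemma tab_chain_iff:
  assumes lam: "is_partition lam" and M: "M \<in> SSYT lam" and b: "(i, j) \<in> diagram lam"
  shows "j \<le> tab_chain lam M v i \<longleftrightarrow> M (i, j) \<le> v"
proof -
  define S where "S = {j. (i, j) \<in> diagram lam \<and> M (i, j) \<le> v}"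
  have ij: "1 \<le> i" "1 \<le> j" using b by (auto simp: diagram_partition[OF lam])
  have S: "S = {j. 1 \<le> j \<and> j \<le> lam i \<and> M (i, j) \<le> v}"
    using ij by (auto simp: S_def diagram_partition[OF lam])
  have fin: "finite S" by (rule finite_subset[of _ "{..lam i}"]) (auto simp: S)
  have "S = {1..card S}"
  proof (rule down_closed_eq_atLeastAtMost[OF fin])
    fix x y assume "y \<in> S" "1 \<le> x" "x \<le> y"
    then show "x \<in> S"
      using SSYT_row_mono[OF lam M ij(1), of x y] by (auto simp: S)
  qed (simp add: S)
  then have "j \<in> S \<longleftrightarrow> j \<le> card S"
    using ij by (metis atLeastAtMost_iff)
  then show ?thesis
    using b by (simp add: S_def tab_chain_def)
qed

lemma tab_chain_le:
  assumes lam: "is_partition lam"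
  shows "tab_chain lam M v i \<le> lam i"
proof -
  have "{j. (i, j) \<in> diagram lam \<and> M (i, j) \<le> v} \<subseteq> {1..lam i}"
    by (auto simp: diagram_partition[OF lam])
  then show ?thesis
    unfolding tab_chain_def by (metis card_atLeastAtMost card_mono diff_Suc_1 finite_atLeastAtMost)
qed

lemma tab_chain_row_0 [simp]: "tab_chain lam M v 0 = 0"
  by (simp add: tab_chain_def diagram_def)

lemma tab_chain_iff':
  assumes lam: "is_partition lam" and M: "M \<in> SSYT lam" and "1 \<le> i" "1 \<le> j"
  shows "j \<le> tab_chain lam M v i \<longleftrightarrow> j \<le> lam i \<and> M (i, j) \<le> v"
  using tab_chain_iff[OF lam M, of i j v] tab_chain_le[OF lam, of M v i] assms(3,4)
  by (auto simp: diagram_partition[OF lam])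

text \<open>Column strictness is what produces interlacing: an entry at most \<open>Suc v\<close> in
  row \<open>i + 1\<close> forces the entry above it to be at most \<open>v\<close>.\<close>

lemma strip_chain_tab_chain:
  assumes lam: "is_partition lam" and M: "M \<in> SSYT lam"
  shows "strip_chain lam (tab_chain lam M)"
proof -
  let ?L = "tab_chain lam M"
  note iff = tab_chain_iff'[OF lam M]
  have part: "is_partition (?L v)" for v
  proof -
    have "?L v (i + 1) \<le> ?L v i" if i: "1 \<le> i" for i
    proof (rule nat_le_via_lower)
      fix j :: nat assume j: "1 \<le> j" "j \<le> ?L v (i + 1)"
      then have "j \<le> lam (i + 1)" "M (i + 1, j) \<le> v" by (simp_all add: iff)
      moreover have "lam (i + 1) \<le> lam i"
        by (rule is_partition_antimono[OF lam i]) simp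
      ultimately show "j \<le> ?L v i"
        using SSYT_column_mono[OF lam M j(1) i, of "i + 1"] i j(1) by (simp add: iff)
    qed
    moreover have "finite {i. ?L v i \<noteq> 0}"
    proof (rule finite_subset)
      show "{i. ?L v i \<noteq> 0} \<subseteq> {i. lam i \<noteq> 0}"
        using tab_chain_le[OF lam, of M v] by (metis (mono_tags, lifting) Collect_mono le_zero_eq)
    qed (use lam in \<open>simp add: is_partition_def\<close>)
    ultimately show ?thesis by (auto simp: is_partition_def)
  qed
  have "hstrip (?L v) (?L (Suc v))" for v
  proof (rule hstripI[OF part])
    fix i :: nat assume i: "1 \<le> i"
    show "?L v i \<le> ?L (Suc v) i"
    proof (rule nat_le_via_lower)
      fix j :: nat assume "1 \<le> j" "j \<le> ?L v i"
      then show "j \<le> ?L (Suc v) i"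
        using iff[OF i, of j v] iff[OF i, of j "Suc v"] by simp
    qed
    show "?L (Suc v) (i + 1) \<le> ?L v i"
    proof (rule nat_le_via_lower)
      fix j :: nat assume j: "1 \<le> j" "j \<le> ?L (Suc v) (i + 1)"
      then have le: "j \<le> lam (i + 1)" "M (i + 1, j) \<le> Suc v" by (simp_all add: iff)
      moreover have "lam (i + 1) \<le> lam i"
        by (rule is_partition_antimono[OF lam i]) simp
      moreover from this have "M (i, j) < M (i + 1, j)"
        using M i j le by (auto simp: SSYT_def diagram_partition[OF lam])
      ultimately show "j \<le> ?L v i"
        using i j(1) by (simp add: iff)
    qed
  qed simp
  moreover have "?L 0 = (\<lambda>i. 0)"
    using SSYT_pos[OF M] unfolding tab_chain_def
    by (intro ext) (force simp: card_eq_0_iff)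
  moreover have "?L v = lam" if v: "\<forall>b\<in>diagram lam. M b \<le> v" for v
  proof (rule partition_eqI[OF part lam])
    fix i j :: nat assume "1 \<le> i" "1 \<le> j"
    then show "j \<le> ?L v i \<longleftrightarrow> j \<le> lam i"
      using iff[of i j v] v by (auto simp: diagram_partition[OF lam])
  qed
  \<comment> \<open>For the empty diagram \<open>Max\<close> is unspecified, but then there is no
    box to bound.\<close>
  moreover have "\<forall>b\<in>diagram lam. M b \<le> v" if "Max (M ` diagram lam) \<le> v" for v
    using that by (meson Max_ge finite_diagram finite_imageI image_eqI order_trans)
  ultimately show ?thesis
    unfolding strip_chain_def by blast
qed

lemma tab_chain_inj:
  assumes lam: "is_partition lam" and "M \<in> SSYT lam" "M' \<in> SSYT lam"
    and eq: "tab_chain lam M = tab_chain lam M'"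
  shows "M = M'"
proof (rule PiE_ext)
  show "M \<in> diagram lam \<rightarrow>\<^sub>E {1..}" "M' \<in> diagram lam \<rightarrow>\<^sub>E {1..}"
    using assms by (auto simp: SSYT_def fillings_def)
  fix b assume b: "b \<in> diagram lam"
  obtain i j where ij: "b = (i, j)" by (cases b)
  show "M b = M' b"
    using tab_chain_iff[OF lam assms(2), of i j] tab_chain_iff[OF lam assms(3), of i j] b eq
    unfolding ij by (auto intro: order_antisym)
qed

text \<open>Each box receives the time at which it is first occupied. As the shapes increase, being
  occupied at time \<open>v\<close> is the same as having an entry at most \<open>v\<close>, and the
  tableau conditions are read off from the chain.\<close>

lemma strip_chain_tableau:
  assumes L: "strip_chain lam L"
  obtains M where "M \<in> SSYT lam" "tab_chain lam M = L"
proof -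
  have lam: "is_partition lam" by (rule strip_chain_limit[OF L])
  define M where "M = restrict (\<lambda>(i, j). LEAST v. j \<le> L v i) (diagram lam)"
  have iff: "M (i, j) \<le> v \<longleftrightarrow> j \<le> L v i" if b: "(i, j) \<in> diagram lam" for i j v
  proof -
    obtain n where "L n = lam" using L unfolding strip_chain_def by blast
    then have ex: "j \<le> L n i" using b by (auto simp: diagram_partition[OF lam])
    have M: "M (i, j) = (LEAST v. j \<le> L v i)" using b by (simp add: M_def)
    show ?thesis
    proof
      assume "M (i, j) \<le> v"
      then show "j \<le> L v i"
        using LeastI[of "\<lambda>v. j \<le> L v i", OF ex] strip_chain_mono[OF L, of "M (i, j)" v i]
        unfolding M by linarith
    next
      assume "j \<le> L v i"
      then show "M (i, j) \<le> v" unfolding M by (rule Least_le)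
    qed
  qed
  have "M \<in> SSYT lam"
    unfolding SSYT_def fillings_def
  proof (intro CollectI conjI allI impI; (elim conjE)?)
    \<comment> \<open>The shape at time 0 is empty, so 0 never occurs as an entry.\<close>
    have "1 \<le> M (i, j)" if b: "(i, j) \<in> diagram lam" for i j
    proof (rule ccontr)
      assume "\<not> 1 \<le> M (i, j)"
      then have "j \<le> L 0 i" using iff[OF b, of 0] by simp
      then show False using b L by (simp add: strip_chain_def diagram_partition[OF lam])
    qed
    then show "M \<in> diagram lam \<rightarrow>\<^sub>E {1..}"
      by (auto simp: M_def PiE_iff extensional_def)
  next
    fix i j assume b: "(i, j) \<in> diagram lam" "(i, j + 1) \<in> diagram lam"
    show "M (i, j) \<le> M (i, j + 1)"
      using iff[OF b(1)] iff[OF b(2), of "M (i, j + 1)"] by simp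
  next
    fix i j assume b: "(i, j) \<in> diagram lam" "(i + 1, j) \<in> diagram lam"
    have i: "1 \<le> i" using b by (simp add: diagram_partition[OF lam])
    have 1: "j \<le> L (M (i + 1, j)) (i + 1)"
      using iff[OF b(2), of "M (i + 1, j)"] by simp
    show "M (i, j) < M (i + 1, j)"
    proof (cases "M (i + 1, j)")
      case 0
      then show ?thesis using 1 b L by (simp add: strip_chain_def diagram_partition[OF lam])
    next
      case (Suc v)
      then have "j \<le> L v i"
        using 1 hstrip_Suc_le[OF strip_chain_hstrip[OF L] i, of v] by simp
      then show ?thesis using iff[OF b(1), of v] Suc by simp
    qed
  qed
  moreover have "tab_chain lam M = L"
  proof
    fix v
    show "tab_chain lam M v = L v"
    proof (rule partition_eqI)
      show "is_partition (tab_chain lam M v)"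
        by (rule strip_chain_partition[OF strip_chain_tab_chain[OF lam \<open>M \<in> SSYT lam\<close>]])
      show "is_partition (L v)" by (rule strip_chain_partition[OF L])
      fix i j :: nat assume ij: "1 \<le> i" "1 \<le> j"
      show "j \<le> tab_chain lam M v i \<longleftrightarrow> j \<le> L v i"
        using iff[of i j v] strip_chain_le[OF L, of v i] ij
        by (auto simp: tab_chain_iff'[OF lam \<open>M \<in> SSYT lam\<close> ij] diagram_partition[OF lam])
    qed
  qed
  ultimately show thesis by (rule that)
qed

lemma SSYT_entries_le:
  assumes lam: "is_partition lam" and M: "M \<in> SSYT lam"
  shows "{b \<in> diagram lam. M b \<le> v} = diagram (tab_chain lam M v)"
  using strip_chain_partition[OF strip_chain_tab_chain[OF lam M]]
  by (auto simp: diagram_partition tab_chain_iff'[OF lam M] lam)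

section \<open>Growth diagrams\<close>

definition vstrip :: "(nat \<Rightarrow> nat) \<Rightarrow> (nat \<Rightarrow> nat) \<Rightarrow> bool" where
  "vstrip mu nu \<longleftrightarrow> is_partition mu \<and> is_partition nu \<and>
     (\<forall>i\<ge>1. mu i \<le> nu i \<and> nu i \<le> mu i + 1)"

lemma vstrip_partition: "vstrip mu nu \<Longrightarrow> is_partition mu" "vstrip mu nu \<Longrightarrow> is_partition nu"
  by (auto simp: vstrip_def)

lemma vstrip_le: "vstrip mu nu \<Longrightarrow> mu i \<le> nu i"
  by (cases "i = 0") (auto simp: vstrip_def is_partition_def)

lemma vstrip_le_Suc: "vstrip mu nu \<Longrightarrow> nu i \<le> mu i + 1"
  by (cases "i = 0") (auto simp: vstrip_def is_partition_def)

lemma diagram_mono: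
  assumes "is_partition f" "is_partition g" "\<And>i. f i \<le> g i"
  shows "diagram f \<subseteq> diagram g"
  using assms(3) by (auto simp: diagram_partition assms(1,2) intro: order_trans)

text \<open>One square of the growth diagram: \<open>mu\<close> to \<open>lam\<close> and
  \<open>nu\<close> to \<open>rho\<close> are steps in time, \<open>mu\<close> to \<open>nu\<close>
  and \<open>lam\<close> to \<open>rho\<close> compare the old with the enlarged shape, and
  \<open>k\<close> counts the inserted letters of the current value. Both insertions satisfy these
  laws; they differ in \<open>strip\<close> and in \<open>step\<close>, which limits how often one
  value may be inserted.\<close>

locale growth =
  fixes strip :: "(nat \<Rightarrow> nat) \<Rightarrow> (nat \<Rightarrow> nat) \<Rightarrow> bool"
    and rule :: "(nat \<Rightarrow> nat) \<Rightarrow> (nat \<Rightarrow> nat) \<Rightarrow> (nat \<Rightarrow> nat) \<Rightarrow> (nat \<Rightarrow> nat) \<Rightarrow> nat \<Rightarrow> bool"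
    and step :: "nat \<Rightarrow> bool"
  assumes strip_refl: "is_partition mu \<Longrightarrow> strip mu mu"
    and strip_le: "strip mu nu \<Longrightarrow> mu i \<le> nu i"
    and rule_step: "rule mu lam nu rho k \<Longrightarrow> step k"
    and rule_hstrip: "rule mu lam nu rho k \<Longrightarrow> hstrip mu lam"
      "rule mu lam nu rho k \<Longrightarrow> hstrip nu rho"
    and rule_strip: "rule mu lam nu rho k \<Longrightarrow> strip mu nu" "rule mu lam nu rho k \<Longrightarrow> strip lam rho"
    and rule_card: "rule mu lam nu rho k \<Longrightarrow>
      card (diagram rho) + card (diagram mu) = card (diagram lam) + card (diagram nu) + k"
    and rule_forward: "hstrip mu lam \<Longrightarrow> strip mu nu \<Longrightarrow> step k \<Longrightarrow> \<exists>rho. rule mu lam nu rho k"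
    and rule_forward_unique: "rule mu lam nu rho k \<Longrightarrow> rule mu lam nu rho' k \<Longrightarrow> rho = rho'"
    and rule_backward: "strip lam rho \<Longrightarrow> hstrip nu rho \<Longrightarrow> \<exists>mu k. rule mu lam nu rho k"
    and rule_backward_unique: "rule mu lam nu rho k \<Longrightarrow> rule mu' lam nu rho k' \<Longrightarrow> mu = mu'"
    and rule_stationary: "strip lam nu \<Longrightarrow> rule lam lam nu nu 0"
begin

text \<open>The chain of a one-row or one-column tableau is determined by the sizes of its shapes,
  so a sequence of numbers replaces it.\<close>

definition count_seq :: "nat \<Rightarrow> (nat \<Rightarrow> nat) \<Rightarrow> bool" where
  "count_seq m K \<longleftrightarrow> K 0 = 0 \<and> (\<forall>v. K v \<le> K (Suc v) \<and> step (K (Suc v) - K v)) \<and>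
     (\<exists>n. \<forall>v\<ge>n. K v = m)"

definition grows :: "(nat \<Rightarrow> nat \<Rightarrow> nat) \<Rightarrow> (nat \<Rightarrow> nat) \<Rightarrow> (nat \<Rightarrow> nat \<Rightarrow> nat) \<Rightarrow> bool" where
  "grows L K N \<longleftrightarrow> (\<forall>v. rule (L v) (L (Suc v)) (N v) (N (Suc v)) (K (Suc v) - K v))"

text \<open>The limit shape is not known in advance. When \<open>L\<close> and \<open>K\<close> have
  both become constant, every further square is stationary, and uniqueness of \<open>rho\<close>
  forbids any later change.\<close>

lemma growth_forward:
  assumes L: "strip_chain lam L" and K: "count_seq m K"
  obtains N nu where "strip_chain nu N" "grows L K N" "strip lam nu"
proof -
  have L0: "L 0 = (\<lambda>i. 0)" using L by (simp add: strip_chain_def)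
  \<comment> \<open>The invariant \<open>strip (L v) (N v)\<close> is carried along because
    \<open>rule_forward\<close> requires it at the next square.\<close>
  have "\<exists>N. \<forall>v. (strip (L v) (N v) \<and> (v = 0 \<longrightarrow> N v = (\<lambda>i. 0))) \<and>
     rule (L v) (L (Suc v)) (N v) (N (Suc v)) (K (Suc v) - K v)"
  proof (rule dependent_nat_choice)
    show "\<exists>x. strip (L 0) x \<and> (0 = 0 \<longrightarrow> x = (\<lambda>i. 0))"
      using strip_refl[OF strip_chain_partition[OF L, of 0]] L0 by auto
  next
    fix x v assume "strip (L v) x \<and> (v = 0 \<longrightarrow> x = (\<lambda>i. 0))"
    then obtain rho where "rule (L v) (L (Suc v)) x rho (K (Suc v) - K v)"
      using rule_forward[OF strip_chain_hstrip[OF L, of v]] K unfolding count_seq_def by blast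
    then show "\<exists>y. (strip (L (Suc v)) y \<and> (Suc v = 0 \<longrightarrow> y = (\<lambda>i. 0))) \<and>
        rule (L v) (L (Suc v)) x y (K (Suc v) - K v)"
      using rule_strip by blast
  qed
  then obtain N where N: "\<And>v. strip (L v) (N v)" "N 0 = (\<lambda>i. 0)" "grows L K N"
    unfolding grows_def by blast
  obtain n1 n2 where n: "\<forall>v\<ge>n1. L v = lam" "\<forall>v\<ge>n2. K v = m"
    using L K by (auto simp: strip_chain_def count_seq_def)
  define n where "n = max n1 n2"
  have "N v = N n" if "n \<le> v" for v
    using that
  proof (induction v rule: dec_induct)
    case (step v)
    then have "rule lam lam (N v) (N (Suc v)) 0"
      using N(3) n unfolding grows_def n_def
      by (metis diff_self_eq_0 le_SucI max.boundedE)
    moreover have "rule lam lam (N v) (N v) 0"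
      using N(1)[of v] n step by (intro rule_stationary) (simp add: n_def)
    ultimately show ?case using rule_forward_unique step by metis
  qed simp
  moreover have "hstrip (N v) (N (Suc v))" for v
    using N(3) rule_hstrip unfolding grows_def by blast
  ultimately have "strip_chain (N n) N"
    using N(2) unfolding strip_chain_def by blast
  moreover have "strip lam (N n)"
    using N(1)[of n] n by (simp add: n_def)
  ultimately show thesis using N(3) that by blast
qed

lemma common_limit:
  assumes "strip_chain lam L" "strip_chain nu N" "count_seq m K"
  obtains w where "N w = nu" "L w = lam" "K w = m"
proof -
  obtain a b c where "\<forall>v\<ge>a. L v = lam" "\<forall>v\<ge>b. N v = nu" "\<forall>v\<ge>c. K v = m"
    using assms unfolding strip_chain_def count_seq_def by blast
  then show thesis by (intro that[of "max a (max b c)"]) simp_all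
qed

lemma grows_card:
  assumes L: "strip_chain lam L" and N: "strip_chain nu N" and K: "count_seq m K"
    and G: "grows L K N"
  shows "card (diagram (N v)) = card (diagram (L v)) + K v"
proof (induction v)
  case 0
  then show ?case using L N K by (simp add: strip_chain_def count_seq_def)
next
  case (Suc v)
  have "K v \<le> K (Suc v)" using K by (simp add: count_seq_def)
  then show ?case
    using Suc rule_card[of "L v" "L (Suc v)" "N v" "N (Suc v)" "K (Suc v) - K v"] G
    by (simp add: grows_def)
qed

lemma grows_forward_unique:
  assumes N: "strip_chain nu N" and N': "strip_chain nu' N'"
    and G: "grows L K N" and G': "grows L K N'"
  shows "N = N'"
proof
  fix v show "N v = N' v"
  proof (induction v)
    case 0
    then show ?case using N N' by (simp add: strip_chain_def)
  next
    case (Suc v)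
    then show ?case
      using G G' rule_forward_unique unfolding grows_def by metis
  qed
qed

lemma strip_zero: "strip mu (\<lambda>i. 0) \<Longrightarrow> mu = (\<lambda>i. 0)"
  using strip_le by fastforce

lemma growth_backward:
  assumes N: "strip_chain nu N" and strip: "strip lam nu"
    and card: "card (diagram nu) = card (diagram lam) + m"
  obtains L K where "strip_chain lam L" "count_seq m K" "grows L K N"
proof -
  obtain n where n: "\<forall>v\<ge>n. N v = nu" using N by (auto simp: strip_chain_def)
  \<comment> \<open>Time is reversed, \<open>B d\<close> being the shape at time
    \<open>n - d\<close>, so that the choice starts from the known shape \<open>lam\<close>. The
    guard \<open>d < n\<close> stops at time 0, where truncated subtraction would repeat
    \<open>N 0\<close>.\<close>
  have "\<exists>B. \<forall>d. strip (B d) (N (n - d)) \<and> (d = 0 \<longrightarrow> B d = lam) \<and>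
     (d < n \<longrightarrow> (\<exists>k. rule (B (Suc d)) (B d) (N (n - Suc d)) (N (n - d)) k))"
  proof -
    have "\<exists>B. \<forall>d. (strip (B d) (N (n - d)) \<and> (d = 0 \<longrightarrow> B d = lam)) \<and>
     (d < n \<longrightarrow> (\<exists>k. rule (B (Suc d)) (B d) (N (n - Suc d)) (N (n - d)) k))"
    proof (rule dependent_nat_choice)
      show "\<exists>x. strip x (N (n - 0)) \<and> (0 = 0 \<longrightarrow> x = lam)"
        using strip n by auto
    next
      fix x d assume x: "strip x (N (n - d)) \<and> (d = 0 \<longrightarrow> x = lam)"
      show "\<exists>y. (strip y (N (n - Suc d)) \<and> (Suc d = 0 \<longrightarrow> y = lam)) \<and>
        (d < n \<longrightarrow> (\<exists>k. rule y x (N (n - Suc d)) (N (n - d)) k))"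
      proof (cases "d < n")
        case True
        then have "n - d = Suc (n - Suc d)" by simp
        then have "hstrip (N (n - Suc d)) (N (n - d))"
          using strip_chain_hstrip[OF N] by simp
        with x obtain y k where "rule y x (N (n - Suc d)) (N (n - d)) k"
          using rule_backward by blast
        then show ?thesis using rule_strip by blast
      qed (use x in auto)
    qed
    then show ?thesis by simp
  qed
  then obtain B where B: "\<And>d. strip (B d) (N (n - d))" "B 0 = lam"
    "\<And>d. d < n \<Longrightarrow> \<exists>k. rule (B (Suc d)) (B d) (N (n - Suc d)) (N (n - d)) k"
    by blast
  define L where "L v = B (n - v)" for v
  \<comment> \<open>The local rule returns the number of inserted letters only existentially. It is
    recovered as a difference of sizes, and the hypothesis on sizes fixes its final value
    \<open>m\<close>.\<close>
  define K where "K v = card (diagram (N v)) - card (diagram (L v))" for v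
  have L: "\<exists>k. rule (L v) (L (Suc v)) (N v) (N (Suc v)) k" for v
  proof (cases "v < n")
    case True
    then have "n - v = Suc (n - Suc v)" "n - Suc v < n" "n - (n - v) = v" "n - (n - Suc v) = Suc v"
      by simp_all
    then show ?thesis unfolding L_def using B(3)[of "n - Suc v"] by simp
  next
    case False
    then show ?thesis using rule_stationary[OF strip] n B(2) by (auto simp: L_def)
  qed
  have strip_v: "strip (L v) (N v)" for v
    using L[of v] rule_strip by blast
  have le: "card (diagram (L v)) \<le> card (diagram (N v))" for v
    using L[of v] rule_hstrip hstrip_partition strip_le[OF strip_v[of v]]
    by (intro card_mono diagram_mono finite_diagram) blast+
  have R: "rule (L v) (L (Suc v)) (N v) (N (Suc v)) (K (Suc v) - K v) \<and> K v \<le> K (Suc v)" for v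
  proof -
    obtain k where k: "rule (L v) (L (Suc v)) (N v) (N (Suc v)) k" using L by blast
    have "K (Suc v) = K v + k"
      using rule_card[OF k] le[of v] le[of "Suc v"] by (simp add: K_def)
    with k show ?thesis by simp
  qed
  \<comment> \<open>The backward run prescribes no starting shape; it ends in the empty one because
    that shape is contained in \<open>N 0\<close>.\<close>
  have "L 0 = (\<lambda>i. 0)"
    using strip_v[of 0] N by (intro strip_zero) (simp add: strip_chain_def)
  moreover have "L v = lam" if "n \<le> v" for v
    using that B(2) by (simp add: L_def)
  ultimately have "strip_chain lam L"
    using L rule_hstrip unfolding strip_chain_def by blast
  moreover have "count_seq m K"
    unfolding count_seq_def
  proof (intro conjI exI[of _ n] allI impI)
    show "K 0 = 0"
      using \<open>L 0 = (\<lambda>i. 0)\<close> N by (simp add: K_def strip_chain_def)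
    show "K v = m" if "n \<le> v" for v
      using that card n B(2) by (simp add: K_def L_def)
  qed (use R rule_step in blast)+
  moreover have "grows L K N" using R by (simp add: grows_def)
  ultimately show thesis by (rule that)
qed

text \<open>Uniqueness spreads backwards in time from the common final shape \<open>lam\<close>; the
  counting sequences then agree because they are differences of sizes.\<close>

lemma grows_backward_unique:
  assumes L: "strip_chain lam L" and L': "strip_chain lam L'"
    and K: "count_seq m K" and K': "count_seq m K'" and N: "strip_chain nu N"
    and G: "grows L K N" and G': "grows L' K' N"
  shows "L = L'" "K = K'"
proof -
  obtain n1 n2 where n: "\<forall>v\<ge>n1. L v = lam" "\<forall>v\<ge>n2. L' v = lam"
    using L L' by (auto simp: strip_chain_def)
  define n where "n = max n1 n2"
  have "L v = L' v" for v
  proof (cases "v \<le> n")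
    case True
    then show ?thesis
    proof (induction rule: inc_induct)
      case base
      then show ?case using n by (simp add: n_def)
    next
      case (step v)
      then show ?case
        using G G' rule_backward_unique unfolding grows_def by metis
    qed
  qed (use n in \<open>auto simp: n_def\<close>)
  then show "L = L'" by blast
  then show "K = K'"
    using grows_card[OF L N K G] grows_card[OF L' N K' G']
    by (metis add_left_cancel ext)
qed

end

section \<open>The local rules of row and column insertion\<close>

text \<open>
  The piecewise linear form of the local rule of the Robinson-Schensted-Knuth correspondence: away
  from the first row, \<open>rho (i + 1)\<close> and \<open>mu i\<close> are exchanged by a reflection of the interval between
  \<open>max (lam (i + 1)) (nu (i + 1))\<close> and \<open>min (lam i) (nu i)\<close>.
\<close>

definition row_rule ::
  "(nat \<Rightarrow> nat) \<Rightarrow> (nat \<Rightarrow> nat) \<Rightarrow> (nat \<Rightarrow> nat) \<Rightarrow> (nat \<Rightarrow> nat) \<Rightarrow> nat \<Rightarrow> bool" where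
  "row_rule mu lam nu rho k \<longleftrightarrow>
     hstrip mu lam \<and> hstrip mu nu \<and> hstrip lam rho \<and> hstrip nu rho \<and>
     rho 1 = max (lam 1) (nu 1) + k \<and>
     (\<forall>i\<ge>1. rho (i + 1) + mu i = max (lam (i + 1)) (nu (i + 1)) + min (lam i) (nu i))"

lemma is_partitionI_hstrip:
  assumes "is_partition nu" "rho 0 = 0" "\<And>i. 1 \<le> i \<Longrightarrow> nu i \<le> rho i"
    "\<And>i. 1 \<le> i \<Longrightarrow> rho (i + 1) \<le> nu i"
  shows "is_partition rho"
proof -
  obtain q where q: "\<And>i. q < i \<Longrightarrow> nu i = 0"
    using is_partition_bound[OF assms(1)] by blast
  have "rho i = 0" if "q + 1 < i" for i
    using assms(4)[of "i - 1"] q[of "i - 1"] that by simp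
  then have "{i. rho i \<noteq> 0} \<subseteq> {..q + 1}" by (auto simp: not_less[symmetric])
  then have "finite {i. rho i \<noteq> 0}" by (rule finite_subset) simp
  moreover have "rho (i + 1) \<le> rho i" if "1 \<le> i" for i
    using assms(3,4)[OF that] by simp
  ultimately show ?thesis using assms(2) by (auto simp: is_partition_def)
qed

lemma hstripI':
  assumes "is_partition nu" "rho 0 = 0" "\<And>i. 1 \<le> i \<Longrightarrow> nu i \<le> rho i"
    "\<And>i. 1 \<le> i \<Longrightarrow> rho (i + 1) \<le> nu i"
  shows "hstrip nu rho"
  using is_partitionI_hstrip[OF assms] assms by (simp add: hstrip_def)

lemma eq_from_rows:
  fixes f g :: "nat \<Rightarrow> nat"
  assumes "f 0 = g 0" "f 1 = g 1" "\<And>i. 1 \<le> i \<Longrightarrow> f (i + 1) = g (i + 1)"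
  shows "f = g"
proof
  fix i show "f i = g i"
    using assms(1,2) assms(3)[of "i - 1"] by (cases "i \<le> 1") (auto simp: le_Suc_eq)
qed

lemma sum_shift_first: "(\<Sum>i\<in>{1..Suc q}. f i) = f 1 + (\<Sum>i\<in>{1..q}. f (i + 1))" for f :: "nat \<Rightarrow> nat"
  by (induction q) auto

text \<open>The rule couples row \<open>i + 1\<close> of \<open>rho\<close> with row
  \<open>i\<close> of \<open>mu\<close>, and a maximum plus the corresponding minimum is a sum. Only
  the first row of \<open>rho\<close> has no partner, and it carries the \<open>k\<close>.\<close>

lemma row_rule_card:
  assumes "row_rule mu lam nu rho k"
  shows "card (diagram rho) + card (diagram mu) = card (diagram lam) + card (diagram nu) + k"
proof -
  note R = assms[unfolded row_rule_def]
  have p: "is_partition mu" "is_partition lam" "is_partition nu" "is_partition rho"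
    using R hstrip_partition by blast+
  obtain q where q: "\<And>i. q < i \<Longrightarrow> rho i = 0"
    using is_partition_bound[OF p(4)] by blast
  have z: "lam i = 0" "nu i = 0" "mu i = 0" if "q < i" for i
  proof -
    show "lam i = 0" "nu i = 0"
      using R q[OF that] hstrip_le[of lam rho i] hstrip_le[of nu rho i] by auto
    then show "mu i = 0"
      using R hstrip_le[of mu lam i] by auto
  qed
  have "(\<Sum>i\<in>{1..Suc q}. rho i) + (\<Sum>i\<in>{1..q}. mu i)
      = rho 1 + (\<Sum>i\<in>{1..q}. rho (i + 1) + mu i)"
    unfolding sum_shift_first by (simp add: sum.distrib)
  also have "(\<Sum>i\<in>{1..q}. rho (i + 1) + mu i) =
      (\<Sum>i\<in>{1..q}. max (lam (i + 1)) (nu (i + 1)) + min (lam i) (nu i))"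
    using R by (intro sum.cong) auto
  also have "rho 1 + \<dots> = (\<Sum>i\<in>{1..Suc q}. max (lam i) (nu i)) + (\<Sum>i\<in>{1..q}. min (lam i) (nu i)) + k"
    using R unfolding sum_shift_first by (simp add: sum.distrib)
  also have "(\<Sum>i\<in>{1..Suc q}. max (lam i) (nu i)) = (\<Sum>i\<in>{1..q}. max (lam i) (nu i))"
    by (simp add: z)
  also have "(\<Sum>i\<in>{1..q}. max (lam i) (nu i)) + (\<Sum>i\<in>{1..q}. min (lam i) (nu i))
      = (\<Sum>i\<in>{1..q}. lam i + nu i)"
    by (subst sum.distrib[symmetric], rule sum.cong) auto
  finally show ?thesis
    using q z by (simp add: card_diagram[where q = q] p sum.distrib)
qed

text \<open>Interlacing with \<open>lam\<close> and \<open>nu\<close> confines \<open>mu i\<close>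
  and \<open>rho (i + 1)\<close> to one and the same interval. A reflection is its own inverse, so
  the two directions are the same computation; going backward, \<open>k\<close> is the excess of
  \<open>rho 1\<close> over \<open>max (lam 1) (nu 1)\<close>.\<close>

interpretation row: growth hstrip row_rule "\<lambda>_. True"
proof
  fix mu nu :: "nat \<Rightarrow> nat"
  show "is_partition mu \<Longrightarrow> hstrip mu mu" by (auto simp: hstrip_def is_partition_def)
  show "hstrip mu nu \<Longrightarrow> mu i \<le> nu i" for i by (rule hstrip_le)
next
  fix mu lam nu rho :: "nat \<Rightarrow> nat" and k
  assume R: "row_rule mu lam nu rho k"
  then show "hstrip mu lam" "hstrip nu rho" "hstrip mu nu" "hstrip lam rho"
    by (auto simp: row_rule_def)
  show "card (diagram rho) + card (diagram mu) = card (diagram lam) + card (diagram nu) + k"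
    by (rule row_rule_card[OF R])
next
  fix mu lam nu :: "nat \<Rightarrow> nat" and k
  assume h: "hstrip mu lam" "hstrip mu nu"
  \<comment> \<open>The subtraction does not truncate, as \<open>mu\<close> is contained in both
    \<open>lam\<close> and \<open>nu\<close>.\<close>
  define rho where "rho i = (if i = 0 then 0 else if i = 1 then max (lam 1) (nu 1) + k
    else max (lam i) (nu i) + min (lam (i - 1)) (nu (i - 1)) - mu (i - 1))" for i
  have e: "rho (i + 1) + mu i = max (lam (i + 1)) (nu (i + 1)) + min (lam i) (nu i)" if "1 \<le> i" for i
    using that hstrip_le[OF h(1), of i] hstrip_le[OF h(2), of i] by (simp add: rho_def)
  have lo: "lam i \<le> rho i" "nu i \<le> rho i" if "1 \<le> i" for i
  proof -
    have "max (lam i) (nu i) \<le> rho i"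
    proof (cases "i = 1")
      case False
      with that have "1 \<le> i - 1" "i - 1 + 1 = i" by simp_all
      then show ?thesis
        using e[of "i - 1"] hstrip_le[OF h(1), of "i - 1"] hstrip_le[OF h(2), of "i - 1"]
        by (auto simp: max_def min_def split: if_splits)
    qed (simp add: rho_def)
    then show "lam i \<le> rho i" "nu i \<le> rho i" by simp_all
  qed
  have hi: "rho (i + 1) \<le> lam i" "rho (i + 1) \<le> nu i" if "1 \<le> i" for i
    using e[OF that] hstrip_Suc_le[OF h(1) that] hstrip_Suc_le[OF h(2) that] by simp_all
  have "row_rule mu lam nu rho k"
    using h lo hi e hstrip_partition[OF h(1)] hstrip_partition[OF h(2)]
    by (auto simp: row_rule_def rho_def[of 0] rho_def[of 1] rho_def[of "Suc 0"] intro!: hstripI')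
  then show "\<exists>rho. row_rule mu lam nu rho k" by blast
next
  fix mu lam nu rho rho' :: "nat \<Rightarrow> nat" and k
  assume R: "row_rule mu lam nu rho k" "row_rule mu lam nu rho' k"
  show "rho = rho'"
  proof (rule eq_from_rows)
    show "rho 0 = rho' 0"
      using R by (auto simp: row_rule_def hstrip_def is_partition_def)
    show "rho 1 = rho' 1" using R by (auto simp: row_rule_def)
    fix i :: nat assume "1 \<le> i"
    then have "rho (i + 1) + mu i = rho' (i + 1) + mu i"
      using R by (simp add: row_rule_def)
    then show "rho (i + 1) = rho' (i + 1)" by simp
  qed
next
  fix lam rho nu :: "nat \<Rightarrow> nat"
  assume h: "hstrip lam rho" "hstrip nu rho"
  define mu where "mu i = (if i = 0 then 0
    else max (lam (i + 1)) (nu (i + 1)) + min (lam i) (nu i) - rho (i + 1))" for i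
  have e: "rho (i + 1) + mu i = max (lam (i + 1)) (nu (i + 1)) + min (lam i) (nu i)" if "1 \<le> i" for i
    using that hstrip_Suc_le[OF h(1) that] hstrip_Suc_le[OF h(2) that] by (simp add: mu_def)
  have hi: "mu i \<le> lam i" "mu i \<le> nu i" if "1 \<le> i" for i
    using e[OF that] hstrip_le[OF h(1), of "i + 1"] hstrip_le[OF h(2), of "i + 1"] by auto
  have lo: "lam (i + 1) \<le> mu i" "nu (i + 1) \<le> mu i" if "1 \<le> i" for i
    using e[OF that] hstrip_Suc_le[OF h(1) that] hstrip_Suc_le[OF h(2) that] by simp_all
  have "max (lam 1) (nu 1) \<le> rho 1"
    using hstrip_le[OF h(1)] hstrip_le[OF h(2)] by simp
  then have "row_rule mu lam nu rho (rho 1 - max (lam 1) (nu 1))"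
    using h lo hi e hstrip_partition[OF h(1)] hstrip_partition[OF h(2)]
    by (auto simp: row_rule_def mu_def[of 0] intro!: hstripI)
  then show "\<exists>mu k. row_rule mu lam nu rho k" by blast
next
  fix mu lam nu rho mu' :: "nat \<Rightarrow> nat" and k k'
  assume R: "row_rule mu lam nu rho k" "row_rule mu' lam nu rho k'"
  show "mu = mu'"
  proof
    fix i show "mu i = mu' i"
    proof (cases "i = 0")
      case True
      then show ?thesis using R by (auto simp: row_rule_def hstrip_def is_partition_def)
    next
      case False
      then have "rho (i + 1) + mu i = rho (i + 1) + mu' i"
        using R by (simp add: row_rule_def)
      then show ?thesis by simp
    qed
  qed
next
  fix lam nu :: "nat \<Rightarrow> nat"
  assume h: "hstrip lam nu"
  then show "row_rule lam lam nu nu 0"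
    using hstrip_le[OF h]
    by (auto simp: row_rule_def hstrip_def is_partition_def max_absorb2 min_absorb1)
qed simp_all

text \<open>
  The letters of one size are pushed from the bottom row upwards. The carry \<open>u i\<close> counts the letters
  displaced in row \<open>i\<close> or arriving there from below; it moves on to row \<open>i - 1\<close> precisely when
  \<open>nu (i - 1) = lam i\<close>, that is, when the box after the end of row \<open>i\<close> of \<open>lam\<close> has no smaller entry
  above it.
\<close>

definition column_carry ::
  "(nat \<Rightarrow> nat) \<Rightarrow> (nat \<Rightarrow> nat) \<Rightarrow> (nat \<Rightarrow> nat) \<Rightarrow> (nat \<Rightarrow> nat) \<Rightarrow> (nat \<Rightarrow> nat) \<Rightarrow> bool" where
  "column_carry mu lam nu rho u \<longleftrightarrow> rho 1 = lam 1 + u 1 \<and> (\<forall>i\<ge>1. u i \<le> 1 \<and>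
     (if nu i = lam (i + 1) then mu i = nu i \<and> u (i + 1) = u i \<and> rho (i + 1) = lam (i + 1)
      else nu i = mu i + u i \<and> rho (i + 1) = lam (i + 1) + u (i + 1)))"

lemma column_carryD:
  assumes "column_carry mu lam nu rho u" "1 \<le> i"
  shows "u i \<le> 1"
    "nu i = lam (i + 1) \<Longrightarrow> mu i = nu i \<and> u (i + 1) = u i \<and> rho (i + 1) = lam (i + 1)"
    "nu i \<noteq> lam (i + 1) \<Longrightarrow> nu i = mu i + u i \<and> rho (i + 1) = lam (i + 1) + u (i + 1)"
  using assms by (auto simp: column_carry_def)

text \<open>Letters of the new value enter below all rows, which is expressed by the carry being
  \<open>k\<close> from some row on. The existential bound avoids fixing a number of rows.\<close>

definition column_rule ::
  "(nat \<Rightarrow> nat) \<Rightarrow> (nat \<Rightarrow> nat) \<Rightarrow> (nat \<Rightarrow> nat) \<Rightarrow> (nat \<Rightarrow> nat) \<Rightarrow> nat \<Rightarrow> bool" where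
  "column_rule mu lam nu rho k \<longleftrightarrow>
     hstrip mu lam \<and> vstrip mu nu \<and> vstrip lam rho \<and> hstrip nu rho \<and>
     (\<exists>u q. column_carry mu lam nu rho u \<and> (\<forall>i>q. u i = k))"

lemma column_ruleI:
  assumes "hstrip mu lam" "vstrip mu nu" "vstrip lam rho" "hstrip nu rho"
    and "column_carry mu lam nu rho u" "\<forall>i>q. u i = k"
  shows "column_rule mu lam nu rho k"
  using assms unfolding column_rule_def by blast

lemma column_ruleE:
  assumes "column_rule mu lam nu rho k"
  obtains u q where "column_carry mu lam nu rho u" "\<And>i. q < i \<Longrightarrow> u i = k"
  using assms by (auto simp: column_rule_def)

lemma column_rule_strips:
  assumes "column_rule mu lam nu rho k"
  shows "hstrip mu lam" "hstrip nu rho" "vstrip mu nu" "vstrip lam rho"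
  using assms by (simp_all add: column_rule_def)

lemma column_rule_card:
  assumes "column_rule mu lam nu rho k"
  shows "card (diagram rho) + card (diagram mu) = card (diagram lam) + card (diagram nu) + k"
proof -
  note R = column_rule_strips[OF assms]
  obtain u q0 where C: "column_carry mu lam nu rho u" and u: "\<And>i. q0 < i \<Longrightarrow> u i = k"
    using column_ruleE[OF assms] by blast
  have p: "is_partition mu" "is_partition lam" "is_partition nu" "is_partition rho"
    using R hstrip_partition by blast+
  obtain q1 where q1: "\<And>i. q1 < i \<Longrightarrow> rho i = 0"
    using is_partition_bound[OF p(4)] by blast
  define q where "q = max q0 q1"
  have z: "rho i = 0" "lam i = 0" "nu i = 0" "mu i = 0" if "q < i" for i
  proof -
    show "rho i = 0" using q1 that by (simp add: q_def)
    then show "lam i = 0" "nu i = 0"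
      using R vstrip_le[of lam rho i] hstrip_le[of nu rho i] by auto
    then show "mu i = 0"
      using R hstrip_le[of mu lam i] by auto
  qed
  text \<open>In both branches, \<open>rho - lam\<close> in row \<open>i + 1\<close> exceeds \<open>nu - mu\<close> in row \<open>i\<close> by \<open>u (i + 1) - u i\<close>.\<close>
  have e: "rho (i + 1) + mu i + u i = lam (i + 1) + nu i + u (i + 1)" if "1 \<le> i" for i
    using column_carryD[OF C that] by (cases "nu i = lam (i + 1)") auto
  have "(\<Sum>i\<in>{1..q}. rho (i + 1) + mu i + u i) = (\<Sum>i\<in>{1..q}. lam (i + 1) + nu i + u (i + 1))"
    using e by (intro sum.cong) auto
  \<comment> \<open>The carries telescope: \<open>u 1\<close> is absorbed by the first row, and
    \<open>u (q + 1) = k\<close> is what came in.\<close>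
  moreover have "(\<Sum>i\<in>{1..q}. u i) + u (q + 1) = u 1 + (\<Sum>i\<in>{1..q}. u (i + 1))"
    using sum_shift_first[of u q] by simp
  moreover have "u (q + 1) = k" using u by (simp add: q_def)
  moreover have "(\<Sum>i\<in>{1..Suc q}. rho i) = rho 1 + (\<Sum>i\<in>{1..q}. rho (i + 1))"
    "(\<Sum>i\<in>{1..Suc q}. lam i) = lam 1 + (\<Sum>i\<in>{1..q}. lam (i + 1))"
    by (rule sum_shift_first)+
  ultimately have "(\<Sum>i\<in>{1..Suc q}. rho i) + (\<Sum>i\<in>{1..q}. mu i) =
      (\<Sum>i\<in>{1..Suc q}. lam i) + (\<Sum>i\<in>{1..q}. nu i) + k"
    using C by (simp add: sum.distrib column_carry_def)
  then show ?thesis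
    using z by (simp add: card_diagram[where q = q] p)
qed

lemma column_rule_forward:
  assumes h: "hstrip mu lam" "vstrip mu nu" and k: "k \<le> 1"
  shows "\<exists>rho. column_rule mu lam nu rho k"
proof -
  have p: "is_partition mu" "is_partition lam" "is_partition nu"
    using h hstrip_partition vstrip_partition by blast+
  define X where "X i \<longleftrightarrow> nu i = lam (i + 1)" for i
  \<comment> \<open>The recursion for the carry runs upwards without a bottom row to start from, so
    it is solved in closed form. Rows satisfying \<open>X\<close> pass the carry on, and at the
    first row \<open>n \<ge> i\<close> that does not, it must equal \<open>nu n - mu n\<close>. If
    there is no such row, the incoming \<open>k\<close> passes through.\<close>
  define u where "u i = (if \<exists>n\<ge>i. \<not> X n then (let n = LEAST n. i \<le> n \<and> \<not> X n in nu n - mu n) else k)" for i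
  have u_X: "u (i + 1) = u i" if "X i" for i
  proof -
    have "i \<le> n \<and> \<not> X n \<longleftrightarrow> i + 1 \<le> n \<and> \<not> X n" for n
      using that by (cases "n = i") auto
    then show ?thesis unfolding u_def by (simp only:)
  qed
  have u_not_X: "u i = nu i - mu i" if "\<not> X i" for i
  proof -
    have "(LEAST n. i \<le> n \<and> \<not> X n) = i" using that by (intro Least_equality) auto
    then show ?thesis using that by (auto simp: u_def)
  qed
  have u_le: "u i \<le> 1" for i
    using k vstrip_le_Suc[OF h(2)] by (auto simp: u_def Let_def le_diff_conv add.commute)
  obtain q1 q2 where q: "\<And>i. q1 < i \<Longrightarrow> lam i = 0" "\<And>i. q2 < i \<Longrightarrow> nu i = 0"
    using is_partition_bound[OF p(2)] is_partition_bound[OF p(3)] by metis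
  \<comment> \<open>Far below, \<open>lam\<close> and \<open>nu\<close> vanish, so every row
    satisfies \<open>X\<close>.\<close>
  have u_k: "\<forall>i>max q1 q2. u i = k"
    using q by (auto simp: u_def X_def)
  define rho where "rho i = (if i = 0 then 0 else if i = 1 then lam 1 + u 1
    else if X (i - 1) then lam i else lam i + u i)" for i
  have mu_X: "mu i = nu i" if "X i" "1 \<le> i" for i
    using that vstrip_le[OF h(2), of i] hstrip_Suc_le[OF h(1), of i] by (simp add: X_def)
  have rho_Suc: "rho (i + 1) = (if X i then lam (i + 1) else lam (i + 1) + u (i + 1))" if "1 \<le> i" for i
    using that by (simp add: rho_def)
  have lam_rho: "lam i \<le> rho i" "rho i \<le> lam i + 1" if "1 \<le> i" for i
    using that u_le[of i] by (auto simp: rho_def)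
  have hi: "rho (i + 1) \<le> nu i" if i: "1 \<le> i" for i
    using u_le[of "i + 1"] rho_Suc[OF i] hstrip_Suc_le[OF h(1) i] vstrip_le[OF h(2), of i]
    by (auto simp: X_def split: if_splits)
  \<comment> \<open>The critical rows are those where \<open>nu\<close> already has one box more
    than \<open>lam\<close>. There the carry is 1, and the row cannot be skipped:
    \<open>nu (i - 1) \<ge> nu i > lam i\<close> excludes \<open>X (i - 1)\<close>.\<close>
  have lo: "nu i \<le> rho i" if i: "1 \<le> i" for i
  proof (cases "nu i \<le> lam i")
    case True
    then show ?thesis using lam_rho(1)[OF i] by simp
  next
    case False
    then have eq: "nu i = mu i + 1" "lam i = mu i"
      using vstrip_le_Suc[OF h(2), of i] hstrip_le[OF h(1), of i] by simp_all
    then have "\<not> X i" using mu_X[OF _ i] by auto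
    then have "u i = 1" using u_not_X eq by simp
    moreover have "\<not> X (i - 1)" if "i \<noteq> 1"
    proof -
      have "1 \<le> i - 1" using that i by simp
      then show ?thesis
        using is_partition_antimono[OF p(3), of "i - 1" i] eq i by (simp add: X_def)
    qed
    ultimately show ?thesis using i eq by (cases "i = 1") (simp_all add: rho_def)
  qed
  have "hstrip nu rho" using p(3) lo hi by (intro hstripI') (auto simp: rho_def)
  moreover from this have "vstrip lam rho"
    using lam_rho p(2) hstrip_partition(2) by (auto simp: vstrip_def)
  moreover have "rho 1 = lam 1 + u 1" by (simp add: rho_def)
  moreover have "if nu i = lam (i + 1) then mu i = nu i \<and> u (i + 1) = u i \<and> rho (i + 1) = lam (i + 1)
       else nu i = mu i + u i \<and> rho (i + 1) = lam (i + 1) + u (i + 1)" if i: "1 \<le> i" for i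
    using u_X[of i] u_not_X[of i] mu_X[OF _ i] rho_Suc[OF i] vstrip_le[OF h(2), of i]
    by (auto simp: X_def)
  ultimately have "column_carry mu lam nu rho u"
    unfolding column_carry_def using u_le by blast
  then show ?thesis
    using column_ruleI[OF h \<open>vstrip lam rho\<close> \<open>hstrip nu rho\<close> _ u_k] by blast
qed

lemma column_rule_backward:
  assumes h: "vstrip lam rho" "hstrip nu rho"
  shows "\<exists>mu k. column_rule mu lam nu rho k"
proof -
  have p: "is_partition lam" "is_partition rho" "is_partition nu"
    using h hstrip_partition vstrip_partition by blast+
  define X where "X i \<longleftrightarrow> nu i = lam (i + 1)" for i
  \<comment> \<open>Backwards, the carry is determined from the first row downwards. The guard
    \<open>1 \<le> i\<close> makes row 1 always be read off from \<open>rho 1 - lam 1\<close>; the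
    value at index 0 is a dummy.\<close>
  define u where "u = rec_nat 0 (\<lambda>i x. if 1 \<le> i \<and> X i then x else rho (i + 1) - lam (i + 1))"
  have u_1: "u 1 = rho 1 - lam 1" by (simp add: u_def)
  have u_X: "u (i + 1) = u i" if "X i" "1 \<le> i" for i
    using that by (simp add: u_def)
  have u_not_X: "u (i + 1) = rho (i + 1) - lam (i + 1)" if "\<not> X i" for i
    using that by (simp add: u_def)
  have u_le: "u i \<le> 1" for i
  proof (induction i)
    case (Suc i)
    then show ?case
      using vstrip_le_Suc[OF h(1), of "Suc i"] by (auto simp: u_def le_diff_conv)
  qed (simp add: u_def)
  define mu where "mu i = (if i = 0 then 0 else if X i then nu i else nu i - u i)" for i
  have rho_X: "rho (i + 1) = lam (i + 1)" if "X i" "1 \<le> i" for i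
    using that vstrip_le[OF h(1), of "i + 1"] hstrip_Suc_le[OF h(2), of i] by (simp add: X_def)
  have not_X: "lam (i + 1) < nu i" if "\<not> X i" "1 \<le> i" for i
    using that vstrip_le[OF h(1), of "i + 1"] hstrip_Suc_le[OF h(2), of i] by (simp add: X_def)
  have lo: "lam (i + 1) \<le> mu i" if i: "1 \<le> i" for i
    using not_X[OF _ i] u_le[of i] i by (cases "X i") (auto simp: mu_def X_def)
  \<comment> \<open>When \<open>X i\<close> fails, only \<open>nu i = lam i + 1\<close> is critical.
    Then \<open>rho\<close> has gained a box in row \<open>i\<close> as well, so the carry there is
    1 and is taken off again.\<close>
  have hi: "mu i \<le> lam i" if i: "1 \<le> i" for i
  proof (cases "X i")
    case True
    then show ?thesis using is_partition_antimono[OF p(1) i, of "i + 1"] i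
      by (simp add: mu_def X_def)
  next
    case False
    show ?thesis
    proof (cases "nu i \<le> lam i")
      case True
      then show ?thesis using i False by (simp add: mu_def)
    next
      case gt: False
      then have eq: "rho i = lam i + 1" "nu i = lam i + 1"
        using vstrip_le_Suc[OF h(1), of i] hstrip_le[OF h(2), of i] by simp_all
      have "u i = 1"
      proof (cases "i = 1")
        case True
        then show ?thesis using u_1 eq by simp
      next
        case ne: False
        then have "1 \<le> i - 1" "i - 1 + 1 = i" using i by simp_all
        moreover from this have "\<not> X (i - 1)" using rho_X[of "i - 1"] eq by auto
        ultimately show ?thesis using u_not_X[of "i - 1"] eq by simp
      qed
      then show ?thesis using False eq i by (simp add: mu_def)
    qed
  qed
  have hs: "hstrip mu lam" using p(1) lo hi by (intro hstripI) (auto simp: mu_def)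
  have vs: "vstrip mu nu"
  proof -
    have "nu i \<le> nu i - u i + 1" for i using u_le[of i] by linarith
    then show ?thesis
      using p(3) hstrip_partition[OF hs] by (auto simp: vstrip_def mu_def)
  qed
  have "rho 1 = lam 1 + u 1"
    using u_1 vstrip_le[OF h(1), of 1] by simp
  moreover have "if nu i = lam (i + 1) then mu i = nu i \<and> u (i + 1) = u i \<and> rho (i + 1) = lam (i + 1)
       else nu i = mu i + u i \<and> rho (i + 1) = lam (i + 1) + u (i + 1)" if i: "1 \<le> i" for i
    using u_X[OF _ i] u_not_X[of i] rho_X[OF _ i] not_X[OF _ i] u_le[of i] i
      vstrip_le[OF h(1), of "i + 1"]
    by (auto simp: X_def mu_def)
  ultimately have C: "column_carry mu lam nu rho u"
    unfolding column_carry_def using u_le by blast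
  \<comment> \<open>Below all rows \<open>X\<close> holds, so the carry is constant there; this
    constant is the required \<open>k\<close>.\<close>
  obtain q where "\<forall>i>q. u i = u (q + 1)"
  proof -
    obtain q1 q2 where q: "\<And>i. q1 < i \<Longrightarrow> lam i = 0" "\<And>i. q2 < i \<Longrightarrow> nu i = 0"
      using is_partition_bound[OF p(1)] is_partition_bound[OF p(3)] by metis
    define q where "q = max q1 q2"
    have "u i = u (q + 1)" if "q + 1 \<le> i" for i
      using that
    proof (induction i rule: dec_induct)
      case (step n)
      then have "X n" using q by (auto simp: X_def q_def)
      with step u_X[of n] show ?case by simp
    qed simp
    then have "\<forall>i>q. u i = u (q + 1)" by (metis Suc_eq_plus1 Suc_leI)
    then show thesis by (rule that)
  qed
  from column_ruleI[OF hs vs h C this] show ?thesis by blast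
qed

text \<open>Two carries agree far below, where both equal \<open>k\<close>, and agreement climbs row
  by row.\<close>

lemma column_rule_forward_unique:
  assumes "column_rule mu lam nu rho k" "column_rule mu lam nu rho' k"
  shows "rho = rho'"
proof -
  obtain u q where C: "column_carry mu lam nu rho u" and u: "\<And>i. q < i \<Longrightarrow> u i = k"
    using column_ruleE[OF assms(1)] by blast
  obtain u' q' where C': "column_carry mu lam nu rho' u'" and u': "\<And>i. q' < i \<Longrightarrow> u' i = k"
    using column_ruleE[OF assms(2)] by blast
  note X = column_carryD[OF C] and X' = column_carryD[OF C']
  have uu: "u i = u' i" if "1 \<le> i" for i
  proof (cases "i \<le> max q q' + 1")
    case True
    then show ?thesis
      using that
    proof (induction rule: inc_induct)
      case (step n)
      then show ?case
        using X[of n] X'[of n] by (cases "nu n = lam (n + 1)") auto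
    qed (use u u' in simp)
  qed (use u u' in simp)
  show ?thesis
  proof (rule eq_from_rows)
    show "rho 0 = rho' 0"
      using assms by (simp add: column_rule_def hstrip_def is_partition_def)
    show "rho 1 = rho' 1" using C C' uu by (simp add: column_carry_def)
    show "rho (i + 1) = rho' (i + 1)" if "1 \<le> i" for i
      using X[OF that] X'[OF that] uu[of "i + 1"] by (cases "nu i = lam (i + 1)") auto
  qed
qed

text \<open>Here agreement of the carries starts in the first row, as
  \<open>rho 1 = lam 1 + u 1\<close>, and descends.\<close>

lemma column_rule_backward_unique:
  assumes "column_rule mu lam nu rho k" "column_rule mu' lam nu rho k'"
  shows "mu = mu'"
proof -
  obtain u where C: "column_carry mu lam nu rho u"
    using column_ruleE[OF assms(1)] by blast
  obtain u' where C': "column_carry mu' lam nu rho u'"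
    using column_ruleE[OF assms(2)] by blast
  note X = column_carryD[OF C] and X' = column_carryD[OF C']
  have uu: "u i = u' i" if "1 \<le> i" for i
    using that
  proof (induction i rule: dec_induct)
    case (step n)
    then show ?case
        using X[of n] X'[of n] by (cases "nu n = lam (n + 1)") auto
  qed (use C C' in \<open>simp add: column_carry_def\<close>)
  show ?thesis
  proof
    fix i show "mu i = mu' i"
    proof (cases "i = 0")
      case True
      then show ?thesis using assms by (simp add: column_rule_def hstrip_def is_partition_def)
    next
      case False
      then show ?thesis
        using X[of i] X'[of i] uu[of i] by (cases "nu i = lam (i + 1)") auto
    qed
  qed
qed

interpretation column: growth vstrip column_rule "\<lambda>k. k \<le> 1"
proof
  fix mu nu :: "nat \<Rightarrow> nat"
  show "is_partition mu \<Longrightarrow> vstrip mu mu" by (auto simp: vstrip_def)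
  show "vstrip mu nu \<Longrightarrow> mu i \<le> nu i" for i by (rule vstrip_le)
next
  fix mu lam nu rho :: "nat \<Rightarrow> nat" and k
  assume R: "column_rule mu lam nu rho k"
  then show "hstrip mu lam" "hstrip nu rho" "vstrip mu nu" "vstrip lam rho"
    by (rule column_rule_strips)+
  obtain u q where C: "column_carry mu lam nu rho u" and u: "\<And>i. q < i \<Longrightarrow> u i = k"
    using column_ruleE[OF R] by blast
  show "k \<le> 1" using column_carryD(1)[OF C, of "q + 1"] u[of "q + 1"] by simp
  show "card (diagram rho) + card (diagram mu) = card (diagram lam) + card (diagram nu) + k"
    by (rule column_rule_card[OF R])
next
  fix lam nu :: "nat \<Rightarrow> nat"
  assume h: "vstrip lam nu"
  \<comment> \<open>In a stationary square the carry is the vertical strip itself.\<close>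
  define u where "u i = nu i - lam i" for i
  obtain q where q: "\<And>i. q < i \<Longrightarrow> nu i = 0"
    using is_partition_bound[OF vstrip_partition(2)[OF h]] by blast
  have p: "lam i \<le> nu i" "nu i \<le> lam i + 1" "1 \<le> i \<Longrightarrow> lam (i + 1) \<le> lam i" "1 \<le> i \<Longrightarrow> nu (i + 1) \<le> nu i" for i
    using vstrip_le[OF h, of i] vstrip_le_Suc[OF h, of i]
      is_partition_antimono[OF vstrip_partition(1)[OF h], of i "i + 1"]
      is_partition_antimono[OF vstrip_partition(2)[OF h], of i "i + 1"] by auto
  have hs: "hstrip lam lam" "hstrip nu nu"
    using vstrip_partition[OF h] by (auto simp: hstrip_def is_partition_def)
  have "nu 1 = lam 1 + u 1" using p(1)[of 1] by (simp add: u_def)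
  moreover have "u i \<le> 1" for i using p(2)[of i] by (simp add: u_def)
  moreover have "if nu i = lam (i + 1) then lam i = nu i \<and> u (i + 1) = u i \<and> nu (i + 1) = lam (i + 1)
       else nu i = lam i + u i \<and> nu (i + 1) = lam (i + 1) + u (i + 1)" if i: "1 \<le> i" for i
    using p(1)[of i] p(3,4)[OF i] p(1)[of "i + 1"] by (auto simp: u_def)
  ultimately have "column_carry lam lam nu nu u"
    unfolding column_carry_def by blast
  moreover have "\<forall>i>q. u i = 0" using q by (simp add: u_def)
  ultimately show "column_rule lam lam nu nu 0"
    by (rule column_ruleI[OF hs(1) h h hs(2)])
qed (fact column_rule_forward column_rule_backward column_rule_forward_unique
    column_rule_backward_unique)+

section \<open>The pushing rules as bijections of labels\<close>

lemma bij_betw_rank: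
  fixes J :: "nat set"
  assumes "finite J"
  shows "bij_betw (\<lambda>j. card {a \<in> J. a \<le> j}) J {1..card J}"
proof -
  let ?r = "\<lambda>j. card {a \<in> J. a \<le> j}"
  have less: "?r i < ?r j" if "i < j" "j \<in> J" for i j
  proof (rule psubset_card_mono)
    show "finite {a \<in> J. a \<le> j}" using assms by simp
    have "j \<in> {a \<in> J. a \<le> j}" "j \<notin> {a \<in> J. a \<le> i}" using that by auto
    moreover have "{a \<in> J. a \<le> i} \<subseteq> {a \<in> J. a \<le> j}" using that by auto
    ultimately show "{a \<in> J. a \<le> i} \<subset> {a \<in> J. a \<le> j}" by blast
  qed
  have inj: "inj_on ?r J"
    by (rule linorder_inj_onI') (use less in \<open>simp add: less_imp_neq\<close>)
  have "?r ` J \<subseteq> {1..card J}"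
  proof
    fix x assume "x \<in> ?r ` J"
    then obtain j where j: "j \<in> J" "x = ?r j" by blast
    moreover have "?r j \<le> card J" by (rule card_mono[OF assms]) auto
    moreover have "card {j} \<le> ?r j" using j assms by (intro card_mono) auto
    ultimately show "x \<in> {1..card J}" by simp
  qed
  then have "?r ` J = {1..card J}"
    using card_image[OF inj] by (intro card_subset_eq) auto
  with inj show ?thesis by (rule bij_betw_imageI)
qed

text \<open>The indeterminate that the pushing rule puts into a box.\<close>

definition row_label :: "nat set \<Rightarrow> nat \<times> nat \<Rightarrow> indet" where
  "row_label K = (\<lambda>(i, j). if i \<in> K
     then (if j = 1 then Inl (card {b \<in> K. b \<le> i}, 1) else Inr (i, j - 1)) else Inr (i, j))"

definition column_label :: "nat set \<Rightarrow> nat \<times> nat \<Rightarrow> indet" where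
  "column_label J = (\<lambda>(i, j). if j \<in> J
     then (if i = 1 then Inr (1, card {a \<in> J. a \<le> j}) else Inl (i - 1, j)) else Inl (i, j))"

text \<open>Transposing diagrams and exchanging the roles of the two tableaux carries
  \<open>row_label\<close> to \<open>column_label\<close>, so only one of the two labellings needs a
  direct bijection proof.\<close>

definition flip_indet :: "indet \<Rightarrow> indet" where
  "flip_indet = case_sum (Inr \<circ> prod.swap) (Inl \<circ> prod.swap)"

lemma flip_indet_simps [simp]:
  "flip_indet (Inl (i, j)) = Inr (j, i)" "flip_indet (Inr (i, j)) = Inl (j, i)"
  by (simp_all add: flip_indet_def)

lemma inj_flip_indet: "inj flip_indet"
  by (rule injI) (auto simp: flip_indet_def split: sum.splits)

lemma column_label_flip: "column_label J (i, j) = flip_indet (row_label J (j, i))"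
  by (simp add: column_label_def row_label_def)

lemma push_rows_label:
  "b \<in> diagram (add_rows lam K) \<Longrightarrow> push_rows lam K (v \<circ> Inl) (v \<circ> Inr) b = v (row_label K b)"
  by (cases b) (simp add: push_rows_def row_label_def)

lemma push_columns_label:
  "b \<in> diagram (add_columns lam J) \<Longrightarrow>
    push_columns lam J (v \<circ> Inl) (v \<circ> Inr) b = v (column_label J b)"
  by (cases b) (simp add: push_columns_def column_label_def)

lemma bij_betw_row_label:
  assumes lam: "is_partition lam" and nu: "is_partition (add_rows lam K)" and "finite K"
  shows "bij_betw (row_label K) (diagram (add_rows lam K))
    (Inl ` diagram (one_column (card K)) \<union> Inr ` diagram lam)"
proof (rule bij_betw_imageI)
  note rank = bij_betw_rank[OF \<open>finite K\<close>]
  have D: "diagram (add_rows lam K) = {(i, j). 1 \<le> i \<and> 1 \<le> j \<and> j \<le> lam i + (if i \<in> K then 1 else 0)}"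
    unfolding diagram_partition[OF nu] by (auto simp: add_rows_def split: if_splits)
  have K: "1 \<le> i" if "i \<in> K" for i
    using that is_partition_zero[OF nu] by (cases "i = 0") (auto simp: add_rows_def)
  show "inj_on (row_label K) (diagram (add_rows lam K))"
  proof (rule inj_onI)
    fix x y assume xy: "x \<in> diagram (add_rows lam K)" "y \<in> diagram (add_rows lam K)"
      and eq: "row_label K x = row_label K y"
    obtain i j k l where ij: "x = (i, j)" "y = (k, l)" by (cases x; cases y)
    have "1 \<le> j" "1 \<le> l" using xy by (auto simp: D ij)
    then show "x = y"
      using eq inj_onD[OF bij_betw_imp_inj_on[OF rank], of i k]
      by (auto simp: ij row_label_def split: if_splits)
  qed
  show "row_label K ` diagram (add_rows lam K) =
    Inl ` diagram (one_column (card K)) \<union> Inr ` diagram lam" (is "?A = ?B")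
  proof (intro subset_antisym subsetI)
    fix x assume "x \<in> ?A"
    then obtain i j where ij: "1 \<le> i" "1 \<le> j" "j \<le> lam i + (if i \<in> K then 1 else 0)"
      "x = row_label K (i, j)" by (auto simp: D)
    show "x \<in> ?B"
    proof (cases "i \<in> K \<and> j = 1")
      case True
      then have "card {b \<in> K. b \<le> i} \<in> {1..card K}"
        using bij_betw_apply[OF rank] by blast
      then show ?thesis using True ij by (simp add: row_label_def diagram_one_column)
    next
      case False
      then show ?thesis using ij
        by (auto simp: row_label_def diagram_partition[OF lam])
    qed
  next
    fix x assume "x \<in> ?B"
    then consider k where "k \<in> {1..card K}" "x = Inl (k, 1)"
      | i j where "(i, j) \<in> diagram lam" "x = Inr (i, j)"
      by (auto simp: diagram_one_column)
    then show "x \<in> ?A"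
    proof cases
      case 1
      then obtain i where "i \<in> K" "k = card {b \<in> K. b \<le> i}"
        using bij_betw_imp_surj_on[OF rank] by blast
      then have "(i, 1) \<in> diagram (add_rows lam K)" "x = row_label K (i, 1)"
        using K 1 by (auto simp: D row_label_def)
      then show ?thesis by blast
    next
      case 2
      define b where "b = (i, if i \<in> K then j + 1 else j)"
      have "b \<in> diagram (add_rows lam K)" "x = row_label K b"
        using 2 by (auto simp: D row_label_def b_def diagram_partition[OF lam])
      then show ?thesis by blast
    qed
  qed
qed

lemma card_diagram_add_rows:
  assumes "is_partition lam" "is_partition (add_rows lam K)" "finite K"
  shows "card (diagram (add_rows lam K)) = card (diagram lam) + card K"
proof -
  have "card (diagram (add_rows lam K)) =
      card (Inl ` diagram (one_column (card K)) \<union> (Inr ` diagram lam :: indet set))"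
    by (rule bij_betw_same_card[OF bij_betw_row_label[OF assms]])
  also have "\<dots> = card (diagram (one_column (card K))) + card (diagram lam)"
    by (subst card_Un_disjoint) (auto simp: card_image)
  finally show ?thesis by (simp add: diagram_one_column)
qed

section \<open>Strips and the index sets of the two sums\<close>

lemma E_setD:
  assumes "is_partition lam" "K \<in> E_set lam n"
  shows "vstrip lam (add_rows lam K)" "finite K" "card K = n"
    "card (diagram (add_rows lam K)) = card (diagram lam) + n"
  using assms card_diagram_add_rows[of lam K]
  by (auto simp: E_set_def vstrip_def add_rows_def)

text \<open>The rows in which the two shapes differ are the only candidate for \<open>K\<close>.
  Hence the limit shape of a growth diagram determines its summand on the right.\<close>

lemma vstrip_E_set:
  assumes v: "vstrip lam nu" and c: "card (diagram nu) = card (diagram lam) + n"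
  obtains K where "K \<in> E_set lam n" "add_rows lam K = nu"
proof -
  define K where "K = {i. nu i \<noteq> lam i}"
  note p = vstrip_partition[OF v]
  have add: "add_rows lam K = nu"
  proof
    fix i show "add_rows lam K i = nu i"
      using vstrip_le[OF v, of i] vstrip_le_Suc[OF v, of i] by (auto simp: add_rows_def K_def)
  qed
  have "K \<subseteq> {i. nu i \<noteq> 0}"
    using vstrip_le[OF v] unfolding K_def by (metis (mono_tags, lifting) Collect_mono le_zero_eq)
  then have fin: "finite K" using p(2) finite_subset by (auto simp: is_partition_def)
  have "K \<subseteq> {1..}"
    using is_partition_zero[OF p(1)] is_partition_zero[OF p(2)] by (auto simp: K_def) (metis not_less_eq_eq le_zero_eq)
  moreover have "card K = n"
    using card_diagram_add_rows[OF p(1) _ fin] p(2) c by (simp add: add)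
  ultimately have "K \<in> E_set lam n" using fin p(2) by (simp add: E_set_def add)
  then show thesis using add by (rule that)
qed

lemma add_rows_inject: "add_rows lam K = add_rows lam K' \<Longrightarrow> K = K'"
  by (auto simp: add_rows_def fun_eq_iff split: if_splits)

text \<open>An element \<open>i\<close> of \<open>K\<close> makes row \<open>i\<close>, hence every
  row above it, nonempty, so \<open>i\<close> is bounded by the number of boxes.\<close>

lemma finite_E_set:
  assumes "is_partition lam"
  shows "finite (E_set lam n)"
proof (rule finite_subset)
  show "E_set lam n \<subseteq> Pow {..card (diagram lam) + n}"
  proof (intro subsetI PowI)
    fix K i assume K: "K \<in> E_set lam n" and i: "i \<in> K"
    note p = vstrip_partition[OF E_setD(1)[OF assms K]]
    have "1 \<le> add_rows lam K i" using i by (simp add: add_rows_def)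
    then have "{1..i} \<times> {1} \<subseteq> diagram (add_rows lam K)"
      using is_partition_antimono[OF p(2), of _ i] by (fastforce simp: diagram_partition[OF p(2)])
    then have "card ({1..i} \<times> {1 :: nat}) \<le> card (diagram (add_rows lam K))"
      by (intro card_mono) auto
    then show "i \<in> {..card (diagram lam) + n}"
      using E_setD(4)[OF assms K] by (simp add: card_cartesian_product)
  qed
qed simp

text \<open>By the adjunction for conjugates, both conditions say that the shape grows by at most
  one box per column. This transfers the facts about \<open>E_set\<close> to
  \<open>H_set\<close>.\<close>

lemma hstrip_conj_part:
  assumes lam: "is_partition lam" and nu: "is_partition nu"
  shows "hstrip lam nu \<longleftrightarrow> vstrip (conj_part lam) (conj_part nu)"
proof
  note L = conj_part_iff[OF lam] and N = conj_part_iff[OF nu]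
  assume h: "hstrip lam nu"
  have "conj_part lam j \<le> conj_part nu j" "conj_part nu j \<le> conj_part lam j + 1" if j: "1 \<le> j" for j
  proof -
    show "conj_part lam j \<le> conj_part nu j"
    proof (rule nat_le_via_lower)
      fix i :: nat assume "1 \<le> i" "i \<le> conj_part lam j"
      then show "i \<le> conj_part nu j"
        using hstrip_le[OF h, of i] L[of i j] N[of i j] j by simp
    qed
    show "conj_part nu j \<le> conj_part lam j + 1"
    proof (rule nat_le_via_lower)
      fix i :: nat assume i: "1 \<le> i" "i \<le> conj_part nu j"
      show "i \<le> conj_part lam j + 1"
      proof (cases "i = 1")
        case False
        then have "1 \<le> i - 1" "Suc (i - 1) = i" using i by simp_all
        then show ?thesis
          using hstrip_Suc_le[OF h, of "i - 1"] L[of "i - 1" j] N[of i j] j i by simp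
      qed simp
    qed
  qed
  then show "vstrip (conj_part lam) (conj_part nu)"
    using lam nu by (simp add: vstrip_def is_partition_conj_part)
next
  note L = conj_part_iff[OF lam] and N = conj_part_iff[OF nu]
  assume v: "vstrip (conj_part lam) (conj_part nu)"
  have "lam i \<le> nu i" "nu (i + 1) \<le> lam i" if i: "1 \<le> i" for i
  proof -
    show "lam i \<le> nu i"
    proof (rule nat_le_via_lower)
      fix j :: nat assume "1 \<le> j" "j \<le> lam i"
      then show "j \<le> nu i"
        using vstrip_le[OF v, of j] L[of i j] N[of i j] i by simp
    qed
    show "nu (i + 1) \<le> lam i"
    proof (rule nat_le_via_lower)
      fix j :: nat assume "1 \<le> j" "j \<le> nu (i + 1)"
      then show "j \<le> lam i"
        using vstrip_le_Suc[OF v, of j] L[of i j] N[of "i + 1" j] i by simp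
    qed
  qed
  then show "hstrip lam nu"
    using lam nu by (simp add: hstrip_def)
qed

lemma H_setD:
  assumes lam: "is_partition lam" and J: "J \<in> H_set lam m"
  shows "hstrip lam (add_columns lam J)" "finite J" "card J = m"
    "card (diagram (add_columns lam J)) = card (diagram lam) + m"
    "conj_part (add_columns lam J) = add_rows (conj_part lam) J"
proof -
  note c = is_partition_conj_part[OF lam]
  note E = E_setD[OF c J[unfolded H_set_def]]
  note p = vstrip_partition(2)[OF E(1)]
  show "finite J" "card J = m" by (rule E(2,3))+
  show conj: "conj_part (add_columns lam J) = add_rows (conj_part lam) J"
    by (simp add: add_columns_def conj_part_conj_part[OF p])
  have "is_partition (add_columns lam J)"
    unfolding add_columns_def by (rule is_partition_conj_part[OF p])
  then show "hstrip lam (add_columns lam J)"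
    using hstrip_conj_part[OF lam] E(1) conj by metis
  show "card (diagram (add_columns lam J)) = card (diagram lam) + m"
    using E(4) by (simp add: add_columns_def card_diagram_conj_part p lam)
qed

lemma hstrip_H_set:
  assumes h: "hstrip lam nu" and c: "card (diagram nu) = card (diagram lam) + m"
  obtains J where "J \<in> H_set lam m" "add_columns lam J = nu"
proof -
  note p = hstrip_partition[OF h]
  obtain J where "J \<in> E_set (conj_part lam) m" "add_rows (conj_part lam) J = conj_part nu"
    using vstrip_E_set[of "conj_part lam" "conj_part nu" m] hstrip_conj_part[OF p] h c
    by (auto simp: card_diagram_conj_part p)
  then show thesis
    by (intro that[of J]) (simp_all add: H_set_def add_columns_def conj_part_conj_part p)
qed

lemma add_columns_inject:
  assumes "is_partition lam" "J \<in> H_set lam m" "J' \<in> H_set lam m"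
    "add_columns lam J = add_columns lam J'"
  shows "J = J'"
  using assms H_setD(5) add_rows_inject by metis

lemma finite_H_set: "is_partition lam \<Longrightarrow> finite (H_set lam m)"
  unfolding H_set_def by (intro finite_E_set is_partition_conj_part)

lemma bij_betw_column_label:
  assumes lam: "is_partition lam" and J: "J \<in> H_set lam m"
  shows "bij_betw (column_label J) (diagram (add_columns lam J))
    (Inl ` diagram lam \<union> Inr ` diagram (one_row m))"
proof -
  note c = is_partition_conj_part[OF lam]
  note E = E_setD[OF c J[unfolded H_set_def]]
  note p = vstrip_partition(2)[OF E(1)]
  have "bij_betw (flip_indet \<circ> (row_label J \<circ> prod.swap)) (diagram (add_columns lam J))
      (flip_indet ` (Inl ` diagram (one_column m) \<union> Inr ` diagram (conj_part lam)))"
  proof (intro bij_betw_trans)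
    show "bij_betw prod.swap (diagram (add_columns lam J)) (diagram (add_rows (conj_part lam) J))"
      unfolding add_columns_def diagram_conj_part[OF p]
      by (intro bij_betw_imageI) (auto simp: image_image)
    show "bij_betw (row_label J) (diagram (add_rows (conj_part lam) J))
        (Inl ` diagram (one_column m) \<union> Inr ` diagram (conj_part lam))"
      using bij_betw_row_label[OF c p E(2)] E(3) by simp
    show "bij_betw flip_indet (Inl ` diagram (one_column m) \<union> Inr ` diagram (conj_part lam))
        (flip_indet ` (Inl ` diagram (one_column m) \<union> Inr ` diagram (conj_part lam)))"
      by (intro bij_betw_imageI inj_on_subset[OF inj_flip_indet]) auto
  qed
  moreover have "flip_indet \<circ> (row_label J \<circ> prod.swap) = column_label J"
    by (rule ext) (auto simp: column_label_flip)
  moreover have "flip_indet ` (Inl ` diagram (one_column m) \<union> Inr ` diagram (conj_part lam)) =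
      Inl ` diagram lam \<union> Inr ` diagram (one_row m)"
    unfolding diagram_conj_part[OF lam] image_Un image_image
    by (auto simp: diagram_one_row diagram_one_column flip_indet_def image_iff)
  ultimately show ?thesis by simp
qed

section \<open>Entries of the indeterminates that are not symmetrised\<close>

text \<open>The gap \<open>x v - K v\<close> never shrinks, and it is frozen once \<open>x v\<close>
  has reached \<open>r\<close>, in particular once \<open>K v\<close> has. Boxes and letters counted
  from the end therefore arrive at the same moment; \<open>j + m = y + k\<close> expresses this
  position without subtraction.\<close>

lemma shifted_sequences_compare:
  fixes x K :: "nat \<Rightarrow> nat"
  assumes "x 0 = 0" "K 0 = 0" and K: "\<And>v. K v \<le> K (Suc v)"
    and x: "\<And>v. x v + (K (Suc v) - K v) \<le> x (Suc v)"
    and eq: "\<And>v. r \<le> x v \<Longrightarrow> x (Suc v) = x v + (K (Suc v) - K v)"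
    and lim: "\<And>v. n \<le> v \<Longrightarrow> K v = m \<and> x v = y"
    and k: "r \<le> k" "j + m = y + k"
  shows "j \<le> x v \<longleftrightarrow> k \<le> K v"
proof -
  have mono: "x v + K w \<le> x w + K v" if "v \<le> w" for v w
    using that
  proof (induction w rule: dec_induct)
    case (step w)
    then show ?case using x[of w] K[of w] by simp
  qed simp
  have le: "K v \<le> x v" for v using mono[of 0 v] assms(1,2) by simp
  have K_mono: "v \<le> w \<Longrightarrow> K v \<le> K w" for v w
    by (rule lift_Suc_mono_le[of K]) (use K in auto)
  have const: "x v + K w = x w + K v" if "v \<le> w" "r \<le> K v" for v w
    using that(1)
  proof (induction w rule: dec_induct)
    case (step w)
    then have "r \<le> x w" using K_mono[of v w] le[of w] that(2) by simp
    then show ?case using step eq[of w] K[of w] by simp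
  qed simp
  define w where "w = max v n"
  have w: "v \<le> w" "K w = m" "x w = y" using lim[of w] by (simp_all add: w_def)
  show ?thesis
  proof
    assume "j \<le> x v"
    then show "k \<le> K v" using mono[OF w(1)] w k by simp
  next
    assume "k \<le> K v"
    then show "j \<le> x v" using const[OF w(1)] w k by simp
  qed
qed

section \<open>Row insertion: end of the first row and tail of the first column\<close>

context
  fixes lam nu :: "nat \<Rightarrow> nat" and L N :: "nat \<Rightarrow> nat \<Rightarrow> nat" and K :: "nat \<Rightarrow> nat" and m :: nat
  assumes L: "strip_chain lam L" and N: "strip_chain nu N"
    and K: "row.count_seq m K" and G: "row.grows L K N"
begin

lemma row_grows_rule: "row_rule (L v) (L (Suc v)) (N v) (N (Suc v)) (K (Suc v) - K v)"
  using G by (simp add: row.grows_def)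

text \<open>The first row of \<open>L\<close> never exceeds \<open>lam 1\<close>, so the maximum in
  the rule is the row's own length once this is at least \<open>lam 1\<close>. This is why only the
  t_k with k < r have to be symmetrised.\<close>

lemma row_grows_first_row:
  assumes "lam 1 \<le> k" "j + m = nu 1 + k"
  shows "j \<le> N v 1 \<longleftrightarrow> k \<le> K v"
proof -
  obtain n1 n2 where n: "\<forall>v\<ge>n1. N v = nu" "\<forall>v\<ge>n2. K v = m"
    using N K by (auto simp: strip_chain_def row.count_seq_def)
  have r: "N (Suc v) 1 = max (L (Suc v) 1) (N v 1) + (K (Suc v) - K v)" for v
    using row_grows_rule[of v] by (simp add: row_rule_def)
  show ?thesis
  proof (rule shifted_sequences_compare[where r = "lam 1" and n = "max n1 n2" and m = m
        and x = "\<lambda>v. N v 1"])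
    show "N 0 1 = 0" using N by (simp add: strip_chain_def)
    show "K 0 = 0" "\<And>v. K v \<le> K (Suc v)" using K by (simp_all add: row.count_seq_def)
    show "N v 1 + (K (Suc v) - K v) \<le> N (Suc v) 1" for v using r[of v] by simp
    show "N (Suc v) 1 = N v 1 + (K (Suc v) - K v)" if "lam 1 \<le> N v 1" for v
      using r[of v] that strip_chain_le[OF L, of "Suc v" 1] by simp
  qed (use n assms in auto)
qed

text \<open>Call a row ahead when it is occupied in \<open>N\<close> and empty in \<open>L\<close>.
  The first letter of row \<open>i + 1\<close> has been displaced from row \<open>i\<close>: the
  rule bounds \<open>1 + L y i\<close> by \<open>L z i\<close> and by \<open>N y i\<close>. As row
  \<open>i\<close> of \<open>lam\<close> has at most one box, row \<open>i\<close> was ahead just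
  before, and its own letter arrives at \<open>z\<close>.\<close>

lemma row_grows_push_down:
  assumes i: "1 \<le> i" and "lam i \<le> 1" and v: "1 \<le> N v (i + 1)" "L v (i + 1) = 0"
  shows "\<exists>w. 1 \<le> N w i \<and> L w i = 0" "1 \<le> L w i \<Longrightarrow> 1 \<le> N w (i + 1)"
proof -
  define z where "z = (LEAST v. 1 \<le> N v (i + 1))"
  have z: "1 \<le> N z (i + 1)" "z \<le> v"
    unfolding z_def by (rule LeastI Least_le, rule v)+
  have "z \<noteq> 0"
  proof
    assume "z = 0"
    with z N show False by (simp add: strip_chain_def)
  qed
  then obtain y where y: "z = Suc y" by (cases z) auto
  then have "N y (i + 1) = 0"
    using not_less_Least[of y "\<lambda>v. 1 \<le> N v (i + 1)"] by (simp add: z_def not_le)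
  moreover have "L z (i + 1) = 0"
    using strip_chain_mono[OF L z(2), of "i + 1"] v by simp
  moreover have "N z (i + 1) + L y i = max (L z (i + 1)) (N y (i + 1)) + min (L z i) (N y i)"
    using row_grows_rule[of y] i by (simp add: row_rule_def y)
  ultimately have "N z (i + 1) + L y i = min (L z i) (N y i)" by simp
  with z have *: "1 + L y i \<le> min (L z i) (N y i)" by linarith
  then have "L y i = 0"
    using strip_chain_le[OF L, of z i] assms(2) by simp
  moreover from * have "1 \<le> N y i" by simp
  ultimately show "\<exists>w. 1 \<le> N w i \<and> L w i = 0" by blast
  assume "1 \<le> L w i"
  then have "\<not> w \<le> y"
    using strip_chain_mono[OF L, of w y i] \<open>L y i = 0\<close> by auto
  then show "1 \<le> N w (i + 1)"
    using strip_chain_mono[OF N, of z w "i + 1"] z y by simp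
qed

text \<open>When the old row \<open>i\<close> receives its first letter while the enlarged row
  \<open>i\<close> is already occupied, the rule sends a letter on to row \<open>i + 1\<close>,
  which at that time is still empty in the old shape.\<close>

lemma row_grows_push_up:
  assumes i: "1 \<le> i" and "1 \<le> lam i" and v: "1 \<le> N v i" "L v i = 0"
  shows "\<exists>w. 1 \<le> N w (i + 1) \<and> L w (i + 1) = 0"
proof -
  obtain n where "L n = lam" using L by (auto simp: strip_chain_def)
  then have n: "1 \<le> L n i" using assms(2) by simp
  define z where "z = (LEAST v. 1 \<le> L v i)"
  have z: "1 \<le> L z i" unfolding z_def by (rule LeastI, rule n)
  have "z \<noteq> 0"
  proof
    assume "z = 0"
    with z L show False by (simp add: strip_chain_def)
  qed
  then obtain y where y: "z = Suc y" by (cases z) auto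
  then have y0: "L y i = 0"
    using not_less_Least[of y "\<lambda>v. 1 \<le> L v i"] by (simp add: z_def not_le)
  have "v \<le> y"
    using strip_chain_mono[OF L, of z v i] z v y by (cases "v \<le> y") auto
  then have "1 \<le> N y i" using strip_chain_mono[OF N, of v y i] v by simp
  moreover have "L z (i + 1) = 0"
    using hstrip_Suc_le[OF strip_chain_hstrip[OF L] i, of y] y0 y by simp
  moreover have "N z (i + 1) + L y i = max (L z (i + 1)) (N y (i + 1)) + min (L z i) (N y i)"
    using row_grows_rule[of y] i by (simp add: row_rule_def y)
  ultimately show ?thesis using z y0 by (intro exI[of _ z]) simp
qed

text \<open>The row \<open>q + 1\<close> just below \<open>lam\<close> decides. If it is occupied in
  the end, it is ahead, this spreads up to row \<open>i + 1\<close>, and the tail is shifted by one.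
  Otherwise row \<open>i\<close> is never ahead, since that would spread down to row
  \<open>q + 1\<close>, which stays empty.\<close>

lemma row_grows_first_column:
  assumes i: "1 \<le> i" and one: "lam i = 1"
  shows "1 \<le> nu (conj_part lam 1 + 1) \<Longrightarrow> 1 \<le> N v (i + 1) \<longleftrightarrow> 1 \<le> L v i"
    and "nu (conj_part lam 1 + 1) = 0 \<Longrightarrow> 1 \<le> N v i \<longleftrightarrow> 1 \<le> L v i"
proof -
  note lam = strip_chain_limit[OF L]
  define q where "q = conj_part lam 1"
  have iq: "i \<le> q" using conj_part_iff[OF lam i, of 1] one by (simp add: q_def)
  have lam_q: "1 \<le> lam j \<longleftrightarrow> j \<le> q" if "1 \<le> j" for j
    using conj_part_iff[OF lam that, of 1] by (simp add: q_def)
  have strip: "hstrip (L v) (N v)" for v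
    using row_grows_rule by (simp add: row_rule_def)
  have top: "L v (q + 1) = 0" for v
    using lam_q[of "q + 1"] strip_chain_le[OF L, of v "q + 1"] by simp
  { assume "1 \<le> nu (conj_part lam 1 + 1)"
    moreover obtain n where "N n = nu" using N by (auto simp: strip_chain_def)
    ultimately have n: "1 \<le> N n (q + 1)" by (simp add: q_def)
    have *: "\<exists>w. 1 \<le> N w j \<and> L w j = 0" if "j \<le> q + 1" "i \<le> j" for j
      using that
    proof (induction rule: inc_induct)
      case base
      then show ?case using n top by blast
    next
      case (step j)
      then have "1 \<le> j" "lam j \<le> 1"
        using i one is_partition_antimono[OF lam i, of j] by simp_all
      moreover obtain w where "1 \<le> N w (j + 1)" "L w (j + 1) = 0"
        using step by auto
      ultimately show ?case by (rule row_grows_push_down(1))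
    qed
    have "i + 1 \<le> q + 1" "i \<le> i + 1" using iq by simp_all
    from *[OF this] obtain w where "1 \<le> N w (i + 1)" "L w (i + 1) = 0" by blast
    then show "1 \<le> N v (i + 1) \<longleftrightarrow> 1 \<le> L v i"
      using row_grows_push_down(2)[OF i, of w v] one hstrip_Suc_le[OF strip i, of v] by auto
  }
  { assume nu: "nu (conj_part lam 1 + 1) = 0"
    have *: "\<exists>w. 1 \<le> N w j \<and> L w j = 0" if "i \<le> j" "j \<le> q + 1" "1 \<le> N v i" "L v i = 0" for j v
      using that(1,2)
    proof (induction rule: dec_induct)
      case base
      then show ?case using that by blast
    next
      case (step j)
      then obtain w where "1 \<le> N w j" "L w j = 0" by auto
      moreover have "1 \<le> lam j" "1 \<le> j" using lam_q[of j] step i by auto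
      ultimately show ?case using row_grows_push_up[of j w] by simp
    qed
    have False if "1 \<le> N v i" "L v i = 0"
      using *[of "q + 1" v] that iq nu strip_chain_le[OF N, of _ "q + 1"]
      by (metis (no_types, lifting) Suc_eq_plus1 le_SucI le_refl le_zero_eq not_one_le_zero q_def)
    then show "1 \<le> N v i \<longleftrightarrow> 1 \<le> L v i"
      using hstrip_le[OF strip, of v i] by fastforce
  }
qed

end

section \<open>Column insertion: end of the first column and tail of the first row\<close>

text \<open>Below the first column of \<open>nu\<close> every row passes the carry on, so
  \<open>k\<close> reaches the row just below that column. This row takes the carry unless it is
  already occupied by \<open>lam\<close>; the latter is impossible when \<open>lam\<close> is not
  the longer one.\<close>

lemma column_rule_length:
  assumes R: "column_rule mu lam nu rho k"
  shows "conj_part nu 1 + k \<le> conj_part rho 1"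
    and "conj_part lam 1 \<le> conj_part nu 1 \<Longrightarrow> conj_part rho 1 = conj_part nu 1 + k"
proof -
  note h = column_rule_strips[OF R]
  obtain u q where C: "column_carry mu lam nu rho u" and u: "\<And>i. q < i \<Longrightarrow> u i = k"
    using column_ruleE[OF R] by blast
  have p: "is_partition lam" "is_partition nu" "is_partition rho"
    using h hstrip_partition by blast+
  have iff: "j \<le> conj_part f 1 \<longleftrightarrow> 1 \<le> f j" if "is_partition f" "1 \<le> j" for f j
    by (rule conj_part_iff) (use that in auto)
  define b where "b = conj_part nu 1"
  have b0: "nu i = 0" if "b + 1 \<le> i" for i
    using iff[OF p(2), of i] that by (simp add: b_def)
  have u_Suc: "u (i + 1) = u i" if "b + 1 \<le> i" for i
  proof -
    have "lam (i + 1) = 0"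
      using hstrip_Suc_le[OF h(1), of i] vstrip_le[OF h(3), of i] b0[OF that] that by simp
    then show ?thesis using column_carryD(2)[OF C, of i] b0[OF that] that by simp
  qed
  have "u i = u (b + 1)" if "b + 1 \<le> i" for i
    using that by (induction i rule: dec_induct) (use u_Suc in auto)
  from this[of "q + b + 1"] have ub: "u (b + 1) = k" using u[of "q + b + 1"] by simp
  have k: "k \<le> 1" using column_carryD(1)[OF C, of "b + 1"] ub by simp
  have "rho (b + 2) = 0"
    using hstrip_Suc_le[OF h(2), of "b + 1"] b0[of "b + 1"] by simp
  then have up: "conj_part rho 1 \<le> b + 1"
    using iff[OF p(3), of "b + 2"] by simp
  have lo: "b \<le> conj_part rho 1"
    using iff[OF p(3), of b] iff[OF p(2), of b] hstrip_le[OF h(2), of b]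
    by (cases "b = 0") (auto simp: b_def)
  have rho: "rho (b + 1) = lam (b + 1) + k \<or> rho (b + 1) = lam (b + 1) \<and> 1 \<le> lam (b + 1)"
  proof (cases "b = 0")
    case True
    then show ?thesis using C ub by (simp add: column_carry_def)
  next
    case False
    then have "1 \<le> nu b" using iff[OF p(2), of b] by (simp add: b_def)
    then show ?thesis
      using column_carryD(2,3)[OF C, of b] False ub by (cases "nu b = lam (b + 1)") auto
  qed
  show "conj_part nu 1 + k \<le> conj_part rho 1"
  proof (cases "k = 0")
    case True
    then show ?thesis using lo by (simp add: b_def)
  next
    case False
    then show ?thesis using rho k iff[OF p(3), of "b + 1"] by (auto simp: b_def)
  qed
  assume "conj_part lam 1 \<le> conj_part nu 1"
  then have "lam (b + 1) = 0" using iff[OF p(1), of "b + 1"] by (simp add: b_def)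
  then show "conj_part rho 1 = conj_part nu 1 + k"
    using rho k up lo iff[OF p(3), of "b + 1"] by (cases "k = 0") (auto simp: b_def)
qed

context
  fixes lam nu :: "nat \<Rightarrow> nat" and L N :: "nat \<Rightarrow> nat \<Rightarrow> nat" and K :: "nat \<Rightarrow> nat" and m :: nat
  assumes L: "strip_chain lam L" and N: "strip_chain nu N"
    and K: "column.count_seq m K" and G: "column.grows L K N"
begin

lemma column_grows_rule: "column_rule (L v) (L (Suc v)) (N v) (N (Suc v)) (K (Suc v) - K v)"
  using G by (simp add: column.grows_def)

text \<open>The number of rows plays the part of the first row length in row insertion: saturation
  sets in once it is at least the length of \<open>lam\<close>.\<close>

lemma column_grows_first_column:
  assumes "conj_part lam 1 \<le> k" "j + m = conj_part nu 1 + k" "1 \<le> j"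
  shows "1 \<le> N v j \<longleftrightarrow> k \<le> K v"
proof -
  obtain n1 n2 where n: "\<forall>v\<ge>n1. N v = nu" "\<forall>v\<ge>n2. K v = m"
    using N K unfolding strip_chain_def column.count_seq_def by blast
  note r = column_rule_length[OF column_grows_rule]
  have mono: "conj_part (L v) 1 \<le> conj_part lam 1" for v
  proof (rule nat_le_via_lower)
    fix i :: nat assume "1 \<le> i" "i \<le> conj_part (L v) 1"
    then show "i \<le> conj_part lam 1"
      using strip_chain_le[OF L, of v i] conj_part_iff[OF strip_chain_partition[OF L, of v], of i 1]
        conj_part_iff[OF strip_chain_limit[OF L], of i 1] by simp
  qed
  have "j \<le> conj_part (N v) 1 \<longleftrightarrow> k \<le> K v"
  proof (rule shifted_sequences_compare[where r = "conj_part lam 1" and n = "max n1 n2" and m = m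
        and x = "\<lambda>v. conj_part (N v) 1"])
    show "conj_part (N 0) 1 = 0"
      using N conj_part_iff[OF strip_chain_partition[OF N, of 0], of "conj_part (N 0) 1" 1]
      by (cases "conj_part (N 0) 1 = 0") (simp_all add: strip_chain_def)
    show "K 0 = 0" "\<And>v. K v \<le> K (Suc v)" using K unfolding column.count_seq_def by blast+
    show "conj_part (N v) 1 + (K (Suc v) - K v) \<le> conj_part (N (Suc v)) 1" for v by (rule r(1))
    show "conj_part (N (Suc v)) 1 = conj_part (N v) 1 + (K (Suc v) - K v)"
      if "conj_part lam 1 \<le> conj_part (N v) 1" for v
      using mono[of "Suc v"] that by (intro r(2)) simp
  qed (use n assms in auto)
  then show ?thesis
    using conj_part_iff[OF strip_chain_partition[OF N, of v] assms(3), of 1] by simp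
qed

text \<open>The excess \<open>N v 1 - L v 1\<close> is 0 or 1, and once it is 1 it stays 1. It
  cannot become 1 after \<open>L v 1\<close> has reached \<open>j > lam 2\<close>: row 1 is then
  longer than row 2 of the old shape can ever be, so its carry is 0. From then on the excess has its
  final value.\<close>

lemma column_grows_first_row:
  assumes j: "lam 2 < j"
  shows "nu 1 = lam 1 \<Longrightarrow> j \<le> N v 1 \<longleftrightarrow> j \<le> L v 1"
    and "nu 1 = lam 1 + 1 \<Longrightarrow> j + 1 \<le> N v 1 \<longleftrightarrow> j \<le> L v 1"
proof -
  obtain n1 n2 where n: "\<forall>v\<ge>n1. N v = nu" "\<forall>v\<ge>n2. L v = lam"
    using N L by (auto simp: strip_chain_def)
  define n where "n = max n1 n2"
  have lim: "N v = nu" "L v = lam" if "n \<le> v" for v using n that by (simp_all add: n_def)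
  have strip: "vstrip (L v) (N v)" for v
    by (rule column_rule_strips[OF column_grows_rule])
  have two: "N v 1 = L v 1 \<or> N v 1 = L v 1 + 1" for v
    using vstrip_le[OF strip, of v 1] vstrip_le_Suc[OF strip, of v 1] by auto
  have persist: "N w 1 = L w 1 + 1" if "v \<le> w" "N v 1 = L v 1 + 1" for v w
    using that(1)
  proof (induction w rule: dec_induct)
    case (step w)
    obtain u where C: "column_carry (L w) (L (Suc w)) (N w) (N (Suc w)) u"
      using column_ruleE[OF column_grows_rule] by blast
    \<comment> \<open>The branch in which the carry skips row 2 would force
      \<open>N w 1 = L w 1\<close>, against the excess of 1.\<close>
    have "u 1 = 1"
      using column_carryD[OF C, of 1] step by (cases "N w 1 = L (Suc w) (1 + 1)") auto
    then show ?case using C by (simp add: column_carry_def)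
  qed (fact that)
  have persist': "N w 1 = L w 1" if "v \<le> w" "j \<le> L v 1" "N v 1 = L v 1" for v w
    using that(1)
  proof (induction w rule: dec_induct)
    case (step w)
    obtain u where C: "column_carry (L w) (L (Suc w)) (N w) (N (Suc w)) u"
      using column_ruleE[OF column_grows_rule] by blast
    have "N w 1 \<noteq> L (Suc w) (1 + 1)"
      using strip_chain_mono[OF L step(1), of 1] that step strip_chain_le[OF L, of "Suc w" 2] j
      by (simp add: numeral_2_eq_2)
    then have "u 1 = 0" using column_carryD(3)[OF C, of 1] step by simp
    then show ?case using C by (simp add: column_carry_def)
  qed (fact that)
  { assume "nu 1 = lam 1"
    then have "N v 1 = L v 1"
      using persist[of v "max v n"] two[of v] lim[of "max v n"] by auto
    then show "j \<le> N v 1 \<longleftrightarrow> j \<le> L v 1" by simp }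
  { assume "nu 1 = lam 1 + 1"
    then show "j + 1 \<le> N v 1 \<longleftrightarrow> j \<le> L v 1"
      using persist'[of v "max v n"] two[of v] lim[of "max v n"] by auto }
qed

end

section \<open>Convergence and symmetrisation\<close>

text \<open>Boxes are replaced by an arbitrary index type so that the terms of both sides can be
  indexed by the same indeterminates.\<close>

definition zeta_term :: "'a set \<Rightarrow> ('a \<Rightarrow> complex) \<Rightarrow> ('a \<Rightarrow> nat) \<Rightarrow> complex" where
  "zeta_term D s g = 1 / (\<Prod>x\<in>D. of_nat (g x) powr s x)"

lemma schur_zeta_zeta_term: "schur_zeta lam s = infsum (zeta_term (diagram lam) s) (SSYT lam)"
  by (simp add: schur_zeta_def zeta_term_def[abs_def])

lemma zeta_term_cong:
  "(\<And>x. x \<in> D \<Longrightarrow> s x = s' x) \<Longrightarrow> (\<And>x. x \<in> D \<Longrightarrow> g x = g' x) \<Longrightarrow> zeta_term D s g = zeta_term D s' g'"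
  by (simp add: zeta_term_def cong: prod.cong)

lemma zeta_term_reindex:
  assumes "bij_betw p E D"
  shows "zeta_term E (\<lambda>x. s (p x)) (\<lambda>x. g (p x)) = zeta_term D s g"
  unfolding zeta_term_def
  using prod.reindex_bij_betw[OF assms, of "\<lambda>x. of_nat (g x) powr s x"] by simp

section \<open>Absolute convergence\<close>

lemma summable_on_prod_powr_PiE:
  fixes a :: real
  assumes "finite D" "1 < a"
  shows "(\<lambda>g. \<Prod>b\<in>D. real (g b) powr - a) summable_on (D \<rightarrow>\<^sub>E {1..})"
proof -
  have "summable (\<lambda>n. real n powr - a)"
    using assms(2) by (simp add: summable_real_powr_iff)
  then have "Infinite_Set_Sum.abs_summable_on (\<lambda>n. real n powr - a) UNIV"
    by (simp add: abs_summable_on_nat_iff')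
  then have "Infinite_Set_Sum.abs_summable_on (\<lambda>n. real n powr - a) {1..}"
    by (rule abs_summable_on_subset) simp
  then have "Infinite_Set_Sum.abs_summable_on (\<lambda>g. \<Prod>b\<in>D. real (g b) powr - a) (D \<rightarrow>\<^sub>E {1..})"
    using assms(1) by (intro abs_summable_on_prod_PiE) auto
  then show ?thesis
    by (rule iffD2[OF summable_on_iff_abs_summable_on_real, OF iffD2[OF abs_summable_equivalent]])
qed

text \<open>
  The excess exponent at the box holding the largest entry is distributed over all boxes, which
  reduces the claim to a product of convergent series.
\<close>

lemma summable_on_norm_zeta_term:
  assumes D: "finite D" and S: "S \<subseteq> D \<rightarrow>\<^sub>E {1..}"
    and ge: "\<And>b. b \<in> D \<Longrightarrow> 1 \<le> Re (s b)"
    and dom: "\<And>b. b \<in> D \<Longrightarrow> \<exists>c\<in>D. 1 < Re (s c) \<and> (\<forall>g\<in>S. g b \<le> g c)"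
  shows "(\<lambda>g. norm (zeta_term D s g)) summable_on S"
proof (cases "D = {}")
  case True
  then have "finite S" using S by (auto intro: finite_subset)
  then show ?thesis by simp
next
  case False
  \<comment> \<open>The dominating box \<open>c\<close> depends on \<open>g\<close>; the minimum
    over the finitely many admissible boxes gives an excess that works uniformly.\<close>
  define e where "e = Min ((\<lambda>c. Re (s c) - 1) ` {c \<in> D. 1 < Re (s c)})"
  have ne: "{c \<in> D. 1 < Re (s c)} \<noteq> {}" using dom False by blast
  have e: "0 < e" "\<And>c. c \<in> D \<Longrightarrow> 1 < Re (s c) \<Longrightarrow> e \<le> Re (s c) - 1"
    using D ne by (auto simp: e_def)
  \<comment> \<open>With this choice \<open>g c powr e\<close> splits evenly into one factor
    \<open>g c powr d\<close> per box.\<close>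
  define d where "d = e / card D"
  have cd: "0 < card D" using D False by (simp add: card_gt_0_iff)
  have d: "0 < d" "d * card D = e" using e cd by (simp_all add: d_def)
  have le: "norm (zeta_term D s g) \<le> (\<Prod>b\<in>D. real (g b) powr - (1 + d))" if g: "g \<in> S" for g
  proof -
    have g1: "1 \<le> real (g b)" if "b \<in> D" for b
      using S g that by (auto simp: PiE_iff subset_iff)
    have "Max (g ` D) \<in> g ` D" using D False by simp
    then obtain b0 where "b0 \<in> D" "g b0 = Max (g ` D)" by auto
    then have b0: "b0 \<in> D" "\<And>b. b \<in> D \<Longrightarrow> g b \<le> g b0" using D by simp_all
    obtain c where c: "c \<in> D" "1 < Re (s c)" "g b0 \<le> g c" using dom[OF b0(1)] g by blast
    have gc: "g b \<le> g c" if "b \<in> D" for b using b0(2)[OF that] c(3) by simp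
    have "(\<Prod>b\<in>D. real (g b) powr (1 + d)) = (\<Prod>b\<in>D. real (g b)) * (\<Prod>b\<in>D. real (g b) powr d)"
      unfolding prod.distrib[symmetric]
    proof (intro prod.cong refl)
      fix b assume "b \<in> D"
      then show "real (g b) powr (1 + d) = real (g b) * real (g b) powr d"
        using g1[of b] by (simp add: powr_add)
    qed
    also have "\<dots> \<le> (\<Prod>b\<in>D. real (g b)) * (\<Prod>b\<in>D. real (g c) powr d)"
      using gc d by (intro mult_left_mono prod_mono conjI powr_mono2 prod_nonneg) auto
    also have "(\<Prod>b\<in>D. real (g c) powr d) = real (g c) powr e"
      using g1[OF c(1)] d by (simp add: powr_powr flip: powr_realpow)
    also have "(\<Prod>b\<in>D. real (g b)) * real (g c) powr e
        = real (g c) powr (1 + e) * (\<Prod>b\<in>D - {c}. real (g b))"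
      using D c g1[OF c(1)] by (simp add: prod.remove[of D c] powr_add)
    also have "\<dots> \<le> real (g c) powr Re (s c) * (\<Prod>b\<in>D - {c}. real (g b) powr Re (s b))"
    proof (intro mult_mono powr_mono prod_mono prod_nonneg conjI)
      show "1 + e \<le> Re (s c)" using e(2)[OF c(1,2)] by simp
      show "real (g b) \<le> real (g b) powr Re (s b)" if "b \<in> D - {c}" for b
        using powr_mono[of 1 "Re (s b)" "real (g b)"] ge[of b] g1[of b] that by auto
    qed (use g1 c in auto)
    also have "\<dots> = (\<Prod>b\<in>D. real (g b) powr Re (s b))"
      using D c by (simp add: prod.remove[of D c])
    finally have "(\<Prod>b\<in>D. real (g b) powr (1 + d)) \<le> (\<Prod>b\<in>D. real (g b) powr Re (s b))" .
    moreover have "0 < (\<Prod>b\<in>D. real (g b) powr (1 + d))"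
      using g1 by (intro prod_pos) force
    ultimately have "inverse (\<Prod>b\<in>D. real (g b) powr Re (s b))
        \<le> inverse (\<Prod>b\<in>D. real (g b) powr (1 + d))"
      by (intro le_imp_inverse_le)
    moreover have "norm (zeta_term D s g) = inverse (\<Prod>b\<in>D. real (g b) powr Re (s b))"
      by (simp add: zeta_term_def norm_divide prod_norm[symmetric] norm_powr_real_powr inverse_eq_divide)
    moreover have "(\<Prod>b\<in>D. real (g b) powr - (1 + d)) = inverse (\<Prod>b\<in>D. real (g b) powr (1 + d))"
      by (simp add: powr_minus prod_inversef[symmetric] del: minus_add_distrib)
    ultimately show ?thesis by simp
  qed
  have "(\<lambda>g. \<Prod>b\<in>D. real (g b) powr - (1 + d)) summable_on S"
    using summable_on_prod_powr_PiE[OF D, of "1 + d"] d S by (auto intro: summable_on_subset_banach)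
  then show ?thesis
    by (rule Infinite_Sum.abs_summable_on_comparison_test') (rule le)
qed

lemma summable_on_norm_product:
  fixes f :: "'a \<Rightarrow> complex" and g :: "'b \<Rightarrow> complex"
  assumes f: "(\<lambda>x. norm (f x)) summable_on A" and g: "(\<lambda>x. norm (g x)) summable_on B"
  shows "(\<lambda>p. norm (f (fst p) * g (snd p))) summable_on A \<times> B"
    and "infsum f A * infsum g B = infsum (\<lambda>p. f (fst p) * g (snd p)) (A \<times> B)"
proof -
  show n: "(\<lambda>p. norm (f (fst p) * g (snd p))) summable_on A \<times> B"
    unfolding Infinite_Sum.abs_summable_on_Sigma_iff
    using f g by (auto simp: norm_mult infsum_cmult_right' infsum_nonneg
        intro!: summable_on_cmult_right summable_on_cmult_left)
  have "infsum (\<lambda>p. f (fst p) * g (snd p)) (A \<times> B)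
      = infsum (\<lambda>x. infsum (\<lambda>y. f x * g y) B) A"
    using infsum_Sigma_banach[OF abs_summable_summable[OF n]] by simp
  also have "\<dots> = infsum f A * infsum g B"
    by (simp add: infsum_cmult_right' infsum_cmult_left')
  finally show "infsum f A * infsum g B = infsum (\<lambda>p. f (fst p) * g (snd p)) (A \<times> B)" by simp
qed

section \<open>Exchanging symmetrisation and summation\<close>

lemma sum_infsum_swap:
  fixes f :: "'i \<Rightarrow> 'a \<Rightarrow> complex"
  assumes "finite I" "\<And>i. i \<in> I \<Longrightarrow> f i summable_on A"
  shows "(\<Sum>i\<in>I. infsum (f i) A) = infsum (\<lambda>a. \<Sum>i\<in>I. f i a) A"
    and "(\<lambda>a. \<Sum>i\<in>I. f i a) summable_on A"
proof -
  have "(\<Sum>i\<in>I. infsum (f i) A) = infsum (\<lambda>a. \<Sum>i\<in>I. f i a) A \<and> (\<lambda>a. \<Sum>i\<in>I. f i a) summable_on A"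
    using assms
    by (induction I rule: finite_induct) (simp_all add: infsum_add summable_on_add)
  then show "(\<Sum>i\<in>I. infsum (f i) A) = infsum (\<lambda>a. \<Sum>i\<in>I. f i a) A"
    "(\<lambda>a. \<Sum>i\<in>I. f i a) summable_on A" by simp_all
qed

text \<open>
  Only the left-hand family is assumed summable: as the symmetrised sums of norms agree, each term
  on the right is dominated by a finite sum of summable families.
\<close>

lemma symmetrized_infsum_bij:
  assumes D: "finite D" "V \<subseteq> D" and bij: "bij_betw \<Phi> A B"
    and perm: "\<And>a. a \<in> A \<Longrightarrow> \<exists>\<tau>. \<tau> permutes V \<and> (\<forall>x\<in>D. gB (\<Phi> a) x = gA a (\<tau> x))"
    and summ: "\<And>\<sigma>. \<sigma> permutes V \<Longrightarrow> (\<lambda>a. norm (zeta_term D (v \<circ> \<sigma>) (gA a))) summable_on A"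
  shows "(\<Sum>\<sigma> | \<sigma> permutes V. infsum (\<lambda>a. zeta_term D (v \<circ> \<sigma>) (gA a)) A) =
      (\<Sum>\<sigma> | \<sigma> permutes V. infsum (\<lambda>b. zeta_term D (v \<circ> \<sigma>) (gB b)) B)"
    and "\<And>\<sigma>. \<sigma> permutes V \<Longrightarrow> (\<lambda>b. zeta_term D (v \<circ> \<sigma>) (gB b)) summable_on B"
proof -
  have fin: "finite {\<sigma>. \<sigma> permutes V}"
    using D finite_subset by (intro finite_permutations) blast
  \<comment> \<open>The map \<open>F\<close> stays general because two cases are needed: the norm
    gives the domination of the right-hand terms, the identity the equality of the sums.\<close>
  have sym: "(\<Sum>\<sigma> | \<sigma> permutes V. F (zeta_term D (v \<circ> \<sigma>) (gB (\<Phi> a)))) =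
      (\<Sum>\<sigma> | \<sigma> permutes V. F (zeta_term D (v \<circ> \<sigma>) (gA a)))" if a: "a \<in> A"
    for a and F :: "complex \<Rightarrow> 'z :: comm_monoid_add"
  proof -
    obtain \<tau> where \<tau>: "\<tau> permutes V" "\<And>x. x \<in> D \<Longrightarrow> gB (\<Phi> a) x = gA a (\<tau> x)"
      using perm[OF a] by blast
    have bij: "bij_betw \<tau> D D"
      using permutes_imp_bij[OF permutes_subset[OF \<tau>(1) D(2)]] .
    \<comment> \<open>Composition with \<open>\<tau>\<close> permutes the range of summation;
      afterwards the product over \<open>D\<close> is reindexed by \<open>\<tau>\<close>.\<close>
    have "(\<Sum>\<sigma> | \<sigma> permutes V. F (zeta_term D (v \<circ> \<sigma>) (gB (\<Phi> a)))) =
        (\<Sum>\<sigma> | \<sigma> permutes V. F (zeta_term D (v \<circ> (\<sigma> \<circ> \<tau>)) (gB (\<Phi> a))))"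
      by (rule sum_permutations_compose_right[OF \<tau>(1)])
    also have "\<dots> = (\<Sum>\<sigma> | \<sigma> permutes V. F (zeta_term D (v \<circ> \<sigma>) (gA a)))"
    proof (intro sum.cong refl arg_cong[where f = F])
      fix \<sigma>
      have "zeta_term D (v \<circ> (\<sigma> \<circ> \<tau>)) (gB (\<Phi> a)) =
          zeta_term D (\<lambda>x. (v \<circ> \<sigma>) (\<tau> x)) (\<lambda>x. gA a (\<tau> x))"
        by (rule zeta_term_cong) (simp_all add: \<tau>(2))
      also have "\<dots> = zeta_term D (v \<circ> \<sigma>) (gA a)" by (rule zeta_term_reindex[OF bij])
      finally show "zeta_term D (v \<circ> (\<sigma> \<circ> \<tau>)) (gB (\<Phi> a)) = zeta_term D (v \<circ> \<sigma>) (gA a)" .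
    qed
    finally show ?thesis .
  qed
  have summB: "(\<lambda>a. norm (zeta_term D (v \<circ> \<sigma>) (gB (\<Phi> a)))) summable_on A" if \<sigma>: "\<sigma> permutes V" for \<sigma>
  proof (rule Infinite_Sum.abs_summable_on_comparison_test')
    show "(\<lambda>a. \<Sum>\<sigma> | \<sigma> permutes V. norm (zeta_term D (v \<circ> \<sigma>) (gA a))) summable_on A"
      using fin summ by (induction rule: finite_subset_induct'[OF fin subset_refl])
        (auto intro: summable_on_add)
    show "norm (zeta_term D (v \<circ> \<sigma>) (gB (\<Phi> a))) \<le>
        (\<Sum>\<sigma> | \<sigma> permutes V. norm (zeta_term D (v \<circ> \<sigma>) (gA a)))" if "a \<in> A" for a
      unfolding sym[OF that, of norm, symmetric]
      by (rule member_le_sum) (use fin \<sigma> in auto)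
  qed
  show "(\<lambda>b. zeta_term D (v \<circ> \<sigma>) (gB b)) summable_on B" if "\<sigma> permutes V" for \<sigma>
    using summable_on_reindex_bij_betw[OF bij, of "\<lambda>b. zeta_term D (v \<circ> \<sigma>) (gB b)"]
      abs_summable_summable[OF summB[OF that]] by blast
  have "(\<Sum>\<sigma> | \<sigma> permutes V. infsum (\<lambda>b. zeta_term D (v \<circ> \<sigma>) (gB b)) B) =
      (\<Sum>\<sigma> | \<sigma> permutes V. infsum (\<lambda>a. zeta_term D (v \<circ> \<sigma>) (gB (\<Phi> a))) A)"
    by (intro sum.cong refl infsum_reindex_bij_betw[OF bij, symmetric])
  also have "\<dots> = infsum (\<lambda>a. \<Sum>\<sigma> | \<sigma> permutes V. zeta_term D (v \<circ> \<sigma>) (gB (\<Phi> a))) A"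
    using fin abs_summable_summable[OF summB] by (intro sum_infsum_swap) auto
  also have "\<dots> = infsum (\<lambda>a. \<Sum>\<sigma> | \<sigma> permutes V. zeta_term D (v \<circ> \<sigma>) (gA a)) A"
    by (intro infsum_cong sym[of _ "\<lambda>x. x"])
  also have "\<dots> = (\<Sum>\<sigma> | \<sigma> permutes V. infsum (\<lambda>a. zeta_term D (v \<circ> \<sigma>) (gA a)) A)"
    using fin abs_summable_summable[OF summ] by (intro sum_infsum_swap(1)[symmetric]) auto
  finally show "(\<Sum>\<sigma> | \<sigma> permutes V. infsum (\<lambda>a. zeta_term D (v \<circ> \<sigma>) (gA a)) A) =
      (\<Sum>\<sigma> | \<sigma> permutes V. infsum (\<lambda>b. zeta_term D (v \<circ> \<sigma>) (gB b)) B)" by simp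
qed

text \<open>The counts below all thresholds determine the multiset of values on \<open>D\<close>.
  Cancelling the values off \<open>V\<close>, where the functions agree, leaves equal multisets on
  \<open>V\<close>, and functions on a finite set with the same multiset of values differ by a
  permutation.\<close>

lemma permutation_of_equal_counts:
  fixes g h :: "'a \<Rightarrow> nat"
  assumes D: "finite D" "V \<subseteq> D"
    and card: "\<And>n. card {x \<in> D. g x \<le> n} = card {x \<in> D. h x \<le> n}"
    and off: "\<And>x. x \<in> D - V \<Longrightarrow> g x = h x"
  shows "\<exists>\<tau>. \<tau> permutes V \<and> (\<forall>x\<in>D. h x = g (\<tau> x))"
proof -
  have V: "finite V" using D finite_subset by blast
  have le: "card {x \<in> V. g x \<le> n} = card {x \<in> V. h x \<le> n}" for n
  proof -
    have split: "card {x \<in> D. f x \<le> n} = card {x \<in> V. f x \<le> n} + card {x \<in> D - V. f x \<le> n}"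
      for f :: "'a \<Rightarrow> nat"
      using D V by (subst card_Un_disjoint[symmetric]) (auto intro: arg_cong[where f = card])
    have "{x \<in> D - V. g x \<le> n} = {x \<in> D - V. h x \<le> n}" using off by auto
    then show ?thesis using split[of g] split[of h] card[of n] by simp
  qed
  have eq: "card {x \<in> V. g x = n} = card {x \<in> V. h x = n}" for n
  proof (cases n)
    case 0
    then show ?thesis using le[of 0] by simp
  next
    case (Suc k)
    have split: "card {x \<in> V. f x \<le> n} = card {x \<in> V. f x \<le> k} + card {x \<in> V. f x = n}"
      for f :: "'a \<Rightarrow> nat"
      using V Suc by (subst card_Un_disjoint[symmetric]) (auto intro: arg_cong[where f = card])
    show ?thesis using split[of g] split[of h] le[of n] le[of k] by simp
  qed
  have "image_mset h (mset_set V) = image_mset g (mset_set V)"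
    by (rule multiset_eqI) (simp add: count_image_mset_eq_card_vimage V eq)
  from image_mset_eq_implies_permutes[OF V this] obtain \<tau>
    where \<tau>: "\<tau> permutes V" "\<forall>x\<in>V. h x = g (\<tau> x)" by blast
  have "h x = g (\<tau> x)" if "x \<in> D" for x
    using \<tau> off[of x] that permutes_not_in[OF \<tau>(1), of x] by (cases "x \<in> V") auto
  with \<tau>(1) show ?thesis by blast
qed

section \<open>One-row and one-column tableaux\<close>

definition entry_count :: "(nat \<Rightarrow> nat) \<Rightarrow> (nat \<times> nat \<Rightarrow> nat) \<Rightarrow> nat \<Rightarrow> nat" where
  "entry_count lam M v = card {b \<in> diagram lam. M b \<le> v}"

lemma entry_count_tab_chain:
  "is_partition lam \<Longrightarrow> M \<in> SSYT lam \<Longrightarrow> entry_count lam M v = card (diagram (tab_chain lam M v))"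
  by (simp add: entry_count_def SSYT_entries_le)

lemma card_diagram_one_row [simp]: "card (diagram (one_row m)) = m"
  by (simp add: diagram_one_row)

lemma card_diagram_one_column [simp]: "card (diagram (one_column n)) = n"
  by (simp add: diagram_one_column)

lemma tab_chain_one_row:
  assumes "M \<in> SSYT (one_row m)"
  shows "tab_chain (one_row m) M v = one_row (entry_count (one_row m) M v)"
proof -
  let ?C = "tab_chain (one_row m) M v"
  have "?C = one_row (?C 1)"
  proof
    fix i show "?C i = one_row (?C 1) i"
      using tab_chain_le[OF is_partition_one_row, of m M v i] by (auto simp: one_row_def)
  qed
  then have "?C = one_row (card (diagram ?C))" by (metis card_diagram_one_row)
  then show ?thesis
    using entry_count_tab_chain[OF is_partition_one_row assms] by simp
qed

lemma tab_chain_one_column: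
  assumes "M \<in> SSYT (one_column n)"
  shows "tab_chain (one_column n) M v = one_column (entry_count (one_column n) M v)"
proof -
  let ?C = "tab_chain (one_column n) M v"
  have p: "is_partition ?C"
    by (rule strip_chain_partition[OF strip_chain_tab_chain[OF is_partition_one_column assms]])
  have "?C = one_column (part_length ?C)"
  proof
    fix i show "?C i = one_column (part_length ?C) i"
      using tab_chain_le[OF is_partition_one_column, of n M v i] part_length_iff[OF p, of i]
        is_partition_zero[OF p]
      by (cases "i = 0") (auto simp: one_column_def split: if_splits)
  qed
  then have "?C = one_column (card (diagram ?C))" by (metis card_diagram_one_column)
  then show ?thesis
    using entry_count_tab_chain[OF is_partition_one_column assms] by simp
qed

lemma hstrip_one_row: "hstrip (one_row a) (one_row b) \<longleftrightarrow> a \<le> b"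
  using is_partition_one_row by (auto simp: hstrip_def one_row_def)

text \<open>A horizontal strip meets a single column at most once; this is the source of the bound
  \<open>k \<le> 1\<close> on the steps of column insertion.\<close>

lemma hstrip_one_column: "hstrip (one_column a) (one_column b) \<longleftrightarrow> a \<le> b \<and> b \<le> a + 1"
proof
  assume h: "hstrip (one_column a) (one_column b)"
  have "a \<le> b" using hstrip_le[OF h, of a] by (cases "a = 0") (auto simp: one_column_def split: if_splits)
  moreover have "b \<le> a + 1"
    using hstrip_Suc_le[OF h, of "a + 1"] by (auto simp: one_column_def split: if_splits)
  ultimately show "a \<le> b \<and> b \<le> a + 1" by simp
next
  assume "a \<le> b \<and> b \<le> a + 1"
  then show "hstrip (one_column a) (one_column b)"
    using is_partition_one_column by (auto simp: hstrip_def one_column_def)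
qed

lemma entry_count_limit:
  assumes "is_partition lam" "M \<in> SSYT lam"
  shows "\<exists>n. \<forall>v\<ge>n. entry_count lam M v = card (diagram lam)"
  using strip_chain_tab_chain[OF assms] unfolding strip_chain_def entry_count_tab_chain[OF assms]
  by metis

lemma entry_count_0: "M \<in> SSYT lam \<Longrightarrow> entry_count lam M 0 = 0"
  using SSYT_pos[of M lam] by (force simp: entry_count_def card_eq_0_iff)

lemma count_seq_one_row:
  assumes N: "N \<in> SSYT (one_row m)"
  shows "row.count_seq m (entry_count (one_row m) N)"
  using strip_chain_hstrip[OF strip_chain_tab_chain[OF is_partition_one_row N]]
    entry_count_limit[OF is_partition_one_row N] entry_count_0[OF N]
  unfolding row.count_seq_def tab_chain_one_row[OF N] hstrip_one_row by simp

lemma count_seq_one_column: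
  assumes N: "N \<in> SSYT (one_column n)"
  shows "column.count_seq n (entry_count (one_column n) N)"
  using strip_chain_hstrip[OF strip_chain_tab_chain[OF is_partition_one_column N]]
    entry_count_limit[OF is_partition_one_column N] entry_count_0[OF N]
  unfolding column.count_seq_def tab_chain_one_column[OF N] hstrip_one_column
  by (simp add: le_diff_conv add.commute)

lemma entry_count_one_row_iff:
  assumes N: "N \<in> SSYT (one_row m)" and "1 \<le> k" "k \<le> m"
  shows "k \<le> entry_count (one_row m) N v \<longleftrightarrow> N (1, k) \<le> v"
proof -
  have "(1, k) \<in> diagram (one_row m)" using assms(2,3) by (simp add: diagram_one_row)
  from tab_chain_iff[OF is_partition_one_row N this, of v] show ?thesis
    by (simp add: tab_chain_one_row[OF N] one_row_def[of "entry_count _ _ _"])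
qed

lemma entry_count_one_column_iff:
  assumes N: "N \<in> SSYT (one_column n)" and "1 \<le> k" "k \<le> n"
  shows "k \<le> entry_count (one_column n) N v \<longleftrightarrow> N (k, 1) \<le> v"
proof -
  have "(k, 1) \<in> diagram (one_column n)" using assms(2,3) by (simp add: diagram_one_column)
  from tab_chain_iff[OF is_partition_one_column N this, of v] show ?thesis
    using assms(2)
    by (auto simp: tab_chain_one_column[OF N] one_column_def[of "entry_count _ _ _"] split: if_splits)
qed

lemma count_seq_one_row_tableau:
  assumes K: "row.count_seq m K"
  obtains N where "N \<in> SSYT (one_row m)" "entry_count (one_row m) N = K"
proof -
  have "strip_chain (one_row m) (\<lambda>v. one_row (K v))"
    using K unfolding strip_chain_def row.count_seq_def hstrip_one_row
    by (auto simp: one_row_def)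
  then obtain N where N: "N \<in> SSYT (one_row m)" "tab_chain (one_row m) N = (\<lambda>v. one_row (K v))"
    by (rule strip_chain_tableau)
  then have "entry_count (one_row m) N = K"
    by (simp add: fun_eq_iff[of "entry_count _ _"] entry_count_tab_chain[OF is_partition_one_row])
  with N(1) show thesis by (rule that)
qed

lemma count_seq_one_column_tableau:
  assumes K: "column.count_seq n K"
  obtains N where "N \<in> SSYT (one_column n)" "entry_count (one_column n) N = K"
proof -
  have "K v \<le> K (Suc v)" "K (Suc v) \<le> K v + 1" for v
    using K unfolding column.count_seq_def by (metis, metis add.commute le_diff_conv)
  then have "strip_chain (one_column n) (\<lambda>v. one_column (K v))"
    using K unfolding strip_chain_def column.count_seq_def hstrip_one_column
    by (auto simp: one_column_def)
  then obtain N where N: "N \<in> SSYT (one_column n)" "tab_chain (one_column n) N = (\<lambda>v. one_column (K v))"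
    by (rule strip_chain_tableau)
  then have "entry_count (one_column n) N = K"
    by (simp add: fun_eq_iff[of "entry_count _ _"] entry_count_tab_chain[OF is_partition_one_column])
  with N(1) show thesis by (rule that)
qed

lemma entry_count_one_row_inj:
  assumes "N \<in> SSYT (one_row m)" "N' \<in> SSYT (one_row m)"
    "entry_count (one_row m) N = entry_count (one_row m) N'"
  shows "N = N'"
  using assms by (intro tab_chain_inj[OF is_partition_one_row]) (auto simp: tab_chain_one_row)

lemma entry_count_one_column_inj:
  assumes "N \<in> SSYT (one_column n)" "N' \<in> SSYT (one_column n)"
    "entry_count (one_column n) N = entry_count (one_column n) N'"
  shows "N = N'"
  using assms by (intro tab_chain_inj[OF is_partition_one_column]) (auto simp: tab_chain_one_column)

section \<open>The symmetrised Pieri formulas\<close>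

text \<open>Growth diagrams supply existence and uniqueness in both directions, but no map; the
  bijection is extracted by choice.\<close>

lemma bij_betw_of_relation:
  assumes "\<And>a. a \<in> A \<Longrightarrow> \<exists>b\<in>B. R a b" "\<And>b. b \<in> B \<Longrightarrow> \<exists>a\<in>A. R a b"
    and "\<And>a b b'. a \<in> A \<Longrightarrow> b \<in> B \<Longrightarrow> b' \<in> B \<Longrightarrow> R a b \<Longrightarrow> R a b' \<Longrightarrow> b = b'"
    and "\<And>a a' b. a \<in> A \<Longrightarrow> a' \<in> A \<Longrightarrow> b \<in> B \<Longrightarrow> R a b \<Longrightarrow> R a' b \<Longrightarrow> a = a'"
  obtains f where "bij_betw f A B" "\<And>a. a \<in> A \<Longrightarrow> R a (f a)"
proof -
  obtain f where f: "\<And>a. a \<in> A \<Longrightarrow> f a \<in> B \<and> R a (f a)" using assms(1) by metis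
  have "inj_on f A" by (rule inj_onI) (metis assms(4) f)
  moreover have "f ` A = B"
  proof (intro subset_antisym subsetI)
    fix b assume b: "b \<in> B"
    then obtain a where "a \<in> A" "R a b" using assms(2) by blast
    then show "b \<in> f ` A" using assms(3) b f by blast
  qed (use f in auto)
  ultimately have "bij_betw f A B" by (rule bij_betw_imageI)
  then show thesis using f that by blast
qed

text \<open>The part common to both identities is separated from the insertion: a labelling of boxes
  by indeterminates, a correspondence \<open>rel\<close> that preserves the numbers of entries below
  each threshold, and its compatibility with the labels off \<open>V\<close>.\<close>

lemma symmetrized_schur_product:
  fixes lam kap :: "nat \<Rightarrow> nat" and shape :: "'j \<Rightarrow> nat \<Rightarrow> nat" and v :: "indet \<Rightarrow> complex"
  defines "D \<equiv> Inl ` diagram lam \<union> Inr ` diagram kap"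
  assumes V: "V \<subseteq> D" and H: "finite H"
    and label: "\<And>J. J \<in> H \<Longrightarrow> bij_betw (label J) (diagram (shape J)) D"
    and push: "\<And>J w b. J \<in> H \<Longrightarrow> b \<in> diagram (shape J) \<Longrightarrow> push J (w \<circ> Inl) (w \<circ> Inr) b = w (label J b)"
    and total: "\<And>M N. M \<in> SSYT lam \<Longrightarrow> N \<in> SSYT kap \<Longrightarrow> \<exists>J\<in>H. \<exists>P\<in>SSYT (shape J). rel M N J P"
    and onto: "\<And>J P. J \<in> H \<Longrightarrow> P \<in> SSYT (shape J) \<Longrightarrow> \<exists>M\<in>SSYT lam. \<exists>N\<in>SSYT kap. rel M N J P"
    and unique: "\<And>M N J P J' P'. M \<in> SSYT lam \<Longrightarrow> N \<in> SSYT kap \<Longrightarrow> J \<in> H \<Longrightarrow> P \<in> SSYT (shape J) \<Longrightarrow>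
      J' \<in> H \<Longrightarrow> P' \<in> SSYT (shape J') \<Longrightarrow> rel M N J P \<Longrightarrow> rel M N J' P' \<Longrightarrow> J = J' \<and> P = P'"
    and inj: "\<And>M N J P M' N'. M \<in> SSYT lam \<Longrightarrow> N \<in> SSYT kap \<Longrightarrow> J \<in> H \<Longrightarrow> P \<in> SSYT (shape J) \<Longrightarrow>
      M' \<in> SSYT lam \<Longrightarrow> N' \<in> SSYT kap \<Longrightarrow> rel M N J P \<Longrightarrow> rel M' N' J P \<Longrightarrow> M = M' \<and> N = N'"
    and count: "\<And>M N J P n. M \<in> SSYT lam \<Longrightarrow> N \<in> SSYT kap \<Longrightarrow> J \<in> H \<Longrightarrow> P \<in> SSYT (shape J) \<Longrightarrow>
      rel M N J P \<Longrightarrow> entry_count (shape J) P n = entry_count lam M n + entry_count kap N n"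
    and off: "\<And>M N J P b. M \<in> SSYT lam \<Longrightarrow> N \<in> SSYT kap \<Longrightarrow> J \<in> H \<Longrightarrow> P \<in> SSYT (shape J) \<Longrightarrow>
      rel M N J P \<Longrightarrow> b \<in> diagram (shape J) \<Longrightarrow> label J b \<notin> V \<Longrightarrow> P b = case_sum M N (label J b)"
    and summ: "\<And>\<sigma>. \<sigma> permutes V \<Longrightarrow>
        (\<lambda>M. norm (zeta_term (diagram lam) ((v \<circ> \<sigma>) \<circ> Inl) M)) summable_on SSYT lam"
      "\<And>\<sigma>. \<sigma> permutes V \<Longrightarrow>
        (\<lambda>N. norm (zeta_term (diagram kap) ((v \<circ> \<sigma>) \<circ> Inr) N)) summable_on SSYT kap"
  shows "sym_sum V (\<lambda>w. schur_zeta lam (w \<circ> Inl) * schur_zeta kap (w \<circ> Inr)) v =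
    sym_sum V (\<lambda>w. \<Sum>J\<in>H. schur_zeta (shape J) (push J (w \<circ> Inl) (w \<circ> Inr))) v"
proof -
  define A where "A = SSYT lam \<times> SSYT kap"
  define B where "B = Sigma H (\<lambda>J. SSYT (shape J))"
  define gA where "gA = (\<lambda>a :: (nat \<times> nat \<Rightarrow> nat) \<times> (nat \<times> nat \<Rightarrow> nat). case_sum (fst a) (snd a))"
  \<comment> \<open>Transporting the entries of \<open>P\<close> along the inverse labelling lets
    the shapes for all \<open>J\<close> be compared on the one index set \<open>D\<close>.\<close>
  define gB where "gB = (\<lambda>b :: 'j \<times> (nat \<times> nat \<Rightarrow> nat). \<lambda>x.
    snd b (the_inv_into (diagram (shape (fst b))) (label (fst b)) x))"
  have finD: "finite D" by (simp add: D_def)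
  have gB: "gB (J, P) (label J b) = P b" if "J \<in> H" "b \<in> diagram (shape J)" for J P b
    using the_inv_into_f_f[OF bij_betw_imp_inj_on[OF label[OF that(1)]] that(2)] by (simp add: gB_def)
  obtain \<Phi> where \<Phi>: "bij_betw \<Phi> A B"
    and rel: "\<And>a. a \<in> A \<Longrightarrow> (case a of (M, N) \<Rightarrow> case \<Phi> a of (J, P) \<Rightarrow> rel M N J P)"
  proof (rule bij_betw_of_relation[of A B "\<lambda>a b. case a of (M, N) \<Rightarrow> case b of (J, P) \<Rightarrow> rel M N J P"])
    show "\<exists>b\<in>B. case a of (M, N) \<Rightarrow> case b of (J, P) \<Rightarrow> rel M N J P" if "a \<in> A" for a
      using that total by (fastforce simp: A_def B_def)
    show "\<exists>a\<in>A. case a of (M, N) \<Rightarrow> case b of (J, P) \<Rightarrow> rel M N J P" if "b \<in> B" for b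
      using that onto by (fastforce simp: A_def B_def)
    show "b = b'" if "a \<in> A" "b \<in> B" "b' \<in> B" "case a of (M, N) \<Rightarrow> case b of (J, P) \<Rightarrow> rel M N J P"
      "case a of (M, N) \<Rightarrow> case b' of (J, P) \<Rightarrow> rel M N J P" for a b b'
      using that unique by (fastforce simp: A_def B_def)
    show "a = a'" if "a \<in> A" "a' \<in> A" "b \<in> B" "case a of (M, N) \<Rightarrow> case b of (J, P) \<Rightarrow> rel M N J P"
      "case a' of (M, N) \<Rightarrow> case b of (J, P) \<Rightarrow> rel M N J P" for a a' b
      using that inj by (fastforce simp: A_def B_def)
  qed blast
  have perm: "\<exists>\<tau>. \<tau> permutes V \<and> (\<forall>x\<in>D. gB (\<Phi> a) x = gA a (\<tau> x))" if a: "a \<in> A" for a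
  proof -
    obtain M N J P where MN: "a = (M, N)" "\<Phi> a = (J, P)" by fastforce
    have mem: "M \<in> SSYT lam" "N \<in> SSYT kap" "J \<in> H" "P \<in> SSYT (shape J)"
      using a bij_betw_apply[OF \<Phi> a] unfolding MN(2) by (simp_all add: A_def B_def MN(1))
    have r: "rel M N J P" using rel[OF a] unfolding MN(2) by (simp add: MN(1))
    have "card {x \<in> D. gA a x \<le> n} = card {x \<in> D. gB (\<Phi> a) x \<le> n}" for n
    proof -
      have "bij_betw (label J) {b \<in> diagram (shape J). P b \<le> n} {x \<in> D. gB (J, P) x \<le> n}"
        using label[OF mem(3)] gB[OF mem(3)]
        by (force simp: bij_betw_def inj_on_def)
      then have "card {x \<in> D. gB (J, P) x \<le> n} = entry_count (shape J) P n"
        by (simp add: entry_count_def bij_betw_same_card[symmetric])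
      also have "\<dots> = entry_count lam M n + entry_count kap N n"
        by (rule count[OF mem r])
      also have "\<dots> = card (Inl ` {b \<in> diagram lam. M b \<le> n} \<union> (Inr ` {b \<in> diagram kap. N b \<le> n} :: indet set))"
        by (subst card_Un_disjoint) (auto simp: card_image entry_count_def)
      also have "\<dots> = card {x \<in> D. gA a x \<le> n}"
        by (rule arg_cong[where f = card]) (auto simp: D_def gA_def MN(1))
      finally show ?thesis unfolding MN(2) by simp
    qed
    moreover have "gA a x = gB (\<Phi> a) x" if "x \<in> D - V" for x
    proof -
      have "x \<in> D" using that by simp
      then obtain b where "b \<in> diagram (shape J)" "x = label J b"
        using bij_betw_imp_surj_on[OF label[OF mem(3)]] by blast
      then show ?thesis using off[OF mem r, of b] that gB[OF mem(3)]
        unfolding MN(2) by (simp add: gA_def MN(1))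
    qed
    ultimately show ?thesis by (rule permutation_of_equal_counts[OF finD V])
  qed
  have factor: "zeta_term D w (gA a) =
      zeta_term (diagram lam) (w \<circ> Inl) (fst a) * zeta_term (diagram kap) (w \<circ> Inr) (snd a)" for w a
  proof -
    have "(\<Prod>x\<in>D. of_nat (gA a x) powr w x) =
        (\<Prod>x\<in>Inl ` diagram lam. of_nat (gA a x) powr w x) * (\<Prod>x\<in>Inr ` diagram kap. of_nat (gA a x) powr w x)"
      unfolding D_def by (rule prod.union_disjoint) auto
    then show ?thesis by (simp add: zeta_term_def prod.reindex gA_def)
  qed
  have summA: "(\<lambda>a. norm (zeta_term D (v \<circ> \<sigma>) (gA a))) summable_on A" if "\<sigma> permutes V" for \<sigma>
    unfolding A_def factor by (rule summable_on_norm_product(1)[OF summ[OF that]])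
  note main = symmetrized_infsum_bij[OF finD V \<Phi> perm summA]
  have left: "schur_zeta lam ((v \<circ> \<sigma>) \<circ> Inl) * schur_zeta kap ((v \<circ> \<sigma>) \<circ> Inr) =
      infsum (\<lambda>a. zeta_term D (v \<circ> \<sigma>) (gA a)) A" if "\<sigma> permutes V" for \<sigma>
    unfolding A_def factor schur_zeta_zeta_term by (rule summable_on_norm_product(2)[OF summ[OF that]])
  have right: "(\<Sum>J\<in>H. schur_zeta (shape J) (push J ((v \<circ> \<sigma>) \<circ> Inl) ((v \<circ> \<sigma>) \<circ> Inr))) =
      infsum (\<lambda>b. zeta_term D (v \<circ> \<sigma>) (gB b)) B" if \<sigma>: "\<sigma> permutes V" for \<sigma>
  proof -
    have "schur_zeta (shape J) (push J ((v \<circ> \<sigma>) \<circ> Inl) ((v \<circ> \<sigma>) \<circ> Inr)) =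
        infsum (\<lambda>P. zeta_term D (v \<circ> \<sigma>) (gB (J, P))) (SSYT (shape J))" if J: "J \<in> H" for J
      unfolding schur_zeta_zeta_term
    proof (rule infsum_cong)
      fix P
      have "zeta_term (diagram (shape J)) (push J ((v \<circ> \<sigma>) \<circ> Inl) ((v \<circ> \<sigma>) \<circ> Inr)) P =
          zeta_term (diagram (shape J)) (\<lambda>b. (v \<circ> \<sigma>) (label J b)) (\<lambda>b. gB (J, P) (label J b))"
        using push[OF J, of _ "v \<circ> \<sigma>"] gB[OF J] by (intro zeta_term_cong) simp_all
      also have "\<dots> = zeta_term D (v \<circ> \<sigma>) (gB (J, P))"
        by (rule zeta_term_reindex[OF label[OF J]])
      finally show "zeta_term (diagram (shape J)) (push J ((v \<circ> \<sigma>) \<circ> Inl) ((v \<circ> \<sigma>) \<circ> Inr)) P =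
          zeta_term D (v \<circ> \<sigma>) (gB (J, P))" .
    qed
    \<comment> \<open>The finite sum over \<open>J\<close> is written as \<open>infsum\<close> so
      that it merges with the sums over tableaux; this requires the summability on \<open>B\<close>
      obtained by symmetrisation.\<close>
    then have "(\<Sum>J\<in>H. schur_zeta (shape J) (push J ((v \<circ> \<sigma>) \<circ> Inl) ((v \<circ> \<sigma>) \<circ> Inr))) =
        infsum (\<lambda>J. infsum (\<lambda>P. zeta_term D (v \<circ> \<sigma>) (gB (J, P))) (SSYT (shape J))) H"
      using H by simp
    also have "\<dots> = infsum (\<lambda>b. zeta_term D (v \<circ> \<sigma>) (gB b)) B"
      unfolding B_def by (rule infsum_Sigma_banach) (use main(2)[OF _ _ \<sigma>] B_def in auto)
    finally show ?thesis .
  qed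
  show ?thesis
    unfolding sym_sum_def using main(1) by (simp add: left right)
qed

section \<open>Convergence of the factors and the labels outside the symmetrised set\<close>

text \<open>Every box is dominated by the end of its row and by the foot of its column, so one of
  these with exponent of real part above 1 suffices. For the factor of shape \<open>lam\<close>, the
  H-type identity uses the feet and the E-type identity the row ends.\<close>

lemma summable_on_norm_SSYT:
  assumes lam: "is_partition lam"
    and ge: "\<And>b. b \<in> diagram lam \<Longrightarrow> 1 \<le> Re (s b)"
    and dom: "\<And>i j. (i, j) \<in> diagram lam \<Longrightarrow>
      1 < Re (s (conj_part lam j, j)) \<or> 1 < Re (s (i, lam i))"
  shows "(\<lambda>M. norm (zeta_term (diagram lam) s M)) summable_on SSYT lam"
proof (rule summable_on_norm_zeta_term)
  show "SSYT lam \<subseteq> diagram lam \<rightarrow>\<^sub>E {1..}" by (auto simp: SSYT_def fillings_def)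
  fix b assume b: "b \<in> diagram lam"
  obtain i j where ij: "b = (i, j)" by (cases b)
  have d: "1 \<le> i" "1 \<le> j" "j \<le> lam i" using b by (simp_all add: ij diagram_partition[OF lam])
  have c: "i \<le> conj_part lam j" using conj_part_iff[OF lam d(1,2)] d by simp
  then have cj: "j \<le> lam (conj_part lam j)"
    using conj_part_iff[OF lam, of "conj_part lam j" j] d by simp
  have "(conj_part lam j, j) \<in> diagram lam" "(i, lam i) \<in> diagram lam"
    using c cj d by (simp_all add: diagram_partition[OF lam])
  moreover have "M (i, j) \<le> M (conj_part lam j, j)" "M (i, j) \<le> M (i, lam i)" if "M \<in> SSYT lam" for M
    using SSYT_column_mono[OF lam that d(2,1) c cj] SSYT_row_mono[OF lam that d(1,2,3)] by simp_all
  ultimately show "\<exists>c\<in>diagram lam. 1 < Re (s c) \<and> (\<forall>M\<in>SSYT lam. M b \<le> M c)"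
    using dom[of i j] b unfolding ij by blast
qed (use ge in auto)

text \<open>A rank is at most the element itself, so \<open>j\<close> is at least \<open>r\<close>,
  and above \<open>r\<close> the set \<open>J\<close> is an interval ending in \<open>y\<close>. The
  elements of \<open>J\<close> after \<open>j\<close> are thus exactly those from
  \<open>j + 1\<close> to \<open>y\<close>, which fixes the position of \<open>j\<close> counted
  from the end.\<close>

lemma position_from_rank:
  fixes J :: "nat set"
  assumes J: "finite J" "J \<subseteq> {1..}" "j \<in> J" and r: "r \<le> y" "r \<le> card {a \<in> J. a \<le> j}"
    and above: "\<And>a. r < a \<Longrightarrow> a \<in> J \<longleftrightarrow> a \<le> y"
  shows "j + card J = y + card {a \<in> J. a \<le> j}"
proof -
  have "card {a \<in> J. a \<le> j} \<le> card {1..j}"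
    using J by (intro card_mono) auto
  then have rj: "r \<le> j" using r by simp
  have jy: "j \<le> y" using above[of j] J(3) r(1) rj by (cases "r = j") auto
  have "{a \<in> J. j < a} = {j<..y}" using above rj by auto
  then have "card {a \<in> J. j < a} = y - j" by simp
  moreover have "card J = card {a \<in> J. a \<le> j} + card {a \<in> J. j < a}"
    using J by (subst card_Un_disjoint[symmetric]) (auto intro: arg_cong[where f = card])
  ultimately show ?thesis using jy by simp
qed

lemma Re_permuted:
  fixes v :: "'a \<Rightarrow> complex"
  assumes "\<sigma> permutes V" "\<forall>x\<in>V. 1 < Re (v x)"
  shows "1 \<le> Re (v x) \<Longrightarrow> 1 \<le> Re ((v \<circ> \<sigma>) x)"
    and "x \<in> V \<or> 1 < Re (v x) \<Longrightarrow> 1 < Re ((v \<circ> \<sigma>) x)"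
  using bspec[OF assms(2), of "\<sigma> x"] permutes_in_image[OF assms(1), of x] permutes_not_in[OF assms(1), of x]
  by (cases "x \<in> V"; simp)+

lemma conj_part_1:
  assumes "is_partition lam" shows "conj_part lam 1 = part_length lam"
proof (rule antisym)
  show "conj_part lam 1 \<le> part_length lam"
    by (rule nat_le_via_lower) (simp add: conj_part_iff[OF assms] part_length_iff[OF assms])
  show "part_length lam \<le> conj_part lam 1"
    by (rule nat_le_via_lower) (simp add: conj_part_iff[OF assms] part_length_iff[OF assms])
qed

lemma nat_eqI_le: "(\<And>v. x \<le> v \<longleftrightarrow> y \<le> v) \<Longrightarrow> x = (y :: nat)"
  by (meson order_antisym order_refl)

text \<open>The labels off the symmetrised set are the t_k with k \<ge> \<open>lam 1\<close> and the
  boxes of the first column of \<open>lam\<close> below the foot of the second. For these, the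
  chains reach the box and its label at the same threshold, which makes the entries equal.\<close>

lemma H_fixed_entries:
  assumes lam: "is_partition lam" and M: "M \<in> SSYT lam" and N: "N \<in> SSYT (one_row m)"
    and J: "J \<in> H_set lam m" and P: "P \<in> SSYT (add_columns lam J)"
    and G: "row.grows (tab_chain lam M) (entry_count (one_row m) N) (tab_chain (add_columns lam J) P)"
    and b: "b \<in> diagram (add_columns lam J)" and off: "column_label J b \<notin> H_indets lam m"
  shows "P b = case_sum M N (column_label J b)"
proof -
  define nu where "nu = add_columns lam J"
  note h = H_setD(1)[OF lam J, folded nu_def] and fin = H_setD(2)[OF lam J]
  note cJ = H_setD(3)[OF lam J] and conj = H_setD(5)[OF lam J, folded nu_def]
  have nu: "is_partition nu" by (rule hstrip_partition(2)[OF h])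
  have J1: "J \<subseteq> {1..}" using J by (auto simp: H_set_def E_set_def)
  note L = strip_chain_tab_chain[OF lam M] and C = strip_chain_tab_chain[OF nu P[folded nu_def]]
  note K = count_seq_one_row[OF N] and G' = G[folded nu_def]
  obtain i j where ij: "b = (i, j)" by (cases b)
  have box: "1 \<le> i" "1 \<le> j" "j \<le> nu i" and b': "(i, j) \<in> diagram nu"
    using b by (simp_all add: ij diagram_partition[OF nu] flip: nu_def)
  have P_le: "P (i, j) \<le> w \<longleftrightarrow> j \<le> tab_chain nu P w i" for w
    using tab_chain_iff[OF nu P[folded nu_def] b'] by simp
  have first_column: "a = 1 \<and> conj_part lam 2 < c \<and> lam c = 1"
    if "(c, a) \<in> diagram lam" "Inl (c, a) \<notin> H_indets lam m" for a c
  proof -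
    have d: "1 \<le> c" "1 \<le> a" "a \<le> lam c" using that by (simp_all add: diagram_partition[OF lam])
    have "a \<le> lam 1" using d is_partition_antimono[OF lam, of 1 c] by simp
    moreover have "c \<le> conj_part lam a" using conj_part_iff[OF lam d(1,2)] d by simp
    ultimately have "a = 1" using that(2) d by (auto simp: H_indets_def)
    moreover from this have c: "conj_part lam 2 < c" using that(2) d by (auto simp: H_indets_def)
    moreover have "lam c = 1" using conj_part_iff[OF lam d(1), of 2] c d by simp
    ultimately show ?thesis by simp
  qed
  have lab: "column_label J b \<in> Inl ` diagram lam \<union> Inr ` diagram (one_row m)"
    by (rule bij_betw_apply[OF bij_betw_column_label[OF lam J] b])
  show ?thesis
  proof (cases "j \<in> J \<and> i = 1")
    case True
    define k where "k = card {a \<in> J. a \<le> j}"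
    have l: "column_label J b = Inr (1, k)" using True by (simp add: column_label_def ij k_def)
    have k: "1 \<le> k" "k \<le> m" using lab by (auto simp: l diagram_one_row)
    have "lam 1 \<le> k" using off k by (auto simp: l H_indets_def)
    moreover have "j + card J = nu 1 + k"
      unfolding k_def
    proof (rule position_from_rank[OF fin J1, where r = "lam 1"])
      \<comment> \<open>Columns beyond \<open>lam 1\<close> are empty in \<open>lam\<close>, so
        there \<open>J\<close> consists of the nonempty columns of \<open>nu\<close>.\<close>
      show "a \<in> J \<longleftrightarrow> a \<le> nu 1" if "lam 1 < a" for a
      proof -
        have "conj_part lam a = 0" using conj_part_iff[OF lam, of 1 a] that by simp
        then have "a \<in> J \<longleftrightarrow> 1 \<le> conj_part nu a" by (simp add: conj add_rows_def)
        then show ?thesis using conj_part_iff[OF nu, of 1 a] that by simp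
      qed
    qed (use True hstrip_le[OF h] \<open>lam 1 \<le> k\<close> k_def in auto)
    ultimately have "j \<le> tab_chain nu P w 1 \<longleftrightarrow> k \<le> entry_count (one_row m) N w" for w
      by (intro row_grows_first_row[OF L C K G']) (simp_all add: cJ)
    then have "P (i, j) \<le> w \<longleftrightarrow> N (1, k) \<le> w" for w
      using P_le[of w] entry_count_one_row_iff[OF N k, of w] True by simp
    then have "P (i, j) = N (1, k)" by (rule nat_eqI_le)
    then show ?thesis by (simp only: l) (simp add: ij)
  next
    case False
    define c where "c = (if j \<in> J then i - 1 else i)"
    have l: "column_label J b = Inl (c, j)" using False by (simp add: column_label_def ij c_def)
    then have d: "(c, j) \<in> diagram lam" using lab by auto
    note j1 = first_column[OF d off[unfolded l]]
    have c1: "1 \<le> c" using d by (simp add: diagram_partition[OF lam])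
    have M_le: "M (c, j) \<le> w \<longleftrightarrow> j \<le> tab_chain lam M w c" for w
      using tab_chain_iff[OF lam M d] by simp
    \<comment> \<open>The pushing rule shifts the tail of the first column exactly when
      \<open>1 \<in> J\<close>; this has to match the case distinction of the growth
      diagram.\<close>
    have tail: "1 \<le> nu (conj_part lam 1 + 1) \<longleftrightarrow> 1 \<in> J"
      using conj_part_iff[OF nu, of "conj_part lam 1 + 1" 1]
      by (auto simp: conj add_rows_def split: if_splits)
    have "1 \<le> tab_chain nu P w i \<longleftrightarrow> 1 \<le> tab_chain lam M w c" for w
    proof (cases "j \<in> J")
      case True
      then have "i = c + 1" using False box by (simp add: c_def)
      then show ?thesis
        using row_grows_first_column(1)[OF L C K G' c1, of w] j1 tail True by simp
    next
      case F: False
      then have "i = c" by (simp add: c_def)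
      moreover have "nu (conj_part lam 1 + 1) = 0" using tail F j1 by auto
      ultimately show ?thesis
        using row_grows_first_column(2)[OF L C K G' c1, of w] j1 by simp
    qed
    then have "P (i, j) \<le> w \<longleftrightarrow> M (c, j) \<le> w" for w
      using P_le[of w] M_le[of w] j1 by simp
    then have "P (i, j) = M (c, j)" by (rule nat_eqI_le)
    then show ?thesis by (simp only: l) (simp add: ij)
  qed
qed

text \<open>Rows and columns exchange roles: fixed are the inserted column from index p on and the
  part of the first row of \<open>lam\<close> beyond \<open>lam 2\<close>, which is shifted exactly
  when \<open>1 \<in> K\<close>.\<close>

lemma E_fixed_entries:
  assumes lam: "is_partition lam" and M: "M \<in> SSYT (one_column n)" and N: "N \<in> SSYT lam"
    and K: "K \<in> E_set lam n" and P: "P \<in> SSYT (add_rows lam K)"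
    and G: "column.grows (tab_chain lam N) (entry_count (one_column n) M) (tab_chain (add_rows lam K) P)"
    and b: "b \<in> diagram (add_rows lam K)" and off: "row_label K b \<notin> E_indets lam n"
  shows "P b = case_sum M N (row_label K b)"
proof -
  define nu where "nu = add_rows lam K"
  note h = E_setD(1)[OF lam K, folded nu_def] and fin = E_setD(2)[OF lam K]
  note cK = E_setD(3)[OF lam K]
  have nu: "is_partition nu" by (rule vstrip_partition(2)[OF h])
  have K1: "K \<subseteq> {1..}" using K by (auto simp: E_set_def)
  note L = strip_chain_tab_chain[OF lam N] and C = strip_chain_tab_chain[OF nu P[folded nu_def]]
  note S = count_seq_one_column[OF M] and G' = G[folded nu_def]
  obtain i j where ij: "b = (i, j)" by (cases b)
  have box: "1 \<le> i" "1 \<le> j" "j \<le> nu i" and b': "(i, j) \<in> diagram nu"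
    using b by (simp_all add: ij diagram_partition[OF nu] flip: nu_def)
  have P_le: "P (i, j) \<le> w \<longleftrightarrow> j \<le> tab_chain nu P w i" for w
    using tab_chain_iff[OF nu P[folded nu_def] b'] by simp
  have first_row: "a = 1 \<and> lam 2 < c"
    if "(a, c) \<in> diagram lam" "Inr (a, c) \<notin> E_indets lam n" for a c
    using that by (auto simp: diagram_def E_indets_def le_Suc_eq)
  have lab: "row_label K b \<in> Inl ` diagram (one_column n) \<union> Inr ` diagram lam"
    using bij_betw_apply[OF bij_betw_row_label[OF lam nu[unfolded nu_def] fin] b] by (simp add: cK)
  show ?thesis
  proof (cases "i \<in> K \<and> j = 1")
    case True
    define k where "k = card {a \<in> K. a \<le> i}"
    have l: "row_label K b = Inl (k, 1)" using True by (simp add: row_label_def ij k_def)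
    have k: "1 \<le> k" "k \<le> n" using lab by (auto simp: l diagram_one_column)
    have ck: "conj_part lam 1 \<le> k"
      using off k unfolding conj_part_1[OF lam] by (auto simp: l E_indets_def)
    have "i + card K = conj_part nu 1 + k"
      unfolding k_def
    proof (rule position_from_rank[OF fin K1, where r = "conj_part lam 1"])
      show "conj_part lam 1 \<le> conj_part nu 1"
      proof (rule nat_le_via_lower)
        fix a :: nat assume "1 \<le> a" "a \<le> conj_part lam 1"
        then show "a \<le> conj_part nu 1"
          using conj_part_iff[OF lam, of a 1] conj_part_iff[OF nu, of a 1] vstrip_le[OF h, of a] by simp
      qed
      show "a \<in> K \<longleftrightarrow> a \<le> conj_part nu 1" if "conj_part lam 1 < a" for a
      proof -
        have "lam a = 0" using conj_part_iff[OF lam, of a 1] that by simp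
        then show ?thesis using conj_part_iff[OF nu, of a 1] that by (simp add: nu_def add_rows_def)
      qed
    qed (use True ck k_def in auto)
    then have "1 \<le> tab_chain nu P w i \<longleftrightarrow> k \<le> entry_count (one_column n) M w" for w
      using ck box by (intro column_grows_first_column[OF L C S G']) (simp_all add: cK)
    then have "P (i, j) \<le> w \<longleftrightarrow> M (k, 1) \<le> w" for w
      using P_le[of w] entry_count_one_column_iff[OF M k, of w] True by simp
    then have "P (i, j) = M (k, 1)" by (rule nat_eqI_le)
    then show ?thesis by (simp only: l) (simp add: ij)
  next
    case False
    define c where "c = (if i \<in> K then j - 1 else j)"
    have l: "row_label K b = Inr (i, c)" using False by (simp add: row_label_def ij c_def)
    then have d: "(i, c) \<in> diagram lam" using lab by auto
    note i1 = first_row[OF d off[unfolded l]]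
    then have c2: "lam 2 < c" by simp
    have N_le: "N (i, c) \<le> w \<longleftrightarrow> c \<le> tab_chain lam N w i" for w
      using tab_chain_iff[OF lam N d] by simp
    have "j \<le> tab_chain nu P w 1 \<longleftrightarrow> c \<le> tab_chain lam N w 1" for w
    proof (cases "i \<in> K")
      case True
      then have "j = c + 1" using False box by (simp add: c_def)
      moreover have "nu 1 = lam 1 + 1" using True i1 by (simp add: nu_def add_rows_def)
      ultimately show ?thesis
        using column_grows_first_row(2)[OF L C S G' c2, of w] by simp
    next
      case F: False
      then have "nu 1 = lam 1" using i1 by (simp add: nu_def add_rows_def)
      then show ?thesis
        using column_grows_first_row(1)[OF L C S G' c2, of w] F by (simp add: c_def)
    qed
    then have "P (i, j) \<le> w \<longleftrightarrow> N (i, c) \<le> w" for w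
      using P_le[of w] N_le[of w] i1 by simp
    then have "P (i, j) = N (i, c)" by (rule nat_eqI_le)
    then show ?thesis by (simp only: l) (simp add: ij)
  qed
qed

section \<open>The two identities\<close>

lemma H_type_identity:
  fixes v :: "indet \<Rightarrow> complex"
  assumes lam: "is_partition lam"
    and ge: "\<And>b. b \<in> diagram lam \<Longrightarrow> 1 \<le> Re (v (Inl b))"
      "\<And>k. k \<in> {1..m} \<Longrightarrow> 1 \<le> Re (v (Inr (1, k)))"
    and gt: "\<And>x. x \<in> H_indets lam m \<Longrightarrow> 1 < Re (v x)"
      "1 < Re (v (Inr (1, m)))" "1 \<le> lam 1 \<Longrightarrow> 1 < Re (v (Inl (conj_part lam 1, 1)))"
  shows "sym_sum (H_indets lam m)
      (\<lambda>w. schur_zeta lam (w \<circ> Inl) * schur_zeta (one_row m) (w \<circ> Inr)) v =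
    sym_sum (H_indets lam m)
      (\<lambda>w. \<Sum>J\<in>H_set lam m. schur_zeta (add_columns lam J) (push_columns lam J (w \<circ> Inl) (w \<circ> Inr))) v"
proof (rule symmetrized_schur_product[where shape = "add_columns lam" and label = column_label
      and push = "push_columns lam" and rel = "\<lambda>M N J P. row.grows (tab_chain lam M)
        (entry_count (one_row m) N) (tab_chain (add_columns lam J) P)"])
  have part: "is_partition (add_columns lam J)" if "J \<in> H_set lam m" for J
    by (rule hstrip_partition(2)[OF H_setD(1)[OF lam that]])
  note sc = strip_chain_tab_chain[OF lam] and sc' = strip_chain_tab_chain[OF part]
  show "H_indets lam m \<subseteq> Inl ` diagram lam \<union> Inr ` diagram (one_row m)"
  proof
    fix x assume "x \<in> H_indets lam m"
    then consider k where "1 \<le> k" "k \<le> m" "x = Inr (1, k)"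
      | i where "1 \<le> i" "i \<le> conj_part lam 2" "x = Inl (i, 1)"
      | i j where "2 \<le> j" "1 \<le> i" "i \<le> conj_part lam j" "x = Inl (i, j)"
      by (auto simp: H_indets_def)
    then show "x \<in> Inl ` diagram lam \<union> Inr ` diagram (one_row m)"
    proof cases
      case 2
      then show ?thesis using conj_part_iff[OF lam, of i 2] by (simp add: diagram_partition[OF lam] image_iff)
    next
      case 3
      then show ?thesis using conj_part_iff[OF lam, of i j] by (simp add: diagram_partition[OF lam] image_iff)
    qed (simp add: diagram_one_row)
  qed
  show "finite (H_set lam m)" by (rule finite_H_set[OF lam])
  show "bij_betw (column_label J) (diagram (add_columns lam J))
      (Inl ` diagram lam \<union> Inr ` diagram (one_row m))" if "J \<in> H_set lam m" for J
    by (rule bij_betw_column_label[OF lam that])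
  show "push_columns lam J (w \<circ> Inl) (w \<circ> Inr) b = w (column_label J b)"
    if "b \<in> diagram (add_columns lam J)" for J w b
    by (rule push_columns_label[OF that])
  show "\<exists>J\<in>H_set lam m. \<exists>P\<in>SSYT (add_columns lam J). row.grows (tab_chain lam M)
      (entry_count (one_row m) N) (tab_chain (add_columns lam J) P)"
    if M: "M \<in> SSYT lam" and N: "N \<in> SSYT (one_row m)" for M N
  proof -
    obtain C nu where C: "strip_chain nu C" "hstrip lam nu"
      and G: "row.grows (tab_chain lam M) (entry_count (one_row m) N) C"
      using row.growth_forward[OF sc[OF M] count_seq_one_row[OF N]] by blast
    obtain w where w: "C w = nu" "tab_chain lam M w = lam" "entry_count (one_row m) N w = m"
      by (rule row.common_limit[OF sc[OF M] C(1) count_seq_one_row[OF N]])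
    have "card (diagram nu) = card (diagram lam) + m"
      using row.grows_card[OF sc[OF M] C(1) count_seq_one_row[OF N] G, of w] w by simp
    then obtain J where J: "J \<in> H_set lam m" "add_columns lam J = nu"
      using hstrip_H_set[OF C(2)] by blast
    obtain P where "P \<in> SSYT nu" "tab_chain nu P = C" by (rule strip_chain_tableau[OF C(1)])
    then show ?thesis using J G by blast
  qed
  show "\<exists>M\<in>SSYT lam. \<exists>N\<in>SSYT (one_row m). row.grows (tab_chain lam M)
      (entry_count (one_row m) N) (tab_chain (add_columns lam J) P)"
    if J: "J \<in> H_set lam m" and P: "P \<in> SSYT (add_columns lam J)" for J P
  proof -
    obtain L K where L: "strip_chain lam L" and K: "row.count_seq m K"
      and G: "row.grows L K (tab_chain (add_columns lam J) P)"
      by (rule row.growth_backward[OF sc'[OF J P] H_setD(1,4)[OF lam J]])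
    obtain M where "M \<in> SSYT lam" "tab_chain lam M = L" by (rule strip_chain_tableau[OF L])
    moreover obtain N where "N \<in> SSYT (one_row m)" "entry_count (one_row m) N = K"
      by (rule count_seq_one_row_tableau[OF K])
    ultimately show ?thesis using G by blast
  qed
  show "J = J' \<and> P = P'"
    if "M \<in> SSYT lam" "N \<in> SSYT (one_row m)" and J: "J \<in> H_set lam m" "J' \<in> H_set lam m"
      and P: "P \<in> SSYT (add_columns lam J)" "P' \<in> SSYT (add_columns lam J')"
      and G: "row.grows (tab_chain lam M) (entry_count (one_row m) N) (tab_chain (add_columns lam J) P)"
        "row.grows (tab_chain lam M) (entry_count (one_row m) N) (tab_chain (add_columns lam J') P')"
    for M N J P J' P'
  proof -
    have eq: "tab_chain (add_columns lam J) P = tab_chain (add_columns lam J') P'"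
      by (rule row.grows_forward_unique[OF sc'[OF J(1) P(1)] sc'[OF J(2) P(2)] G])
    then have "add_columns lam J = add_columns lam J'"
      using strip_chain_limit_unique[OF sc'[OF J(1) P(1)]] sc'[OF J(2) P(2)] by simp
    moreover from this have "J = J'" by (rule add_columns_inject[OF lam J])
    ultimately show ?thesis using tab_chain_inj[OF part[OF J(1)] P(1)] P(2) eq by simp
  qed
  show "M = M' \<and> N = N'"
    if M: "M \<in> SSYT lam" "M' \<in> SSYT lam" and N: "N \<in> SSYT (one_row m)" "N' \<in> SSYT (one_row m)"
      and J: "J \<in> H_set lam m" and P: "P \<in> SSYT (add_columns lam J)"
      and G: "row.grows (tab_chain lam M) (entry_count (one_row m) N) (tab_chain (add_columns lam J) P)"
        "row.grows (tab_chain lam M') (entry_count (one_row m) N') (tab_chain (add_columns lam J) P)"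
    for M N J P M' N'
    using row.grows_backward_unique[OF sc[OF M(1)] sc[OF M(2)] count_seq_one_row[OF N(1)]
        count_seq_one_row[OF N(2)] sc'[OF J P] G]
      tab_chain_inj[OF lam M] entry_count_one_row_inj[OF N] by blast
  show "entry_count (add_columns lam J) P n = entry_count lam M n + entry_count (one_row m) N n"
    if M: "M \<in> SSYT lam" and N: "N \<in> SSYT (one_row m)"
      and J: "J \<in> H_set lam m" and P: "P \<in> SSYT (add_columns lam J)"
      and G: "row.grows (tab_chain lam M) (entry_count (one_row m) N) (tab_chain (add_columns lam J) P)"
    for M N J P n
    using row.grows_card[OF sc[OF M] sc'[OF J P] count_seq_one_row[OF N] G, of n]
    by (simp add: entry_count_tab_chain[OF lam M] entry_count_tab_chain[OF part[OF J] P])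
  show "P b = case_sum M N (column_label J b)"
    if "M \<in> SSYT lam" "N \<in> SSYT (one_row m)" "J \<in> H_set lam m" "P \<in> SSYT (add_columns lam J)"
      "row.grows (tab_chain lam M) (entry_count (one_row m) N) (tab_chain (add_columns lam J) P)"
      "b \<in> diagram (add_columns lam J)" "column_label J b \<notin> H_indets lam m" for M N J P b
    by (rule H_fixed_entries[OF lam that])
  fix \<sigma> assume \<sigma>: "\<sigma> permutes H_indets lam m"
  have "\<forall>x\<in>H_indets lam m. 1 < Re (v x)" using gt(1) by blast
  note Re = Re_permuted[OF \<sigma> this]
  show "(\<lambda>M. norm (zeta_term (diagram lam) ((v \<circ> \<sigma>) \<circ> Inl) M)) summable_on SSYT lam"
  proof (rule summable_on_norm_SSYT[OF lam])
    show "1 \<le> Re (((v \<circ> \<sigma>) \<circ> Inl) b)" if "b \<in> diagram lam" for b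
      using Re(1)[OF ge(1)[OF that]] by simp
    show "1 < Re (((v \<circ> \<sigma>) \<circ> Inl) (conj_part lam j, j)) \<or> 1 < Re (((v \<circ> \<sigma>) \<circ> Inl) (i, lam i))"
      if d: "(i, j) \<in> diagram lam" for i j
    proof -
      have d: "1 \<le> i" "1 \<le> j" "j \<le> lam i" using d by (simp_all add: diagram_partition[OF lam])
      have "j \<le> lam 1" using d is_partition_antimono[OF lam, of 1 i] by simp
      moreover have "1 \<le> conj_part lam j" using conj_part_iff[OF lam d(1,2)] d by simp
      \<comment> \<open>The foot of a column keeps real part above 1 under every permutation: for
        \<open>j \<ge> 2\<close> it is symmetrised, and for the first column there is the separate
        hypothesis.\<close>
      ultimately have "Inl (conj_part lam j, j) \<in> H_indets lam m \<or> 1 < Re (v (Inl (conj_part lam j, j)))"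
        using gt(3) d by (cases "j = 1") (auto simp: H_indets_def)
      then show ?thesis using Re(2) by simp
    qed
  qed
  show "(\<lambda>N. norm (zeta_term (diagram (one_row m)) ((v \<circ> \<sigma>) \<circ> Inr) N)) summable_on SSYT (one_row m)"
  proof (rule summable_on_norm_SSYT[OF is_partition_one_row])
    show "1 \<le> Re (((v \<circ> \<sigma>) \<circ> Inr) b)" if "b \<in> diagram (one_row m)" for b
      using that ge(2)[of "snd b"] Re(1)[of "Inr b"] by (auto simp: diagram_one_row)
    show "1 < Re (((v \<circ> \<sigma>) \<circ> Inr) (conj_part (one_row m) j, j)) \<or>
        1 < Re (((v \<circ> \<sigma>) \<circ> Inr) (i, one_row m i))" if d: "(i, j) \<in> diagram (one_row m)" for i j
    proof -
      have "i = 1" using d by (simp add: diagram_one_row)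
      then show ?thesis using gt(2) Re(2)[of "Inr (1, m)"] by (simp add: one_row_def)
    qed
  qed
qed

lemma E_type_identity:
  fixes v :: "indet \<Rightarrow> complex"
  assumes lam: "is_partition lam"
    and ge: "\<And>b. b \<in> diagram lam \<Longrightarrow> 1 \<le> Re (v (Inr b))"
      "\<And>k. k \<in> {1..n} \<Longrightarrow> 1 \<le> Re (v (Inl (k, 1)))"
    and gt: "\<And>x. x \<in> E_indets lam n \<Longrightarrow> 1 < Re (v x)"
      "1 < Re (v (Inl (n, 1)))" "1 \<le> lam 1 \<Longrightarrow> 1 < Re (v (Inr (1, lam 1)))"
  shows "sym_sum (E_indets lam n)
      (\<lambda>w. schur_zeta (one_column n) (w \<circ> Inl) * schur_zeta lam (w \<circ> Inr)) v =
    sym_sum (E_indets lam n)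
      (\<lambda>w. \<Sum>K\<in>E_set lam n. schur_zeta (add_rows lam K) (push_rows lam K (w \<circ> Inl) (w \<circ> Inr))) v"
\<comment> \<open>Here \<open>lam\<close> is the shape of the second factor, so the chain comes from
  \<open>N\<close> and the counting sequence from \<open>M\<close>.\<close>
proof (rule symmetrized_schur_product[where shape = "add_rows lam" and label = row_label
      and push = "push_rows lam" and rel = "\<lambda>M N K P. column.grows (tab_chain lam N)
        (entry_count (one_column n) M) (tab_chain (add_rows lam K) P)"])
  have part: "is_partition (add_rows lam K)" if "K \<in> E_set lam n" for K
    by (rule vstrip_partition(2)[OF E_setD(1)[OF lam that]])
  note sc = strip_chain_tab_chain[OF lam] and sc' = strip_chain_tab_chain[OF part]
  show "E_indets lam n \<subseteq> Inl ` diagram (one_column n) \<union> Inr ` diagram lam"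
  proof
    fix x assume "x \<in> E_indets lam n"
    then consider k where "1 \<le> k" "k \<le> n" "x = Inl (k, 1)"
      | j where "1 \<le> j" "j \<le> lam 2" "x = Inr (1, j)"
      | i j where "2 \<le> i" "1 \<le> j" "j \<le> lam i" "x = Inr (i, j)"
      by (auto simp: E_indets_def)
    then show "x \<in> Inl ` diagram (one_column n) \<union> Inr ` diagram lam"
    proof cases
      case 2
      then show ?thesis
        using is_partition_antimono[OF lam, of 1 2] by (simp add: diagram_partition[OF lam] image_iff)
    qed (simp_all add: diagram_partition[OF lam] diagram_one_column image_iff)
  qed
  show "finite (E_set lam n)" by (rule finite_E_set[OF lam])
  show "bij_betw (row_label K) (diagram (add_rows lam K))
      (Inl ` diagram (one_column n) \<union> Inr ` diagram lam)" if "K \<in> E_set lam n" for K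
    using bij_betw_row_label[OF lam part[OF that] E_setD(2)[OF lam that]] E_setD(3)[OF lam that] by simp
  show "push_rows lam K (w \<circ> Inl) (w \<circ> Inr) b = w (row_label K b)"
    if "b \<in> diagram (add_rows lam K)" for K w b
    by (rule push_rows_label[OF that])
  show "\<exists>K\<in>E_set lam n. \<exists>P\<in>SSYT (add_rows lam K). column.grows (tab_chain lam N)
      (entry_count (one_column n) M) (tab_chain (add_rows lam K) P)"
    if M: "M \<in> SSYT (one_column n)" and N: "N \<in> SSYT lam" for M N
  proof -
    obtain C nu where C: "strip_chain nu C" "vstrip lam nu"
      and G: "column.grows (tab_chain lam N) (entry_count (one_column n) M) C"
      using column.growth_forward[OF sc[OF N] count_seq_one_column[OF M]] by blast
    obtain w where w: "C w = nu" "tab_chain lam N w = lam" "entry_count (one_column n) M w = n"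
      by (rule column.common_limit[OF sc[OF N] C(1) count_seq_one_column[OF M]])
    have "card (diagram nu) = card (diagram lam) + n"
      using column.grows_card[OF sc[OF N] C(1) count_seq_one_column[OF M] G, of w] w by simp
    then obtain K where K: "K \<in> E_set lam n" "add_rows lam K = nu"
      using vstrip_E_set[OF C(2)] by blast
    obtain P where "P \<in> SSYT nu" "tab_chain nu P = C" by (rule strip_chain_tableau[OF C(1)])
    then show ?thesis using K G by blast
  qed
  show "\<exists>M\<in>SSYT (one_column n). \<exists>N\<in>SSYT lam. column.grows (tab_chain lam N)
      (entry_count (one_column n) M) (tab_chain (add_rows lam K) P)"
    if K: "K \<in> E_set lam n" and P: "P \<in> SSYT (add_rows lam K)" for K P
  proof -
    obtain L S where L: "strip_chain lam L" and S: "column.count_seq n S"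
      and G: "column.grows L S (tab_chain (add_rows lam K) P)"
      by (rule column.growth_backward[OF sc'[OF K P] E_setD(1,4)[OF lam K]])
    obtain N where "N \<in> SSYT lam" "tab_chain lam N = L" by (rule strip_chain_tableau[OF L])
    moreover obtain M where "M \<in> SSYT (one_column n)" "entry_count (one_column n) M = S"
      by (rule count_seq_one_column_tableau[OF S])
    ultimately show ?thesis using G by blast
  qed
  show "K = K' \<and> P = P'"
    if "M \<in> SSYT (one_column n)" "N \<in> SSYT lam" and K: "K \<in> E_set lam n" "K' \<in> E_set lam n"
      and P: "P \<in> SSYT (add_rows lam K)" "P' \<in> SSYT (add_rows lam K')"
      and G: "column.grows (tab_chain lam N) (entry_count (one_column n) M) (tab_chain (add_rows lam K) P)"
        "column.grows (tab_chain lam N) (entry_count (one_column n) M) (tab_chain (add_rows lam K') P')"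
    for M N K P K' P'
  proof -
    have eq: "tab_chain (add_rows lam K) P = tab_chain (add_rows lam K') P'"
      by (rule column.grows_forward_unique[OF sc'[OF K(1) P(1)] sc'[OF K(2) P(2)] G])
    then have "add_rows lam K = add_rows lam K'"
      using strip_chain_limit_unique[OF sc'[OF K(1) P(1)]] sc'[OF K(2) P(2)] by simp
    moreover from this have "K = K'" by (rule add_rows_inject)
    ultimately show ?thesis using tab_chain_inj[OF part[OF K(1)] P(1)] P(2) eq by simp
  qed
  show "M = M' \<and> N = N'"
    if M: "M \<in> SSYT (one_column n)" "M' \<in> SSYT (one_column n)" and N: "N \<in> SSYT lam" "N' \<in> SSYT lam"
      and K: "K \<in> E_set lam n" and P: "P \<in> SSYT (add_rows lam K)"
      and G: "column.grows (tab_chain lam N) (entry_count (one_column n) M) (tab_chain (add_rows lam K) P)"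
        "column.grows (tab_chain lam N') (entry_count (one_column n) M') (tab_chain (add_rows lam K) P)"
    for M N K P M' N'
    using column.grows_backward_unique[OF sc[OF N(1)] sc[OF N(2)] count_seq_one_column[OF M(1)]
        count_seq_one_column[OF M(2)] sc'[OF K P] G]
      tab_chain_inj[OF lam N] entry_count_one_column_inj[OF M] by blast
  show "entry_count (add_rows lam K) P k = entry_count (one_column n) M k + entry_count lam N k"
    if M: "M \<in> SSYT (one_column n)" and N: "N \<in> SSYT lam"
      and K: "K \<in> E_set lam n" and P: "P \<in> SSYT (add_rows lam K)"
      and G: "column.grows (tab_chain lam N) (entry_count (one_column n) M) (tab_chain (add_rows lam K) P)"
    for M N K P k
    using column.grows_card[OF sc[OF N] sc'[OF K P] count_seq_one_column[OF M] G, of k]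
    by (simp add: entry_count_tab_chain[OF lam N] entry_count_tab_chain[OF part[OF K] P])
  show "P b = case_sum M N (row_label K b)"
    if "M \<in> SSYT (one_column n)" "N \<in> SSYT lam" "K \<in> E_set lam n" "P \<in> SSYT (add_rows lam K)"
      "column.grows (tab_chain lam N) (entry_count (one_column n) M) (tab_chain (add_rows lam K) P)"
      "b \<in> diagram (add_rows lam K)" "row_label K b \<notin> E_indets lam n" for M N K P b
    by (rule E_fixed_entries[OF lam that])
  fix \<sigma> assume \<sigma>: "\<sigma> permutes E_indets lam n"
  have "\<forall>x\<in>E_indets lam n. 1 < Re (v x)" using gt(1) by blast
  note Re = Re_permuted[OF \<sigma> this]
  show "(\<lambda>M. norm (zeta_term (diagram (one_column n)) ((v \<circ> \<sigma>) \<circ> Inl) M)) summable_on SSYT (one_column n)"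
  proof (rule summable_on_norm_SSYT[OF is_partition_one_column])
    show "1 \<le> Re (((v \<circ> \<sigma>) \<circ> Inl) b)" if "b \<in> diagram (one_column n)" for b
      using that ge(2)[of "fst b"] Re(1)[of "Inl b"] by (auto simp: diagram_one_column)
    show "1 < Re (((v \<circ> \<sigma>) \<circ> Inl) (conj_part (one_column n) j, j)) \<or>
        1 < Re (((v \<circ> \<sigma>) \<circ> Inl) (i, one_column n i))" if d: "(i, j) \<in> diagram (one_column n)" for i j
    proof -
      have "{i. (i, 1) \<in> diagram (one_column n)} = {1..n}"
        by (auto simp: diagram_one_column)
      then have "conj_part (one_column n) 1 = n" by (simp add: conj_part_def)
      moreover have "j = 1" using d by (simp add: diagram_one_column)
      ultimately show ?thesis using gt(2) Re(2)[of "Inl (n, 1)"] by simp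
    qed
  qed
  show "(\<lambda>N. norm (zeta_term (diagram lam) ((v \<circ> \<sigma>) \<circ> Inr) N)) summable_on SSYT lam"
  proof (rule summable_on_norm_SSYT[OF lam])
    show "1 \<le> Re (((v \<circ> \<sigma>) \<circ> Inr) b)" if "b \<in> diagram lam" for b
      using Re(1)[OF ge(1)[OF that]] by simp
    show "1 < Re (((v \<circ> \<sigma>) \<circ> Inr) (conj_part lam j, j)) \<or> 1 < Re (((v \<circ> \<sigma>) \<circ> Inr) (i, lam i))"
      if d: "(i, j) \<in> diagram lam" for i j
    proof -
      have "1 \<le> i" "i \<le> part_length lam" "1 \<le> lam i" using d by (simp_all add: diagram_def)
      \<comment> \<open>Row ends replace the feet of columns: from row 2 on they are symmetrised,
        and the first row has its own hypothesis.\<close>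
      then have "Inr (i, lam i) \<in> E_indets lam n \<or> 1 < Re (v (Inr (i, lam i)))"
        using gt(3) by (cases "i = 1") (auto simp: E_indets_def)
      then show ?thesis using Re(2) by simp
    qed
  qed
qed

theorem theorem1p5:
  fixes lam :: "nat \<Rightarrow> nat"
  assumes "is_partition lam"
  shows
    "(\<forall>(m::nat) (s :: nat \<times> nat \<Rightarrow> complex) (t :: nat \<times> nat \<Rightarrow> complex).
        m \<ge> 1 \<and>
        s \<in> fillings lam UNIV \<and> t \<in> fillings (one_row m) UNIV \<and>
        (\<forall>b\<in>diagram lam. Re (s b) \<ge> 1) \<and> (\<forall>k\<in>{1..m}. Re (t (1, k)) \<ge> 1) \<and>
        (\<forall>x\<in>H_indets lam m. Re (case_sum s t x) > 1) \<and>
        Re (t (1, m)) > 1 \<and> (lam 1 \<ge> 1 \<longrightarrow> Re (s (conj_part lam 1, 1)) > 1)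
      \<longrightarrow>
        sym_sum (H_indets lam m)
          (\<lambda>v. schur_zeta lam (v \<circ> Inl) * schur_zeta (one_row m) (v \<circ> Inr)) (case_sum s t)
        = sym_sum (H_indets lam m)
          (\<lambda>v. \<Sum>J\<in>H_set lam m.
                 schur_zeta (add_columns lam J) (push_columns lam J (v \<circ> Inl) (v \<circ> Inr)))
          (case_sum s t))
   \<and>
     (\<forall>(n::nat) (s :: nat \<times> nat \<Rightarrow> complex) (t :: nat \<times> nat \<Rightarrow> complex).
        n \<ge> 1 \<and>
        s \<in> fillings (one_column n) UNIV \<and> t \<in> fillings lam UNIV \<and>
        (\<forall>b\<in>diagram lam. Re (t b) \<ge> 1) \<and> (\<forall>k\<in>{1..n}. Re (s (k, 1)) \<ge> 1) \<and>
        (\<forall>x\<in>E_indets lam n. Re (case_sum s t x) > 1) \<and>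
        Re (s (n, 1)) > 1 \<and> (lam 1 \<ge> 1 \<longrightarrow> Re (t (1, lam 1)) > 1)
      \<longrightarrow>
        sym_sum (E_indets lam n)
          (\<lambda>v. schur_zeta (one_column n) (v \<circ> Inl) * schur_zeta lam (v \<circ> Inr)) (case_sum s t)
        = sym_sum (E_indets lam n)
          (\<lambda>v. \<Sum>K\<in>E_set lam n.
                 schur_zeta (add_rows lam K) (push_rows lam K (v \<circ> Inl) (v \<circ> Inr)))
          (case_sum s t))"
proof (intro conjI allI impI; elim conjE)
  fix m s t
  assume "\<forall>b\<in>diagram lam. 1 \<le> Re (s b)" "\<forall>k\<in>{1..m}. 1 \<le> Re (t (1, k))"
    "\<forall>x\<in>H_indets lam m. 1 < Re (case_sum s t x)" "1 < Re (t (1, m))"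
    "1 \<le> lam 1 \<longrightarrow> 1 < Re (s (conj_part lam 1, 1))"
  then show "sym_sum (H_indets lam m)
          (\<lambda>v. schur_zeta lam (v \<circ> Inl) * schur_zeta (one_row m) (v \<circ> Inr)) (case_sum s t)
        = sym_sum (H_indets lam m)
          (\<lambda>v. \<Sum>J\<in>H_set lam m.
                 schur_zeta (add_columns lam J) (push_columns lam J (v \<circ> Inl) (v \<circ> Inr)))
          (case_sum s t)"
    by (intro H_type_identity assms) simp_all
next
  fix n s t
  assume "\<forall>b\<in>diagram lam. 1 \<le> Re (t b)" "\<forall>k\<in>{1..n}. 1 \<le> Re (s (k, 1))"
    "\<forall>x\<in>E_indets lam n. 1 < Re (case_sum s t x)" "1 < Re (s (n, 1))"
    "1 \<le> lam 1 \<longrightarrow> 1 < Re (t (1, lam 1))"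
  then show "sym_sum (E_indets lam n)
          (\<lambda>v. schur_zeta (one_column n) (v \<circ> Inl) * schur_zeta lam (v \<circ> Inr)) (case_sum s t)
        = sym_sum (E_indets lam n)
          (\<lambda>v. \<Sum>K\<in>E_set lam n.
                 schur_zeta (add_rows lam K) (push_rows lam K (v \<circ> Inl) (v \<circ> Inr)))
          (case_sum s t)"
    by (intro E_type_identity assms) simp_all
qed

end
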